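(* Let $X,Y$ be a pair of connected graphs, neither of which is $P_3$ or $P_4$. Then there is a constant $k_{XY}$ such that every connected $(X,Y)$-free graph $G$ satisfies $rvc(G)\leq diam(G)+k_{XY}$ if and only if, up to swapping $X$ and $Y$, either $X=P_5$ and $Y$ is an induced subgraph of $K_t^h$ for some $t\geq 4$, or $X$ is an induced subgraph of $S_{1,2,2}$ and $Y$ is an induced subgraph of $N$.
   Context: All graphs are simple, finite, undirected. For a graph $G$ with a vertex-coloring (adjacent vertices may share colors), a path is vertex-rainbow if its internal vertices have pairwise distinct colors; $G$ is rainbow vertex-connected if every two distinct vertices are joined by a vertex-rainbow path. For a connected graph $G$, $rvc(G)$ is the minimum number of colors in a vertex-coloring making $G$ rainbow vertex-connected (complete graphs have $rvc=0$). $diam(G)$ is the diameter. $P_k$ is the path on $k$ vertices. $G$ is $(X,Y)$-free if it contains no induced subgraph isomorphic to $X$ or to $Y$. $K_t^h$ is the graph obtained from the complete graph $K_t$ by attaching a pendant edge to each vertex. $S_{1,2,2}$ is the graph obtained by identifying one endvertex from each of three vertex-disjoint paths of lengths $1,2,2$. $N$ (the net) is the graph obtained by attaching a pendant edge to each vertex of a triangle.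
   Formalization: X and Y are also assumed to have at least 3 vertices (not K_1 or K_2): for X=K_2, Y=K_5 the bound holds trivially but neither alternative does, so the claim as written fails. The graphs G are taken with natural numbers as vertices, which covers all finite graphs up to isomorphism. *)

theory Defs
  imports Main
begin

datatype 'a ugraph = UGraph (verts: "'a set") (edges: "'a set set")

definition simple_graph :: "'a ugraph \<Rightarrow> bool" where
  "simple_graph G \<longleftrightarrow> finite (verts G) \<and> (\<forall>e\<in>edges G. e \<subseteq> verts G \<and> card e = 2)"

definition adj :: "'a ugraph \<Rightarrow> 'a \<Rightarrow> 'a \<Rightarrow> bool" where
  "adj G u v \<longleftrightarrow> {u, v} \<in> edges G"

definition path_between :: "'a ugraph \<Rightarrow> 'a \<Rightarrow> 'a \<Rightarrow> 'a list \<Rightarrow> bool" where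
  "path_between G u v p \<longleftrightarrow>
     p \<noteq> [] \<and> hd p = u \<and> last p = v \<and> distinct p \<and> set p \<subseteq> verts G \<and> successively (adj G) p"

definition connected_graph :: "'a ugraph \<Rightarrow> bool" where
  "connected_graph G \<longleftrightarrow>
     verts G \<noteq> {} \<and> (\<forall>u\<in>verts G. \<forall>v\<in>verts G. \<exists>p. path_between G u v p)"

definition graph_dist :: "'a ugraph \<Rightarrow> 'a \<Rightarrow> 'a \<Rightarrow> nat" where
  "graph_dist G u v = (LEAST n. \<exists>p. path_between G u v p \<and> length p = Suc n)"

definition diam :: "'a ugraph \<Rightarrow> nat" where
  "diam G = Max {graph_dist G u v |u v. u \<in> verts G \<and> v \<in> verts G}"

text \<open>For a path \<open>p\<close>, the list \<open>butlast (tl p)\<close> consists of its internal vertices.\<close>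

definition vertex_rainbow :: "('a \<Rightarrow> nat) \<Rightarrow> 'a list \<Rightarrow> bool" where
  "vertex_rainbow c p \<longleftrightarrow> inj_on c (set (butlast (tl p)))"

definition rainbow_vertex_connected :: "'a ugraph \<Rightarrow> ('a \<Rightarrow> nat) \<Rightarrow> bool" where
  "rainbow_vertex_connected G c \<longleftrightarrow>
     (\<forall>u\<in>verts G. \<forall>v\<in>verts G. u \<noteq> v \<longrightarrow> (\<exists>p. path_between G u v p \<and> vertex_rainbow c p))"

definition is_complete :: "'a ugraph \<Rightarrow> bool" where
  "is_complete G \<longleftrightarrow> (\<forall>u\<in>verts G. \<forall>v\<in>verts G. u \<noteq> v \<longrightarrow> adj G u v)"

text \<open>Complete graphs are given the value 0 by convention: a colouring of a nonempty vertex set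
  always uses at least one colour.\<close>

definition rvc :: "'a ugraph \<Rightarrow> nat" where
  "rvc G = (if is_complete G then 0
            else (LEAST k. \<exists>c. rainbow_vertex_connected G c \<and> card (c ` verts G) = k))"

definition graph_iso :: "'a ugraph \<Rightarrow> 'b ugraph \<Rightarrow> bool" where
  "graph_iso G H \<longleftrightarrow>
     (\<exists>f. bij_betw f (verts G) (verts H) \<and>
          (\<forall>u\<in>verts G. \<forall>v\<in>verts G. adj G u v \<longleftrightarrow> adj H (f u) (f v)))"

definition induced_by :: "'a ugraph \<Rightarrow> 'a set \<Rightarrow> 'a ugraph" where
  "induced_by G S = UGraph S {e \<in> edges G. e \<subseteq> S}"

text \<open>As usual, being an induced subgraph is understood up to isomorphism.\<close>

definition induced_subgraph_of :: "'a ugraph \<Rightarrow> 'b ugraph \<Rightarrow> bool" where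
  "induced_subgraph_of H G \<longleftrightarrow> (\<exists>S \<subseteq> verts G. graph_iso H (induced_by G S))"

definition pair_free :: "'a ugraph \<Rightarrow> 'b ugraph \<Rightarrow> 'c ugraph \<Rightarrow> bool" where
  "pair_free X Y G \<longleftrightarrow> \<not> induced_subgraph_of X G \<and> \<not> induced_subgraph_of Y G"

definition path_graph :: "nat \<Rightarrow> nat ugraph" where
  "path_graph k = UGraph {..<k} {{i, Suc i} |i. Suc i < k}"

definition complete_graph :: "nat \<Rightarrow> nat ugraph" where
  "complete_graph t = UGraph {..<t} {{i, j} |i j. i < t \<and> j < t \<and> i \<noteq> j}"

text \<open>The vertex \<open>Inr v\<close> is the new leaf attached to the original vertex \<open>Inl v\<close>.\<close>

definition attach_pendants :: "'a ugraph \<Rightarrow> ('a + 'a) ugraph" where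
  "attach_pendants G =
     UGraph (Inl ` verts G \<union> Inr ` verts G)
       ((\<lambda>e. Inl ` e) ` edges G \<union> {{Inl v, Inr v} |v. v \<in> verts G})"

definition K_h :: "nat \<Rightarrow> (nat + nat) ugraph" where
  "K_h t = attach_pendants (complete_graph t)"

definition net :: "(nat + nat) ugraph" where
  "net = attach_pendants (complete_graph 3)"

text \<open>The common endvertex is 0, and the three paths are 0--1, 0--2--3 and 0--4--5.\<close>

definition S122 :: "nat ugraph" where
  "S122 = UGraph {0, 1, 2, 3, 4, 5} {{0, 1}, {0, 2}, {2, 3}, {0, 4}, {4, 5}}"

end

theory Submission
  imports Defs "HOL-Library.Ramsey"
begin

text \<open>
  Boundedness. In a graph without the forbidden pair, the vertices at distance two from any vertex
  \<open>y\<close> are dominated by boundedly many vertices near \<open>y\<close>: a greedy argument otherwise produces a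
  large induced matching between \<open>N(y)\<close> and the second neighbourhood, hence a \<open>P\<^sub>5\<close> or \<open>K\<^sub>t\<^sup>h\<close>, or,
  by Ramsey's theorem, an \<open>S\<^sub>1\<^sub>2\<^sub>2\<close> or a net. Iterating this gives a connected dominating set whose size is
  bounded in terms of the radius, and colouring it injectively settles the \<open>P\<^sub>5\<close>-free case and the
  case of small diameter. If the diameter \<open>d\<close> is large, take a diametral geodesic \<open>P\<close>. A vertex with
  neighbours both on \<open>P\<close> and outside \<open>N[P]\<close> must be adjacent to an end of \<open>P\<close>. So either \<open>P\<close> together
  with bounded sets near its ends dominates, or a shortest detour between the ends outside \<open>N[P]\<close>
  closes \<open>P\<close> up to an induced cycle of length at most \<open>2d + 6\<close>. That cycle dominates, every other vertex
  has two neighbours on it, and a periodic colouring with \<open>d + 3\<close> colours works.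

  Necessity. Cut vertices need pairwise distinct colours, so the graphs \<open>K\<^sub>t\<^sup>h\<close>, the pendant
  extensions of stars and of cycles, and the nets with long legs all have \<open>rvc - diam\<close> unbounded;
  a forbidden pair must therefore hit each of these families.
\<close>


section \<open>Walks, distances and diameter\<close>

text \<open>The diameter must enter with coefficient one, and a long cycle is the obstacle: a
  connected dominating set of about \<open>2d\<close> vertices, coloured injectively, is twice too
  expensive. So equal colours are placed half a turn apart, and a rainbow arc is chosen between
  suitable attachments. This needs the length bound \<open>2d + 6\<close>. It holds because a walk
  from the middle of a shortest detour to the middle of \<open>P\<close> leaves the part outside
  \<open>N[P]\<close> only next to an end of \<open>P\<close>; it pays for half the detour and half
  of \<open>P\<close>, yet some such walk has length at most \<open>d\<close>. The families used for
  necessity interlock. \<open>K_h\<close> contains one of the two graphs, say \<open>X\<close>.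
  Being neither P3 nor P4, \<open>X\<close> has a triangle, so the triangle-free pendant stars and
  pendant cycles both contain \<open>Y\<close>. The former are spiders; the latter have maximum
  degree three, with a leaf next to every vertex of degree three. Hence \<open>Y\<close> is P5, or
  it contains a claw and embeds in \<open>S122\<close>. In the claw case the claw-free long nets
  must contain \<open>X\<close>; having no K4, they leave \<open>X\<close> at most three clique
  vertices, so \<open>X\<close> embeds in \<open>net\<close>.\<close>

lemma distinct_path_of_relpowp:
  assumes "(R ^^ n) u v"
  shows "\<exists>p. p \<noteq> [] \<and> hd p = u \<and> last p = v \<and> distinct p \<and> successively R p \<and> length p \<le> Suc n"
  using assms
proof (induction n arbitrary: u)
  case 0
  then show ?case by (intro exI[of _ "[u]"]) auto
next
  case (Suc n)
  then obtain w where w: "R u w" "(R ^^ n) w v" by (metis relpowp_Suc_E2)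
  from Suc.IH[OF w(2)] obtain p where p: "p \<noteq> []" "hd p = w" "last p = v" "distinct p"
    "successively R p" "length p \<le> Suc n" by blast
  show ?case
  proof (cases "u \<in> set p")
    case False
    then show ?thesis using p w by (intro exI[of _ "u # p"]) (auto simp: successively_Cons)
  next
    case True
    then obtain xs ys where xy: "p = xs @ u # ys" by (meson split_list)
    then have "distinct (u # ys)" "successively R (u # ys)" "last (u # ys) = v" "length (u # ys) \<le> Suc (Suc n)"
      using p by (auto simp: successively_append_iff)
    then show ?thesis by (intro exI[of _ "u # ys"]) auto
  qed
qed

lemma relpowp_of_successively:
  "p \<noteq> [] \<Longrightarrow> successively R p \<Longrightarrow> (R ^^ (length p - 1)) (hd p) (last p)"
proof (induction p)
  case (Cons a p)
  show ?case
  proof (cases "p = []")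
    case False
    with Cons have "R a (hd p)" "(R ^^ (length p - 1)) (hd p) (last p)"
      by (auto simp: successively_Cons)
    then have "(R ^^ Suc (length p - 1)) a (last p)" by (metis relpowp_Suc_I2)
    then show ?thesis using False by simp
  qed auto
qed auto

lemma set_successively:
  "successively R p \<Longrightarrow> p \<noteq> [] \<Longrightarrow> hd p \<in> A \<Longrightarrow> (\<And>x y. R x y \<Longrightarrow> y \<in> A) \<Longrightarrow> set p \<subseteq> A"
proof (induction p)
  case (Cons a p)
  then show ?case by (cases "p = []") (force simp: successively_Cons)+
qed simp

lemma relpowp_sym:
  assumes "\<And>x y. R x y \<Longrightarrow> R y x" and "(R ^^ n) u v"
  shows "(R ^^ n) v u"
  using assms(2)
proof (induction n arbitrary: u)
  case (Suc n)
  then obtain w where "R u w" "(R ^^ n) w v" by (metis relpowp_Suc_E2)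
  then show ?case using Suc.IH assms(1) by (metis relpowp_Suc_I)
qed auto

lemma relpowp_of_fun:
  assumes "\<And>i. a \<le> i \<Longrightarrow> i < b \<Longrightarrow> R (f i) (f (Suc i))" "a \<le> b"
  shows "(R ^^ (b - a)) (f a) (f b)"
  unfolding relpowp_fun_conv using assms by (intro exI[of _ "\<lambda>i. f (a + i)"]) auto

locale sgraph =
  fixes G :: "'a ugraph"
  assumes simple: "simple_graph G"
begin

abbreviation "V \<equiv> verts G"
abbreviation "E \<equiv> adj G"

lemma finV [simp, intro]: "finite V"
  using simple by (auto simp: simple_graph_def)

lemma E_sym: "E x y \<Longrightarrow> E y x"
  by (simp add: adj_def insert_commute)

lemma E_commute: "E x y \<longleftrightarrow> E y x"
  using E_sym by blast

lemma E_irrefl [simp]: "\<not> E x x"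
  using simple by (auto simp: simple_graph_def adj_def)

lemma E_in: "E x y \<Longrightarrow> x \<in> V" "E x y \<Longrightarrow> y \<in> V"
  using simple by (auto simp: simple_graph_def adj_def)

lemma path_of_relpowp:
  assumes "(E ^^ n) u v" "u \<in> V"
  shows "\<exists>p. path_between G u v p \<and> length p \<le> Suc n"
proof -
  from distinct_path_of_relpowp[OF assms(1)] obtain p where p: "p \<noteq> []" "hd p = u" "last p = v"
    "distinct p" "successively E p" "length p \<le> Suc n" by blast
  moreover have "set p \<subseteq> V"
    by (rule set_successively[of E]) (use p assms E_in in auto)
  ultimately show ?thesis by (auto simp: path_between_def)
qed

lemma relpowp_of_path: "path_between G u v p \<Longrightarrow> (E ^^ (length p - 1)) u v"
  by (metis path_between_def relpowp_of_successively)

text \<open>Walks are handled as relation powers, which concatenate and reverse freely, whereas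
  \<open>graph_dist\<close> minimises over paths. The two agree because cutting the loops out of a
  walk leaves a path that is no longer.\<close>

lemma graph_dist_le:
  assumes "(E ^^ n) u v" "u \<in> V"
  shows "graph_dist G u v \<le> n"
proof -
  from path_of_relpowp[OF assms] obtain p where p: "path_between G u v p" "length p \<le> Suc n" by blast
  then have "length p = Suc (length p - 1)" by (simp add: path_between_def)
  then have "graph_dist G u v \<le> length p - 1"
    unfolding graph_dist_def using p by (intro Least_le) blast
  then show ?thesis using p by linarith
qed

end

locale cgraph = sgraph +
  assumes conn: "connected_graph G"
begin

lemma V_nonempty: "V \<noteq> {}"
  using conn by (simp add: connected_graph_def)

lemma relpowp_dist:
  assumes "u \<in> V" "v \<in> V"
  shows "(E ^^ graph_dist G u v) u v"
proof -
  obtain p where p: "path_between G u v p"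
    using conn assms by (auto simp: connected_graph_def)
  then have "\<exists>n q. path_between G u v q \<and> length q = Suc n"
    by (intro exI[of _ "length p - 1"] exI[of _ p]) (auto simp: path_between_def)
  then have "\<exists>q. path_between G u v q \<and> length q = Suc (graph_dist G u v)"
    unfolding graph_dist_def by (rule LeastI_ex)
  then show ?thesis by (metis relpowp_of_path diff_Suc_1)
qed

lemma finite_dists: "finite {graph_dist G u v |u v. u \<in> V \<and> v \<in> V}"
proof -
  have "{graph_dist G u v |u v. u \<in> V \<and> v \<in> V} = (\<lambda>(u,v). graph_dist G u v) ` (V \<times> V)" by auto
  then show ?thesis by simp
qed

lemma diam_walk:
  assumes "u \<in> V" "v \<in> V"
  shows "\<exists>n\<le>diam G. (E ^^ n) u v"
proof -
  have "graph_dist G u v \<le> diam G"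
    unfolding diam_def by (rule Max_ge[OF finite_dists]) (use assms in auto)
  then show ?thesis using relpowp_dist[OF assms] by blast
qed

lemma diam_le:
  assumes "\<And>u v. u \<in> V \<Longrightarrow> v \<in> V \<Longrightarrow> \<exists>n\<le>m. (E ^^ n) u v"
  shows "diam G \<le> m"
proof -
  have "graph_dist G u v \<le> m" if "u \<in> V" "v \<in> V" for u v
    using assms[OF that] graph_dist_le that order_trans by blast
  moreover have "{graph_dist G u v |u v. u \<in> V \<and> v \<in> V} \<noteq> {}" using V_nonempty by auto
  ultimately show ?thesis
    unfolding diam_def by (subst Max_le_iff[OF finite_dists]) auto
qed

lemma diametral_geodesic:
  obtains f where "\<And>i. i < diam G \<Longrightarrow> E (f i) (f (Suc i))" "\<And>i. i \<le> diam G \<Longrightarrow> f i \<in> V"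
    "\<And>n. (E ^^ n) (f 0) (f (diam G)) \<Longrightarrow> diam G \<le> n"
proof -
  have "diam G \<in> {graph_dist G u v |u v. u \<in> V \<and> v \<in> V}"
    unfolding diam_def by (rule Max_in[OF finite_dists]) (use V_nonempty in auto)
  then obtain u v where uv: "u \<in> V" "v \<in> V" "diam G = graph_dist G u v" by auto
  then obtain f where f: "f 0 = u" "f (diam G) = v" "\<forall>i<diam G. E (f i) (f (Suc i))"
    using relpowp_dist[of u v] by (auto simp: relpowp_fun_conv)
  have "f i \<in> V" if "i \<le> diam G" for i
    using that f uv E_in by (cases i) (auto simp: Suc_le_eq)
  then show thesis using that[of f] f uv graph_dist_le by auto
qed

end

section \<open>Bounds for the rainbow vertex-connection number\<close>

lemma rvc_le:
  assumes "rainbow_vertex_connected G c"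
  shows "rvc G \<le> card (c ` verts G)"
  unfolding rvc_def using assms by (auto intro: Least_le)

context cgraph
begin

text \<open>Since \<open>rvc\<close> is a \<open>LEAST\<close>, a lower bound also needs some
  admissible colouring to exist. An injective one serves: it makes every path rainbow, and
  connectedness supplies the paths.\<close>

lemma rvc_ge:
  assumes "\<not> is_complete G"
    and "\<And>c. rainbow_vertex_connected G c \<Longrightarrow> m \<le> card (c ` V)"
  shows "m \<le> rvc G"
proof -
  obtain c :: "'a \<Rightarrow> nat" where c: "inj_on c V"
    using finV finite_imp_inj_to_nat_seg by metis
  have "rainbow_vertex_connected G c"
    unfolding rainbow_vertex_connected_def
  proof (intro ballI impI)
    fix u v assume "u \<in> V" "v \<in> V"
    then obtain p where p: "path_between G u v p" using conn by (auto simp: connected_graph_def)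
    have "set (butlast (tl p)) \<subseteq> set p" by (cases p) (auto dest: in_set_butlastD)
    then have "vertex_rainbow c p"
      unfolding vertex_rainbow_def using p by (intro inj_on_subset[OF c]) (auto simp: path_between_def)
    then show "\<exists>p. path_between G u v p \<and> vertex_rainbow c p" using p by blast
  qed
  then have "\<exists>k c. rainbow_vertex_connected G c \<and> card (c ` V) = k" by blast
  then have "\<exists>c. rainbow_vertex_connected G c \<and> card (c ` V) = (LEAST k. \<exists>c. rainbow_vertex_connected G c \<and> card (c ` V) = k)"
    by (rule LeastI_ex)
  then obtain c' where "rainbow_vertex_connected G c'"
    "card (c' ` V) = (LEAST k. \<exists>c. rainbow_vertex_connected G c \<and> card (c ` V) = k)" by blast
  then show ?thesis using assms by (simp add: rvc_def) metis
qed

end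

section \<open>Colourings from connected dominating sets\<close>

context sgraph
begin

text \<open>Adjacency of the subgraph induced on \<open>S\<close>, kept as a relation so that its
  closure and its powers express reachability and walks inside \<open>S\<close>.\<close>

definition EU :: "'a set \<Rightarrow> 'a \<Rightarrow> 'a \<Rightarrow> bool" where
  "EU S x y \<longleftrightarrow> E x y \<and> x \<in> S \<and> y \<in> S"

lemma EU_sym: "EU S x y \<Longrightarrow> EU S y x"
  using E_sym by (auto simp: EU_def)

lemma EU_mono: "S \<subseteq> T \<Longrightarrow> (EU S)\<^sup>*\<^sup>* x y \<Longrightarrow> (EU T)\<^sup>*\<^sup>* x y"
  by (rule rtranclp_mono[THEN predicate2D, rotated]) (auto simp: EU_def)

text \<open>Loops are cut out of the connection, so \<open>u\<close> and \<open>v\<close> occur only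
  at its ends and all internal vertices lie in \<open>S - {u,v}\<close>. The colours of
  \<open>u\<close> and \<open>v\<close> themselves may therefore repeat.\<close>

lemma rainbow_vertex_connectedI:
  assumes "\<And>u v. u \<in> V \<Longrightarrow> v \<in> V \<Longrightarrow> u \<noteq> v \<Longrightarrow> \<exists>S\<subseteq>V. inj_on c (S - {u,v}) \<and> (EU (insert u (insert v S)))\<^sup>*\<^sup>* u v"
  shows "rainbow_vertex_connected G c"
  unfolding rainbow_vertex_connected_def
proof (intro ballI impI)
  fix u v assume uv: "u \<in> V" "v \<in> V" "u \<noteq> v"
  then obtain S where S: "S \<subseteq> V" "inj_on c (S - {u,v})" "(EU (insert u (insert v S)))\<^sup>*\<^sup>* u v"
    using assms by blast
  let ?T = "insert u (insert v S)"
  from S(3) obtain n where "(EU ?T ^^ n) u v" by (metis rtranclp_imp_relpowp)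
  from distinct_path_of_relpowp[OF this] obtain p where p: "p \<noteq> []" "hd p = u" "last p = v"
    "distinct p" "successively (EU ?T) p" by blast
  have T: "set p \<subseteq> ?T"
    by (rule set_successively[OF p(5)]) (use p in \<open>auto simp: EU_def\<close>)
  have "successively E p"
    by (rule successively_mono[OF p(5)]) (auto simp: EU_def)
  then have path: "path_between G u v p"
    using p T S uv by (auto simp: path_between_def)
  have "set (butlast (tl p)) \<subseteq> set p - {u, v}"
  proof (cases "tl p = []")
    case True
    then show ?thesis by simp
  next
    case False
    then have *: "p = u # butlast (tl p) @ [v]"
      using p by (metis append_butlast_last_id last_tl list.collapse)
    have "distinct (u # butlast (tl p) @ [v])" "set p = set (u # butlast (tl p) @ [v])"
      using p(4) * by metis+
    then show ?thesis by auto
  qed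
  then have "set (butlast (tl p)) \<subseteq> S - {u, v}" using T by auto
  then have "vertex_rainbow c p"
    unfolding vertex_rainbow_def using S(2) inj_on_subset by blast
  then show "\<exists>p. path_between G u v p \<and> vertex_rainbow c p" using path by blast
qed

definition dominates :: "'a set \<Rightarrow> 'a \<Rightarrow> bool" where
  "dominates D v \<longleftrightarrow> (\<exists>d\<in>D. v = d \<or> E d v)"

lemma dominates_mono: "D \<subseteq> D' \<Longrightarrow> dominates D v \<Longrightarrow> dominates D' v"
  by (auto simp: dominates_def)

text \<open>The induced subgraph on \<open>D\<close> is connected, except that the empty set also
  counts; nonemptiness is asked for separately in \<open>expand_linked\<close>.\<close>

definition linked :: "'a set \<Rightarrow> bool" where
  "linked D \<longleftrightarrow> (\<forall>u\<in>D. \<forall>v\<in>D. (EU D)\<^sup>*\<^sup>* u v)"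

lemma EU_reachable_sym: "(EU S)\<^sup>*\<^sup>* x y \<Longrightarrow> (EU S)\<^sup>*\<^sup>* y x"
  by (induction rule: rtranclp_induct) (auto intro: converse_rtranclp_into_rtranclp EU_sym)

lemma linkedI:
  assumes "r \<in> D" "\<And>v. v \<in> D \<Longrightarrow> (EU D)\<^sup>*\<^sup>* r v"
  shows "linked D"
  unfolding linked_def using assms EU_reachable_sym by (meson rtranclp_trans)

text \<open>\<open>D\<close> is coloured injectively and all other vertices share the colour 0,
  which accounts for the extra one. Any two vertices are joined through their dominators, with all
  internal vertices in \<open>D\<close>.\<close>

lemma rvc_le_connected_dominating:
  assumes D: "D \<subseteq> V" "linked D" "\<And>v. v \<in> V \<Longrightarrow> dominates D v"
  shows "rvc G \<le> card D + 1"
proof -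
  have fin: "finite D" using D finite_subset by blast
  obtain h :: "'a \<Rightarrow> nat" where h: "inj_on h D"
    using fin finite_imp_inj_to_nat_seg by metis
  define c where "c v = (if v \<in> D then h v else 0)" for v
  have "rainbow_vertex_connected G c"
  proof (rule rainbow_vertex_connectedI)
    fix u v assume uv: "u \<in> V" "v \<in> V" "u \<noteq> v"
    let ?T = "insert u (insert v D)"
    obtain a b where ab: "a \<in> D" "u = a \<or> E a u" "b \<in> D" "v = b \<or> E b v"
      using D(3)[OF uv(1)] D(3)[OF uv(2)] unfolding dominates_def by blast
    have "(EU D)\<^sup>*\<^sup>* a b" using ab D by (auto simp: linked_def)
    then have 1: "(EU ?T)\<^sup>*\<^sup>* a b" by (rule EU_mono[rotated]) auto
    have 2: "(EU ?T)\<^sup>*\<^sup>* u a" using ab E_sym by (auto simp: EU_def)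
    have 3: "(EU ?T)\<^sup>*\<^sup>* b v" using ab E_sym by (auto simp: EU_def)
    have "inj_on c (D - {u,v})" using h by (auto simp: inj_on_def c_def)
    then show "\<exists>S\<subseteq>V. inj_on c (S - {u,v}) \<and> (EU (insert u (insert v S)))\<^sup>*\<^sup>* u v"
      using D(1) 1 2 3 by (meson rtranclp_trans)
  qed
  then have "rvc G \<le> card (c ` V)" by (rule rvc_le)
  also have "\<dots> \<le> card (insert 0 (h ` D))"
    by (rule card_mono) (use fin in \<open>auto simp: c_def\<close>)
  also have "\<dots> \<le> card D + 1"
    using card_image_le[OF fin, of h] by (simp add: card_insert_if fin)
  finally show ?thesis .
qed

end

section \<open>Induced subgraphs\<close>

lemma adj_induced_by: "adj (induced_by G S) u v \<longleftrightarrow> adj G u v \<and> u \<in> S \<and> v \<in> S"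
  by (auto simp: adj_def induced_by_def)

lemma induced_subgraph_of_iff:
  "induced_subgraph_of H G \<longleftrightarrow> (\<exists>f. inj_on f (verts H) \<and> f ` verts H \<subseteq> verts G \<and>
     (\<forall>u\<in>verts H. \<forall>v\<in>verts H. adj H u v \<longleftrightarrow> adj G (f u) (f v)))" (is "?L \<longleftrightarrow> ?R")
proof
  assume ?L
  then obtain S f where "S \<subseteq> verts G" "bij_betw f (verts H) S"
    "\<forall>u\<in>verts H. \<forall>v\<in>verts H. adj H u v \<longleftrightarrow> adj (induced_by G S) (f u) (f v)"
    by (auto simp: induced_subgraph_of_def graph_iso_def induced_by_def)
  then show ?R by (intro exI[of _ f]) (auto simp: adj_induced_by bij_betw_def)
next
  assume ?R
  then obtain f where f: "inj_on f (verts H)" "f ` verts H \<subseteq> verts G"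
    "\<forall>u\<in>verts H. \<forall>v\<in>verts H. adj H u v \<longleftrightarrow> adj G (f u) (f v)" by blast
  have "verts (induced_by G (f ` verts H)) = f ` verts H" by (simp add: induced_by_def)
  then have "graph_iso H (induced_by G (f ` verts H))"
    unfolding graph_iso_def using f by (intro exI[of _ f]) (auto simp: adj_induced_by bij_betw_def)
  then show ?L using f by (auto simp: induced_subgraph_of_def)
qed

lemma induced_subgraph_of_trans:
  assumes "induced_subgraph_of H G" "induced_subgraph_of G K"
  shows "induced_subgraph_of H K"
proof -
  obtain f where f: "inj_on f (verts H)" "f ` verts H \<subseteq> verts G"
    "\<forall>u\<in>verts H. \<forall>v\<in>verts H. adj H u v \<longleftrightarrow> adj G (f u) (f v)"
    using assms(1) unfolding induced_subgraph_of_iff by blast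
  obtain g where g: "inj_on g (verts G)" "g ` verts G \<subseteq> verts K"
    "\<forall>u\<in>verts G. \<forall>v\<in>verts G. adj G u v \<longleftrightarrow> adj K (g u) (g v)"
    using assms(2) unfolding induced_subgraph_of_iff by blast
  have "inj_on (g \<circ> f) (verts H)" using f g by (intro comp_inj_on) (auto intro: inj_on_subset)
  moreover have "(g \<circ> f) ` verts H \<subseteq> verts K"
    using f(2) g(2) by (simp add: image_subset_iff)
  moreover have "\<forall>u\<in>verts H. \<forall>v\<in>verts H. adj H u v \<longleftrightarrow> adj K ((g \<circ> f) u) ((g \<circ> f) v)"
    using f g by (simp add: image_subset_iff)
  ultimately show ?thesis unfolding induced_subgraph_of_iff by blast
qed

lemma induced_subgraph_of_iso: "graph_iso H G \<Longrightarrow> induced_subgraph_of H G"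
  unfolding induced_subgraph_of_iff graph_iso_def by (metis bij_betw_def subset_refl)

lemma verts_path_graph [simp]: "verts (path_graph k) = {..<k}"
  by (simp add: path_graph_def)

lemma adj_path_graph: "adj (path_graph k) i j \<longleftrightarrow> (j = Suc i \<and> j < k) \<or> (i = Suc j \<and> i < k)"
  by (auto simp: adj_def path_graph_def doubleton_eq_iff)

lemma verts_complete_graph [simp]: "verts (complete_graph k) = {..<k}"
  by (simp add: complete_graph_def)

lemma adj_complete_graph: "adj (complete_graph k) i j \<longleftrightarrow> i < k \<and> j < k \<and> i \<noteq> j"
  by (auto simp: adj_def complete_graph_def doubleton_eq_iff)

lemma verts_attach_pendants [simp]: "verts (attach_pendants H) = Inl ` verts H \<union> Inr ` verts H"
  by (simp add: attach_pendants_def)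

lemma adj_attach_pendants [simp]:
  "adj (attach_pendants H) (Inl a) (Inl b) \<longleftrightarrow> adj H a b"
  "adj (attach_pendants H) (Inl a) (Inr b) \<longleftrightarrow> a = b \<and> a \<in> verts H"
  "adj (attach_pendants H) (Inr a) (Inl b) \<longleftrightarrow> a = b \<and> a \<in> verts H"
  "\<not> adj (attach_pendants H) (Inr a) (Inr b)"
proof -
  have inj: "inj ((`) (Inl :: 'a \<Rightarrow> 'a + 'a))" by (auto intro!: injI simp: inj_image_eq_iff)
  have "{Inl a, Inl b} \<in> (`) (Inl :: 'a \<Rightarrow> 'a + 'a) ` edges H \<longleftrightarrow> {a, b} \<in> edges H"
    using inj_image_mem_iff[OF inj, of "{a, b}" "edges H"] by simp
  then show "adj (attach_pendants H) (Inl a) (Inl b) \<longleftrightarrow> adj H a b"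
    by (auto simp: adj_def attach_pendants_def doubleton_eq_iff)
  have ne: "{x, Inr y} \<noteq> Inl ` e" for x y and e :: "'a set" by blast
  show "adj (attach_pendants H) (Inl a) (Inr b) \<longleftrightarrow> a = b \<and> a \<in> verts H"
    using ne by (auto simp: adj_def attach_pendants_def doubleton_eq_iff)
  then show "adj (attach_pendants H) (Inr a) (Inl b) \<longleftrightarrow> a = b \<and> a \<in> verts H"
    using ne[of "Inl b" a] by (auto simp: adj_def attach_pendants_def doubleton_eq_iff insert_commute[of "Inr a"])
  show "\<not> adj (attach_pendants H) (Inr a) (Inr b)"
    using ne by (auto simp: adj_def attach_pendants_def doubleton_eq_iff)
qed

lemma net_eq: "net = K_h 3"
  by (simp add: net_def K_h_def)

lemma induced_K_h_mono:
  assumes "s \<le> t"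
  shows "induced_subgraph_of (K_h s) (K_h t)"
  unfolding induced_subgraph_of_iff K_h_def
  by (intro exI[of _ id]) (use assms in \<open>auto simp: adj_complete_graph\<close>)

lemma verts_S122: "verts S122 = {0,1,2,3,4,5}"
  by (simp add: S122_def)

lemma adj_S122: "adj S122 i j \<longleftrightarrow> (i,j) \<in> {(0,1),(1,0),(0,2),(2,0),(2,3),(3,2),(0,4),(4,0),(4,5),(5,4)}"
  by (auto simp: adj_def S122_def doubleton_eq_iff)

context sgraph
begin

text \<open>Distinctness of the \<open>2 * t\<close> vertices is derived rather than assumed: for
  each pair, some prescribed adjacency holds for one of the two and fails for the other.\<close>

lemma induced_K_hI:
  assumes "\<And>i. i < t \<Longrightarrow> x i \<in> V" "\<And>i. i < t \<Longrightarrow> u i \<in> V"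
    and "\<And>i j. i < t \<Longrightarrow> j < t \<Longrightarrow> i \<noteq> j \<Longrightarrow> E (x i) (x j)"
    and "\<And>i j. i < t \<Longrightarrow> j < t \<Longrightarrow> E (x i) (u j) \<longleftrightarrow> i = j"
    and "\<And>i j. i < t \<Longrightarrow> j < t \<Longrightarrow> \<not> E (u i) (u j)"
  shows "induced_subgraph_of (K_h t) G"
proof -
  let ?f = "case_sum x u"
  have adj: "\<forall>a\<in>verts (K_h t). \<forall>b\<in>verts (K_h t). adj (K_h t) a b \<longleftrightarrow> E (?f a) (?f b)"
    using assms by (auto simp: K_h_def adj_complete_graph E_commute[of "u _" "x _"])
  have 1: "x i \<noteq> x j" if "i < t" "j < t" "i \<noteq> j" for i j using assms(3)[OF that] by auto
  have 2: "u i \<noteq> u j" if "i < t" "j < t" "i \<noteq> j" for i j using assms(4) that by metis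
  have 3: "x i \<noteq> u j" if "i < t" "j < t" for i j
    using that assms(3)[of i j] assms(4) assms(5) E_irrefl by metis
  have "inj_on ?f (verts (K_h t))"
    using 1 2 3 by (auto simp: inj_on_def K_h_def split: sum.split) metis+
  moreover have "?f ` verts (K_h t) \<subseteq> V" using assms by (auto simp: K_h_def)
  ultimately show ?thesis unfolding induced_subgraph_of_iff using adj by blast
qed

lemma induced_netI:
  assumes "E a b" "E b c" "E a c" "E a a'" "E b b'" "E c c'"
    "\<not> E a b'" "\<not> E a c'" "\<not> E b a'" "\<not> E b c'" "\<not> E c a'" "\<not> E c b'"
    "\<not> E a' b'" "\<not> E a' c'" "\<not> E b' c'"
  shows "induced_subgraph_of net G"
proof -
  define x where "x i = (if i = 0 then a else if i = 1 then b else c)" for i :: nat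
  define u where "u i = (if i = 0 then a' else if i = 1 then b' else c')" for i :: nat
  have x: "x 0 = a" "x 1 = b" "x 2 = c" and u: "u 0 = a'" "u 1 = b'" "u 2 = c'"
    by (simp_all add: x_def u_def)
  have three: "i = 0 \<or> i = 1 \<or> i = 2" if "i < 3" for i :: nat using that by auto
  have sym: "E b a" "E c b" "E c a" "\<not> E b' a'" "\<not> E c' a'" "\<not> E c' b'"
    using assms by (simp_all add: E_commute)
  have "a \<in> V" "b \<in> V" "c \<in> V" "a' \<in> V" "b' \<in> V" "c' \<in> V"
    using E_in[OF assms(4)] E_in[OF assms(5)] E_in[OF assms(6)] by simp_all
  then have "x i \<in> V" "u i \<in> V" if "i < 3" for i
    using three[OF that] x u by auto
  moreover have "E (x i) (x j)" if "i < 3" "j < 3" "i \<noteq> j" for i j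
    using three[OF that(1)] three[OF that(2)] that assms(1-3) sym x by auto
  moreover have "E (x i) (u j) \<longleftrightarrow> i = j" if "i < 3" "j < 3" for i j
    using three[OF that(1)] three[OF that(2)] assms(4-12) x u by auto
  moreover have "\<not> E (u i) (u j)" if "i < 3" "j < 3" for i j
    using three[OF that(1)] three[OF that(2)] assms(13-15) sym u by auto
  ultimately show ?thesis unfolding net_eq by (rule induced_K_hI)
qed

lemma induced_S122I:
  assumes "E c a" "E c b" "E b b'" "E c d" "E d d'"
    "\<not> E c b'" "\<not> E c d'" "\<not> E a b" "\<not> E a b'" "\<not> E a d" "\<not> E a d'"
    "\<not> E b d" "\<not> E b d'" "\<not> E b' d" "\<not> E b' d'"
  shows "induced_subgraph_of S122 G"
proof -
  let ?f = "\<lambda>i::nat. if i = 0 then c else if i = 1 then a else if i = 2 then b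
     else if i = 3 then b' else if i = 4 then d else d'"
  have sym: "E a c" "E b c" "E b' b" "E d c" "E d' d"
    "\<not> E b' c" "\<not> E d' c" "\<not> E b a" "\<not> E b' a" "\<not> E d a" "\<not> E d' a"
    "\<not> E d b" "\<not> E d' b" "\<not> E d b'" "\<not> E d' b'"
    using assms E_sym by blast+
  have ne: "c \<noteq> a" "c \<noteq> b" "c \<noteq> b'" "c \<noteq> d" "c \<noteq> d'" "a \<noteq> b" "a \<noteq> b'" "a \<noteq> d" "a \<noteq> d'"
    "b \<noteq> b'" "b \<noteq> d" "b \<noteq> d'" "b' \<noteq> d" "b' \<noteq> d'" "d \<noteq> d'"
    using assms sym E_irrefl by metis+
  have "inj_on ?f (verts S122)" using ne ne[symmetric] by (auto simp: inj_on_def verts_S122)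
  moreover have "?f ` verts S122 \<subseteq> V" using assms E_in by (auto simp: verts_S122)
  moreover have "\<forall>u\<in>verts S122. \<forall>v\<in>verts S122. adj S122 u v \<longleftrightarrow> E (?f u) (?f v)"
    using assms(1-15) sym by (simp add: verts_S122 adj_S122)
  ultimately show ?thesis unfolding induced_subgraph_of_iff by blast
qed

text \<open>Injectivity follows because two positions with equal images would have the same
  neighbours on the path. The two ends of P3 do have the same neighbour, so \<open>k = 3\<close> has
  to be excluded.\<close>

lemma induced_pathI:
  assumes "\<And>i. i < k \<Longrightarrow> q i \<in> V" "\<And>i j. i < j \<Longrightarrow> j < k \<Longrightarrow> E (q i) (q j) \<longleftrightarrow> j = Suc i" "k \<noteq> 2" "k \<noteq> 3"
  shows "induced_subgraph_of (path_graph k) G"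
proof -
  have adj: "E (q i) (q j) \<longleftrightarrow> j = Suc i \<or> i = Suc j" if "i < k" "j < k" for i j
    using assms(2)[of i j] assms(2)[of j i] that E_commute[of "q i" "q j"]
    by (cases i j rule: linorder_cases) auto
  have "q i \<noteq> q j" if "i < j" "j < k" for i j
  proof
    assume eq: "q i = q j"
    have *: "m = Suc i \<or> i = Suc m \<longleftrightarrow> m = Suc j \<or> j = Suc m" if "m < k" for m
      using adj[of m i] adj[of m j] that \<open>i < j\<close> \<open>j < k\<close> eq by auto
    show False
      using *[of i] *[of j] *[of "Suc i"] *[of "j - 1"] *[of "Suc j"] *[of "i - 1"] that assms(3,4)
      by (cases "Suc j < k"; cases i) auto
  qed
  then have "inj_on q {..<k}" by (auto simp: inj_on_def) (metis linorder_neqE_nat)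
  then show ?thesis unfolding induced_subgraph_of_iff using adj assms(1)
    by (intro exI[of _ q]) (auto simp: adj_path_graph)
qed

lemma E_walk_sym:
  assumes "(E ^^ n) x y"
  shows "(E ^^ n) y x"
  by (rule relpowp_sym[of E]) (use assms E_sym in blast)+

text \<open>Replacing the stretch between \<open>f i\<close> and \<open>f j\<close> by the given
  walk yields a walk between the ends, which cannot have fewer than \<open>n\<close> steps.\<close>

lemma geodesic_le:
  assumes "\<And>i. i < n \<Longrightarrow> E (f i) (f (Suc i))" "\<And>m. (E ^^ m) (f 0) (f n) \<Longrightarrow> n \<le> m"
    and "i \<le> j" "j \<le> n" "(E ^^ m) (f i) (f j)"
  shows "j \<le> i + m"
proof -
  have "(E ^^ (i - 0)) (f 0) (f i)" by (rule relpowp_of_fun) (use assms in auto)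
  moreover have "(E ^^ (n - j)) (f j) (f n)" by (rule relpowp_of_fun) (use assms in auto)
  ultimately have "(E ^^ (i - 0 + m + (n - j))) (f 0) (f n)"
    using assms(5) relpowp_trans by metis
  then show ?thesis using assms(2)[of "i - 0 + m + (n - j)"] assms(3,4) by simp
qed

section \<open>Dominating the second neighbourhood of a vertex\<close>

text \<open>The induced matching is built greedily: a vertex \<open>u\<close> of \<open>W\<close> with fewest neighbours in \<open>X\<close>
  together with one of these neighbours \<open>x\<close> is removed, and minimality ensures that every vertex
  dominated by neither still has a neighbour in \<open>X\<close> outside the neighbourhood of \<open>u\<close>.\<close>

lemma small_dominating_set_or_matching:
  assumes "finite W" "finite X" "\<And>w. w \<in> W \<Longrightarrow> \<exists>x\<in>X. E w x"
  shows "(\<exists>D. D \<subseteq> X \<union> W \<and> card D \<le> 2 * s \<and> (\<forall>w\<in>W. dominates D w) \<and>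
            (\<forall>d\<in>D. d \<in> X \<or> (\<exists>x\<in>D \<inter> X. E d x)))
       \<or> (\<exists>U f. U \<subseteq> W \<and> card U = Suc s \<and> (\<forall>u\<in>U. f u \<in> X \<and> E u (f u)) \<and>
            (\<forall>u\<in>U. \<forall>u'\<in>U. u \<noteq> u' \<longrightarrow> \<not> E u u' \<and> \<not> E u (f u')))"
  using assms
proof (induction s arbitrary: W X)
  case 0
  show ?case
  proof (cases "W = {}")
    case True
    then show ?thesis by (intro disjI1 exI[of _ "{}"]) auto
  next
    case False
    then obtain w where w: "w \<in> W" by blast
    with 0 obtain x where "x \<in> X" "E w x" by blast
    then show ?thesis using w by (intro disjI2 exI[of _ "{w}"] exI[of _ "\<lambda>_. x"]) auto
  qed
next
  case (Suc s)
  show ?case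
  proof (cases "W = {}")
    case True
    then show ?thesis by (intro disjI1 exI[of _ "{}"]) auto
  next
    case False
    define nb where "nb w = {x \<in> X. E w x}" for w
    from False obtain w0 where "w0 \<in> W" by blast
    from ex_has_least_nat[of "\<lambda>w. w \<in> W", OF this, of "\<lambda>w. card (nb w)"]
    obtain u where u: "u \<in> W" "\<And>w. w \<in> W \<Longrightarrow> card (nb u) \<le> card (nb w)" by blast
    then obtain x where x: "x \<in> X" "E u x" using Suc.prems(3)[OF u(1)] by blast
    let ?W = "{w \<in> W. w \<noteq> u \<and> \<not> E w u \<and> \<not> E w x}" and ?X = "X - nb u"
    have fin: "finite ?W" "finite ?X" using Suc.prems(1,2) by simp_all
    have dom: "\<exists>y\<in>?X. E w y" if w: "w \<in> ?W" for w
    proof (rule ccontr)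
      assume "\<not> ?thesis"
      \<comment> \<open>The inclusion is strict because \<open>x\<close> belongs to
        \<open>nb u\<close> while \<open>w\<close> is not adjacent to \<open>x\<close>; this
        contradicts the minimal choice of \<open>u\<close>.\<close>
      then have "nb w \<subset> nb u" using w x by (auto simp: nb_def)
      then have "card (nb w) < card (nb u)"
        using Suc.prems(2) by (intro psubset_card_mono) (auto simp: nb_def)
      then show False using u w by fastforce
    qed
    have "(\<exists>D. D \<subseteq> ?X \<union> ?W \<and> card D \<le> 2 * s \<and> (\<forall>w\<in>?W. dominates D w) \<and>
            (\<forall>d\<in>D. d \<in> ?X \<or> (\<exists>x\<in>D \<inter> ?X. E d x)))
       \<or> (\<exists>U f. U \<subseteq> ?W \<and> card U = Suc s \<and> (\<forall>u\<in>U. f u \<in> ?X \<and> E u (f u)) \<and>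
            (\<forall>u\<in>U. \<forall>u'\<in>U. u \<noteq> u' \<longrightarrow> \<not> E u u' \<and> \<not> E u (f u')))"
      using Suc.IH[of ?W ?X] fin dom by blast
    then show ?thesis
    proof (elim disjE exE conjE)
      fix D assume D: "D \<subseteq> ?X \<union> ?W" "card D \<le> 2 * s" "\<forall>w\<in>?W. dominates D w"
        "\<forall>d\<in>D. d \<in> ?X \<or> (\<exists>x\<in>D \<inter> ?X. E d x)"
      have "finite D" using D(1) Suc.prems(1,2) finite_subset by fastforce
      then have "card (insert u (insert x D)) \<le> Suc (Suc (card D))"
        by (simp add: card_insert_if)
      then have c: "card (insert u (insert x D)) \<le> 2 * Suc s" using D(2) by simp
      have 1: "\<forall>w\<in>W. dominates (insert u (insert x D)) w"
      proof
        fix w assume "w \<in> W"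
        then show "dominates (insert u (insert x D)) w"
          using D(3) E_commute[of w u] E_commute[of w x] by (cases "w \<in> ?W") (auto simp: dominates_def)
      qed
      have 2: "insert u (insert x D) \<subseteq> X \<union> W" using D(1) u x by auto
      have 3: "\<forall>d\<in>insert u (insert x D). d \<in> X \<or> (\<exists>y\<in>insert u (insert x D) \<inter> X. E d y)"
      proof
        fix d assume "d \<in> insert u (insert x D)"
        then consider "d = u" | "d = x" | "d \<in> D" by blast
        then show "d \<in> X \<or> (\<exists>y\<in>insert u (insert x D) \<inter> X. E d y)"
          using D(4) x by cases blast+
      qed
      show ?thesis by (intro disjI1 exI[of _ "insert u (insert x D)"] conjI c 1 2 3)
    next
      fix U f assume U: "U \<subseteq> ?W" "card U = Suc s" "\<forall>u\<in>U. f u \<in> ?X \<and> E u (f u)"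
        "\<forall>u\<in>U. \<forall>u'\<in>U. u \<noteq> u' \<longrightarrow> \<not> E u u' \<and> \<not> E u (f u')"
      have fin: "finite U" using U(2) card.infinite by fastforce
      have "u \<notin> U" using U by auto
      then have c: "card (insert u U) = Suc (Suc s)" using U fin by simp
      have 1: "\<forall>v\<in>insert u U. (f(u := x)) v \<in> X \<and> E v ((f(u := x)) v)"
        using U(3) x by auto
      have 2: "\<not> E u v \<and> \<not> E v u \<and> \<not> E u (f v) \<and> \<not> E v x" if "v \<in> U" for v
        using that U(1,3) E_commute[of u v] by (auto simp: nb_def)
      have 3: "\<forall>v\<in>insert u U. \<forall>v'\<in>insert u U. v \<noteq> v' \<longrightarrow> \<not> E v v' \<and> \<not> E v ((f(u := x)) v')"
        using U(4) 2 by auto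
      show ?thesis using U(1) u
        by (intro disjI2 exI[of _ "insert u U"] exI[of _ "f(u := x)"] conjI c 1 3) auto
    qed
  qed
qed

text \<open>The middle clause ties every vertex of \<open>D\<close> to \<open>y\<close> by at most
  two steps inside \<open>insert y D\<close>. Hence adding \<open>D\<close> to a linked set that
  contains \<open>y\<close> keeps it linked.\<close>

definition second_nbhd_bounded :: "nat \<Rightarrow> bool" where
  "second_nbhd_bounded c \<longleftrightarrow> (\<forall>y\<in>V. \<exists>D\<subseteq>V. card D \<le> c \<and>
     (\<forall>d\<in>D. E y d \<or> (\<exists>x\<in>D. E y x \<and> E d x)) \<and>
     (\<forall>x w. E y x \<longrightarrow> E x w \<longrightarrow> w \<noteq> y \<longrightarrow> \<not> E y w \<longrightarrow> dominates D w))"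

text \<open>The greedy alternative is applied with \<open>X\<close> the neighbourhood of
  \<open>y\<close> and \<open>W\<close> the vertices at distance two, so it remains to exclude
  induced matchings of size \<open>Suc s\<close> between them.\<close>

lemma second_nbhd_boundedI:
  assumes "\<And>y U f. y \<in> V \<Longrightarrow> card U = Suc s \<Longrightarrow> U \<subseteq> V \<Longrightarrow> (\<And>u. u \<in> U \<Longrightarrow> u \<noteq> y \<and> \<not> E y u) \<Longrightarrow>
    (\<And>u. u \<in> U \<Longrightarrow> E y (f u) \<and> E u (f u)) \<Longrightarrow>
    (\<And>u u'. u \<in> U \<Longrightarrow> u' \<in> U \<Longrightarrow> u \<noteq> u' \<Longrightarrow> \<not> E u u' \<and> \<not> E u (f u')) \<Longrightarrow> False"
  shows "second_nbhd_bounded (2 * s)"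
  unfolding second_nbhd_bounded_def
proof
  fix y assume y: "y \<in> V"
  let ?X = "{x \<in> V. E y x}"
  let ?W = "{w \<in> V. w \<noteq> y \<and> \<not> E y w \<and> (\<exists>x. E y x \<and> E w x)}"
  have "(\<exists>D. D \<subseteq> ?X \<union> ?W \<and> card D \<le> 2 * s \<and> (\<forall>w\<in>?W. dominates D w) \<and>
            (\<forall>d\<in>D. d \<in> ?X \<or> (\<exists>x\<in>D \<inter> ?X. E d x)))
       \<or> (\<exists>U f. U \<subseteq> ?W \<and> card U = Suc s \<and> (\<forall>u\<in>U. f u \<in> ?X \<and> E u (f u)) \<and>
            (\<forall>u\<in>U. \<forall>u'\<in>U. u \<noteq> u' \<longrightarrow> \<not> E u u' \<and> \<not> E u (f u')))"
  proof (rule small_dominating_set_or_matching)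
    show "\<exists>x\<in>?X. E w x" if "w \<in> ?W" for w using that E_in(1) E_in(2) by blast
  qed simp_all
  then show "\<exists>D\<subseteq>V. card D \<le> 2 * s \<and>
     (\<forall>d\<in>D. E y d \<or> (\<exists>x\<in>D. E y x \<and> E d x)) \<and>
     (\<forall>x w. E y x \<longrightarrow> E x w \<longrightarrow> w \<noteq> y \<longrightarrow> \<not> E y w \<longrightarrow> dominates D w)"
  proof (elim disjE exE conjE)
    fix D assume D: "D \<subseteq> ?X \<union> ?W" "card D \<le> 2 * s" "\<forall>w\<in>?W. dominates D w"
        "\<forall>d\<in>D. d \<in> ?X \<or> (\<exists>x\<in>D \<inter> ?X. E d x)"
    have "\<forall>x w. E y x \<longrightarrow> E x w \<longrightarrow> w \<noteq> y \<longrightarrow> \<not> E y w \<longrightarrow> dominates D w"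
      using D(3) E_in E_sym by blast
    moreover have "D \<subseteq> V" "\<forall>d\<in>D. E y d \<or> (\<exists>x\<in>D. E y x \<and> E d x)"
      using D(1,4) by blast+
    ultimately show ?thesis using D(2) by blast
  next
    fix U f assume U: "U \<subseteq> ?W" "card U = Suc s" "\<forall>u\<in>U. f u \<in> ?X \<and> E u (f u)"
        "\<forall>u\<in>U. \<forall>u'\<in>U. u \<noteq> u' \<longrightarrow> \<not> E u u' \<and> \<not> E u (f u')"
    have False
    proof (rule assms[OF y U(2), of f])
      show "U \<subseteq> V" using U(1) by blast
      show "u \<noteq> y \<and> \<not> E y u" if "u \<in> U" for u using U(1) that by blast
      show "E y (f u) \<and> E u (f u)" if "u \<in> U" for u using U(3) that by blast
      show "\<not> E u u' \<and> \<not> E u (f u')" if "u \<in> U" "u' \<in> U" "u \<noteq> u'" for u u'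
        using U(4) that by blast
    qed
    then show ?thesis ..
  qed
qed

text \<open>A neighbour \<open>v\<close> of a vertex dominated by \<open>d\<close> is
  \<open>d\<close> itself, adjacent to \<open>d\<close>, or at distance two from it; in the last
  case the bounded set chosen for \<open>d\<close> dominates it. Each vertex of \<open>D\<close>
  keeps itself and brings at most \<open>c\<close> more, whence the factor
  \<open>c + 1\<close>.\<close>

lemma expand_linked:
  assumes c: "second_nbhd_bounded c" and D: "D \<subseteq> V" "linked D" "D \<noteq> {}"
  shows "\<exists>D'. D \<subseteq> D' \<and> D' \<subseteq> V \<and> linked D' \<and> card D' \<le> card D * (c + 1) \<and>
    (\<forall>w v. dominates D w \<longrightarrow> E w v \<longrightarrow> dominates D' v)"
proof -
  have fin: "finite D" using D finite_subset by blast
  have "\<forall>y\<in>D. \<exists>B\<subseteq>V. card B \<le> c \<and>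
     (\<forall>d\<in>B. E y d \<or> (\<exists>x\<in>B. E y x \<and> E d x)) \<and>
     (\<forall>x w. E y x \<longrightarrow> E x w \<longrightarrow> w \<noteq> y \<longrightarrow> \<not> E y w \<longrightarrow> dominates B w)"
    using c D(1) unfolding second_nbhd_bounded_def by blast
  from bchoice[OF this] obtain B where B': "\<forall>y\<in>D. B y \<subseteq> V \<and> card (B y) \<le> c \<and>
     (\<forall>d\<in>B y. E y d \<or> (\<exists>x\<in>B y. E y x \<and> E d x)) \<and>
     (\<forall>x w. E y x \<longrightarrow> E x w \<longrightarrow> w \<noteq> y \<longrightarrow> \<not> E y w \<longrightarrow> dominates (B y) w)" ..
  have B: "\<And>y. y \<in> D \<Longrightarrow> B y \<subseteq> V" "\<And>y. y \<in> D \<Longrightarrow> card (B y) \<le> c"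
    "\<And>y d. y \<in> D \<Longrightarrow> d \<in> B y \<Longrightarrow> E y d \<or> (\<exists>x\<in>B y. E y x \<and> E d x)"
    "\<And>y x w. y \<in> D \<Longrightarrow> E y x \<Longrightarrow> E x w \<Longrightarrow> w \<noteq> y \<Longrightarrow> \<not> E y w \<Longrightarrow> dominates (B y) w"
    using B' by blast+
  let ?D = "D \<union> (\<Union>y\<in>D. B y)"
  obtain r where r: "r \<in> D" using D by blast
  have reach: "(EU ?D)\<^sup>*\<^sup>* r y" if "y \<in> D" for y
    by (rule EU_mono[of D]) (use that r D in \<open>auto simp: linked_def\<close>)
  have "linked ?D"
  proof (rule linkedI)
    show "r \<in> ?D" using r by simp
    fix v assume "v \<in> ?D"
    then consider "v \<in> D" | y where "y \<in> D" "v \<in> B y" by blast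
    then show "(EU ?D)\<^sup>*\<^sup>* r v"
    proof cases
      case (2 y)
      from B(3)[OF 2] have "(EU ?D)\<^sup>*\<^sup>* y v"
      proof
        assume "E y v"
        then show ?thesis using 2 by (intro r_into_rtranclp) (auto simp: EU_def)
      next
        assume "\<exists>x\<in>B y. E y x \<and> E v x"
        then obtain x where x: "x \<in> B y" "E y x" "E x v" using E_sym by blast
        then have "EU ?D y x" "EU ?D x v" using 2 by (auto simp: EU_def)
        then show ?thesis by (meson r_into_rtranclp rtranclp.rtrancl_into_rtrancl)
      qed
      then show ?thesis using reach[OF 2(1)] by (rule rtranclp_trans[rotated])
    qed (use reach in auto)
  qed
  moreover have "card ?D \<le> card D * (c + 1)"
  proof -
    have "card (\<Union>y\<in>D. B y) \<le> (\<Sum>y\<in>D. card (B y))" by (rule card_UN_le[OF fin])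
    also have "\<dots> \<le> card D * c" using B(2) sum_bounded_above[of D "\<lambda>y. card (B y)" c] by simp
    finally show ?thesis using card_Un_le[of D "\<Union>y\<in>D. B y"] by simp
  qed
  moreover have "dominates ?D v" if "dominates D w" "E w v" for w v
  proof -
    from that(1) obtain d where d: "d \<in> D" "w = d \<or> E d w" by (auto simp: dominates_def)
    show ?thesis
    proof (cases "w = d \<or> v = d \<or> E d v")
      case True
      then show ?thesis using d that by (auto simp: dominates_def)
    next
      case False
      then have "dominates (B d) v" using B(4)[OF d(1), of w v] d that by auto
      then show ?thesis by (rule dominates_mono[rotated]) (use d in auto)
    qed
  qed
  moreover have "?D \<subseteq> V" using D(1) B(1) by blast
  ultimately show ?thesis by (intro exI[of _ ?D]) blast
qed

text \<open>The single vertex \<open>z\<close> dominates the ball of radius one; each of the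
  \<open>n\<close> expansions raises the radius by one and multiplies the size by at most
  \<open>c + 1\<close>.\<close>

lemma ball_dominated:
  assumes c: "second_nbhd_bounded c" and z: "z \<in> V"
  shows "\<exists>D. z \<in> D \<and> D \<subseteq> V \<and> linked D \<and> card D \<le> (c + 1) ^ n \<and>
    (\<forall>m v. m \<le> Suc n \<longrightarrow> (E ^^ m) z v \<longrightarrow> dominates D v)"
proof (induction n)
  case 0
  have "dominates {z} v" if "m \<le> Suc 0" "(E ^^ m) z v" for m v
    using that by (cases m) (auto simp: dominates_def)
  then show ?case using z by (intro exI[of _ "{z}"]) (auto simp: linked_def)
next
  case (Suc n)
  then obtain D where D: "z \<in> D" "D \<subseteq> V" "linked D" "card D \<le> (c + 1) ^ n"
    "\<And>m v. m \<le> Suc n \<Longrightarrow> (E ^^ m) z v \<Longrightarrow> dominates D v" by blast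
  then have "D \<noteq> {}" by blast
  from expand_linked[OF c D(2,3) this] obtain D' where D': "D \<subseteq> D'" "D' \<subseteq> V" "linked D'"
    "card D' \<le> card D * (c + 1)" "\<And>w v. dominates D w \<Longrightarrow> E w v \<Longrightarrow> dominates D' v" by blast
  have "card D' \<le> (c + 1) ^ Suc n"
    using D'(4) mult_le_mono1[OF D(4), of "c + 1"] by (simp add: mult.commute)
  moreover have "dominates D' v" if "m \<le> Suc (Suc n)" "(E ^^ m) z v" for m v
  proof (cases "m \<le> Suc n")
    case True
    then show ?thesis using dominates_mono[OF D'(1)] D(5) that(2) by simp
  next
    case False
    then have "(E ^^ Suc (Suc n)) z v" using that by (simp add: le_Suc_eq)
    then obtain w where "(E ^^ Suc n) z w" "E w v" by (rule relpowp_Suc_E)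
    then show ?thesis using D(5)[of "Suc n" w] D'(5)[of w v] by simp
  qed
  moreover have "z \<in> D'" using D(1) D'(1) by blast
  ultimately show ?case using D'(2,3) by (intro exI[of _ D'] conjI allI impI)
qed

lemma rvc_le_of_radius:
  assumes "second_nbhd_bounded c" "z \<in> V" "\<And>v. v \<in> V \<Longrightarrow> \<exists>m\<le>Suc n. (E ^^ m) z v"
  shows "rvc G \<le> (c + 1) ^ n + 1"
proof -
  obtain D where D: "D \<subseteq> V" "linked D" "card D \<le> (c + 1) ^ n"
    "\<forall>m v. m \<le> Suc n \<longrightarrow> (E ^^ m) z v \<longrightarrow> dominates D v"
    using ball_dominated[OF assms(1,2), of n] by (elim exE conjE)
  have "rvc G \<le> card D + 1"
  proof (rule rvc_le_connected_dominating[OF D(1,2)])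
    fix v assume "v \<in> V"
    from assms(3)[OF this] show "dominates D v" using D(4) by blast
  qed
  then show ?thesis using D by linarith
qed

lemma induced_P5I:
  assumes "E a b" "E b c" "E c d" "E d e"
    "\<not> E a c" "\<not> E a d" "\<not> E a e" "\<not> E b d" "\<not> E b e" "\<not> E c e"
  shows "induced_subgraph_of (path_graph 5) G"
proof -
  define q where "q i = [a, b, c, d, e] ! i" for i
  have q: "q 0 = a" "q 1 = b" "q 2 = c" "q 3 = d" "q 4 = e" by (simp_all add: q_def)
  have five: "i = 0 \<or> i = 1 \<or> i = 2 \<or> i = 3 \<or> i = 4" if "i < 5" for i :: nat using that by auto
  have "a \<in> V" "b \<in> V" "c \<in> V" "d \<in> V" "e \<in> V"
    using E_in[OF assms(1)] E_in[OF assms(3)] E_in[OF assms(4)] by simp_all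
  then have "q i \<in> V" if "i < 5" for i using five[OF that] q by auto
  moreover have "E (q i) (q j) \<longleftrightarrow> j = Suc i" if "i < j" "j < 5" for i j
    using five[OF order.strict_trans[OF that]] five[OF that(2)] that(1) assms q by auto
  ultimately show ?thesis by (intro induced_pathI[of 5 q]) simp_all
qed

lemma induced_K_h_of_matching:
  assumes "card U = t" "U \<subseteq> V" "\<And>u. u \<in> U \<Longrightarrow> E u (f u)"
    "\<And>u u'. u \<in> U \<Longrightarrow> u' \<in> U \<Longrightarrow> u \<noteq> u' \<Longrightarrow> \<not> E u u' \<and> \<not> E u (f u') \<and> E (f u) (f u')"
  shows "induced_subgraph_of (K_h t) G"
proof -
  have "finite U" using assms(2) finite_subset by blast
  then obtain h where h: "bij_betw h {0..<t} U" using ex_bij_betw_nat_finite assms(1) by blast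
  have hU: "h i \<in> U" if "i < t" for i using h that by (auto simp: bij_betw_def)
  have inj: "h i = h j \<longleftrightarrow> i = j" if "i < t" "j < t" for i j
    using h that by (auto simp: bij_betw_def inj_on_def)
  show ?thesis
  proof (rule induced_K_hI[of t "\<lambda>i. f (h i)" h])
    fix i j assume ij: "i < t" "j < t"
    show "E (f (h i)) (h j) \<longleftrightarrow> i = j"
      using assms(3)[OF hU[OF ij(2)]] assms(4)[OF hU[OF ij(2)] hU[OF ij(1)]] inj[OF ij] E_commute
      by metis
    show "\<not> E (h i) (h j)"
      using assms(4)[OF hU[OF ij(1)] hU[OF ij(2)]] E_irrefl by metis
    show "E (f (h i)) (f (h j))" if "i \<noteq> j"
      using assms(4)[OF hU[OF ij(1)] hU[OF ij(2)]] inj[OF ij] that by blast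
    show "f (h i) \<in> V" using E_in(2) assms(3) hU[OF ij(1)] by blast
    show "h i \<in> V" using hU[OF ij(1)] assms(2) by blast
  qed
qed

text \<open>If two partners \<open>f u\<close> and \<open>f u'\<close> were not adjacent, then
  \<open>u\<close>, \<open>f u\<close>, \<open>y\<close>, \<open>f u'\<close>, \<open>u'\<close>
  would induce a P5. So the partners form a clique, and a matching of size \<open>Suc t\<close> is a
  \<open>K_h (Suc t)\<close>.\<close>

lemma second_nbhd_bounded_P5_K_h:
  assumes "\<not> induced_subgraph_of (path_graph 5) G" "\<not> induced_subgraph_of (K_h t) G"
  shows "second_nbhd_bounded (2 * t)"
proof (rule second_nbhd_boundedI)
  fix y U f
  assume U: "card U = Suc t" "U \<subseteq> V" "\<And>u. u \<in> U \<Longrightarrow> u \<noteq> y \<and> \<not> E y u"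
    "\<And>u. u \<in> U \<Longrightarrow> E y (f u) \<and> E u (f u)"
    "\<And>u u'. u \<in> U \<Longrightarrow> u' \<in> U \<Longrightarrow> u \<noteq> u' \<Longrightarrow> \<not> E u u' \<and> \<not> E u (f u')"
  have "E (f u) (f u')" if "u \<in> U" "u' \<in> U" "u \<noteq> u'" for u u'
  proof (rule ccontr)
    assume "\<not> E (f u) (f u')"
    then have "induced_subgraph_of (path_graph 5) G"
      using U(3)[OF that(1)] U(3)[OF that(2)] U(4)[OF that(1)] U(4)[OF that(2)] U(5)[OF that]
        U(5)[OF that(2,1)] that(3)
      by (intro induced_P5I[of u "f u" y "f u'" u']) (simp_all add: E_commute)
    then show False using assms by blast
  qed
  then have "induced_subgraph_of (K_h (Suc t)) G"
    using U by (intro induced_K_h_of_matching[of U _ f]) blast+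
  then show False using induced_K_h_mono[of t "Suc t"] induced_subgraph_of_trans assms by (metis le_add2 plus_1_eq_Suc)
qed

text \<open>Ramsey's theorem is applied to the adjacency of the partners, pulled back to
  \<open>U\<close>. Three pairwise adjacent partners form a net with their matched vertices; three
  independent ones form an \<open>S122\<close> centred at \<open>y\<close>, with one matched vertex
  dropped to make the short leg.\<close>

lemma second_nbhd_bounded_S122_net:
  assumes "\<not> induced_subgraph_of S122 G" "\<not> induced_subgraph_of net G"
    and r: "\<And>(W::'a set) F. finite W \<Longrightarrow> r \<le> card W \<Longrightarrow>
      \<exists>R\<subseteq>W. card R = 3 \<and> clique R F \<or> card R = 3 \<and> indep R F"
  shows "second_nbhd_bounded (2 * r)"
proof (rule second_nbhd_boundedI)
  fix y U f
  assume U: "card U = Suc r" "U \<subseteq> V" "\<And>u. u \<in> U \<Longrightarrow> u \<noteq> y \<and> \<not> E y u"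
    "\<And>u. u \<in> U \<Longrightarrow> E y (f u) \<and> E u (f u)"
    "\<And>u u'. u \<in> U \<Longrightarrow> u' \<in> U \<Longrightarrow> u \<noteq> u' \<Longrightarrow> \<not> E u u' \<and> \<not> E u (f u')"
  define F where "F = {{u, u'} |u u'. E (f u) (f u')}"
  have F: "{u, u'} \<in> F \<longleftrightarrow> E (f u) (f u')" for u u'
    using E_sym by (auto simp: F_def doubleton_eq_iff)
  have "finite U" using U(2) finite_subset by blast
  from r[OF this, of F] U(1) obtain R where R: "R \<subseteq> U" "card R = 3" "clique R F \<or> indep R F"
    by auto
  from R(3) show False
  proof
    assume "clique R F"
    then have cl: "E (f u) (f u')" if "u \<in> R" "u' \<in> R" "u \<noteq> u'" for u u'
      using that F by (auto simp: clique_def)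
    have "induced_subgraph_of (K_h 3) G"
    proof (rule induced_K_h_of_matching[OF R(2)])
      show "R \<subseteq> V" using R(1) U(2) by blast
      show "E u (f u)" if "u \<in> R" for u using U(4) R(1) that by blast
      show "\<not> E u u' \<and> \<not> E u (f u') \<and> E (f u) (f u')" if "u \<in> R" "u' \<in> R" "u \<noteq> u'" for u u'
        using U(5)[of u u'] R(1) cl[OF that] that by blast
    qed
    then show False using assms(2) by (simp add: net_eq)
  next
    assume ind: "indep R F"
    obtain a b c where abc: "R = {a, b, c}" "a \<noteq> b" "a \<noteq> c" "b \<noteq> c"
      using R(2) by (metis card_3_iff)
    have in_U: "a \<in> U" "b \<in> U" "c \<in> U" using abc R by auto
    have "\<not> E (f a) (f b)" "\<not> E (f a) (f c)" "\<not> E (f b) (f c)"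
      using ind abc F by (auto simp: indep_def)
    moreover note U(3)[OF in_U(2)] U(3)[OF in_U(3)] U(4)[OF in_U(1)] U(4)[OF in_U(2)] U(4)[OF in_U(3)]
      U(5)[OF in_U(2,1)] U(5)[OF in_U(3,1)] U(5)[OF in_U(2,3)] U(5)[OF in_U(3,2)]
    ultimately have "induced_subgraph_of S122 G"
      using abc by (intro induced_S122I[of y "f a" "f b" b "f c" c]) (simp_all add: E_commute)
    then show False using assms(1) by blast
  qed
qed

section \<open>Attaching a vertex to an induced path\<close>

text \<open>Only the first and last neighbour \<open>a\<close>, \<open>b\<close> of \<open>w\<close>
  on the path matter; both are interior. If they coincide, \<open>S122\<close> is centred there; if
  they are consecutive, they form the triangle of a net with \<open>w\<close>; otherwise
  \<open>S122\<close> is centred at \<open>w\<close>, with \<open>t\<close> as the short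
  leg.\<close>

lemma attached_to_induced_path:
  assumes "\<not> induced_subgraph_of S122 G" "\<not> induced_subgraph_of net G"
    and "3 \<le> l" and q: "\<And>i j. i < j \<Longrightarrow> j \<le> l \<Longrightarrow> E (q i) (q j) \<longleftrightarrow> j = Suc i"
    and "E w t" "\<And>i. i \<le> l \<Longrightarrow> \<not> E t (q i)" "\<not> E w (q 0)" "\<not> E w (q l)"
    and "i \<le> l" "E w (q i)"
  shows False
proof -
  define N where "N = {i. i \<le> l \<and> E w (q i)}"
  define a b where "a = Min N" and "b = Max N"
  have N: "finite N" "N \<noteq> {}" using assms by (auto simp: N_def)
  then have ab: "a \<in> N" "b \<in> N" "a \<le> b" by (auto simp: a_def b_def)
  then have wa: "E w (q a)" "E w (q b)" and l: "a \<le> l" "b \<le> l" by (auto simp: N_def)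
  have out: "\<not> E w (q j)" if "j < a \<or> b < j" "j \<le> l" for j
    using that N Min_le[of N j] Max_ge[of N j] by (auto simp: N_def a_def b_def)
  have "a \<noteq> 0" using wa assms(7) by (metis)
  have "b \<noteq> l" using wa assms(8) by (metis)
  have q2: "E (q i) (q j) \<longleftrightarrow> j = Suc i \<or> i = Suc j" if "i \<le> l" "j \<le> l" for i j
    using q[of i j] q[of j i] that E_commute[of "q i" "q j"] by (cases i j rule: linorder_cases) auto
  have tq: "\<not> E (q i) t" "\<not> E t (q i)" if "i \<le> l" for i
    using assms(6)[OF that] E_commute by blast+
  have wq: "E (q i) w \<longleftrightarrow> E w (q i)" for i by (rule E_commute)
  have le: "a - 1 \<le> l" "b + 1 \<le> l" "Suc (a - 1) = a" "a - 1 < a" "b < b + 1"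
    using l \<open>a \<noteq> 0\<close> \<open>b \<noteq> l\<close> by auto
  \<comment> \<open>A single attachment needs a path leg of length two on one side: on the left if
    \<open>2 \<le> a\<close>, otherwise on the right, where \<open>3 \<le> l\<close> leaves
    room.\<close>
  consider "a = b" "2 \<le> a" | "a = b" "a = 1" | "b = Suc a" | "a + 2 \<le> b"
    using ab(3) \<open>a \<noteq> 0\<close> by linarith
  then show False
  proof cases
    case 1
    have "induced_subgraph_of S122 G"
      by (rule induced_S122I[of "q a" "q (a + 1)" "q (a - 1)" "q (a - 2)" w t])
        (use 1 l le wa assms(5) in \<open>auto simp: q2 tq wq out\<close>)
    then show False using assms(1) by blast
  next
    case 2
    have "induced_subgraph_of S122 G"
      by (rule induced_S122I[of "q a" "q (a - 1)" "q (a + 1)" "q (a + 2)" w t])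
        (use 2 l le wa assms(3,5) in \<open>auto simp: q2 tq wq out\<close>)
    then show False using assms(1) by blast
  next
    case 3
    have "induced_subgraph_of net G"
      by (rule induced_netI[of "q a" "q b" w "q (a - 1)" "q (b + 1)" t])
        (use 3 l le wa assms(3,5) in \<open>auto simp: q2 tq wq out\<close>)
    then show False using assms(2) by blast
  next
    case 4
    have "induced_subgraph_of S122 G"
      by (rule induced_S122I[of w t "q a" "q (a - 1)" "q b" "q (b + 1)"])
        (use 4 l le wa assms(3,5) in \<open>auto simp: q2 tq wq out\<close>)
    then show False using assms(1) by blast
  qed
qed

end

section \<open>The P5-free case\<close>

context cgraph
begin

text \<open>A shortest path with at least four edges begins with five vertices that induce a
  P5.\<close>

lemma P5_free_radius:
  assumes "\<not> induced_subgraph_of (path_graph 5) G" "z \<in> V" "v \<in> V"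
  shows "\<exists>m\<le>3. (E ^^ m) z v"
proof (rule ccontr)
  assume neg: "\<not> ?thesis"
  define n where "n = graph_dist G z v"
  have n: "(E ^^ n) z v" using relpowp_dist assms by (simp add: n_def)
  with neg have "\<not> n \<le> 3" by blast
  then have "4 \<le> n" by simp
  from n obtain f where f: "f 0 = z" "f n = v" "\<And>i. i < n \<Longrightarrow> E (f i) (f (Suc i))"
    by (auto simp: relpowp_fun_conv)
  have short: "n \<le> m" if "(E ^^ m) (f 0) (f n)" for m
    using graph_dist_le[of m z v] that assms f by (simp add: n_def)
  have "E (f i) (f j) \<longleftrightarrow> j = Suc i" if "i < j" "j < 5" for i j
  proof
    assume "E (f i) (f j)"
    then have "(E ^^ 1) (f i) (f j)" by (simp only: relpowp_1)
    with geodesic_le[of n f i j 1, OF f(3) short] show "j = Suc i" using that \<open>4 \<le> n\<close> by simp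
  next
    assume "j = Suc i"
    then show "E (f i) (f j)" using f(3)[of i] that \<open>4 \<le> n\<close> by simp
  qed
  moreover have "f i \<in> V" if "i < 5" for i
    using f(3)[of "i - 1"] f(1) assms(2) that \<open>4 \<le> n\<close> E_in(2)[of "f (i - 1)" "f i"] by (cases i) auto
  ultimately have "induced_subgraph_of (path_graph 5) G" by (intro induced_pathI[of 5 f]) auto
  then show False using assms by blast
qed

text \<open>The bound does not involve the diameter: all distances are at most three, so two
  expansions starting from any vertex dominate the whole graph.\<close>

lemma rvc_P5_K_h:
  assumes "\<not> induced_subgraph_of (path_graph 5) G" "\<not> induced_subgraph_of (K_h t) G"
  shows "rvc G \<le> (2 * t + 1) ^ 2 + 1"
proof -
  obtain z where "z \<in> V" using V_nonempty by blast
  then show ?thesis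
    using second_nbhd_bounded_P5_K_h[OF assms] P5_free_radius[OF assms(1)]
    by (intro rvc_le_of_radius[of "2 * t" z 2]) (auto simp: numeral_3_eq_3 numeral_2_eq_2)
qed

end

section \<open>Colouring along a dominating cycle\<close>

lemma mod_neq_of_diff:
  fixes i j q :: nat
  assumes "i < j" "j - i < 2 * q" "j - i \<noteq> q"
  shows "i mod q \<noteq> j mod q"
proof
  assume "i mod q = j mod q"
  then have "q dvd j - i" using assms(1) by (metis less_imp_le mod_eq_dvd_iff_nat)
  then obtain k where "j - i = q * k" by (elim dvdE)
  with assms have "q * k < q * 2" "q * k \<noteq> q * 1" by auto
  then have "k < 2" "k \<noteq> 1" by auto
  then have "k = 0" by simp
  then show False using \<open>j - i = q * k\<close> assms(1) by simp
qed

context sgraph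
begin

lemma EU_interval:
  assumes "a \<le> b" "b < L" "\<And>i. Suc i < L \<Longrightarrow> E (z i) (z (Suc i))" "z ` {a..b} \<subseteq> S"
  shows "(EU S)\<^sup>*\<^sup>* (z a) (z b)"
  using assms(1,2,4)
proof (induction b)
  case (Suc b)
  show ?case
  proof (cases "a = Suc b")
    case False
    then have "a \<le> b" using Suc.prems(1) by simp
    moreover have "z ` {a..b} \<subseteq> S" using Suc.prems(3) by fastforce
    ultimately have "(EU S)\<^sup>*\<^sup>* (z a) (z b)" using Suc.IH Suc.prems(2) by simp
    moreover have "z b \<in> S" "z (Suc b) \<in> S" using Suc.prems(3) \<open>a \<le> b\<close> by auto
    then have "EU S (z b) (z (Suc b))" using assms(3)[of b] Suc.prems(2) by (auto simp: EU_def)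
    ultimately show ?thesis by (rule rtranclp.rtrancl_into_rtrancl)
  qed simp
qed simp

text \<open>Two cycle vertices of the same colour are exactly \<open>q\<close> apart. Both arcs between them fail to
  be rainbow, but this only hurts a pair of vertices off the cycle, which can avoid it since one of
  them may be attached at a different place.\<close>

lemma rvc_le_dominating_cycle:
  assumes z: "z ` {..<L} \<subseteq> V" "inj_on z {..<L}" "\<And>i. Suc i < L \<Longrightarrow> E (z i) (z (Suc i))"
    "E (z (L - 1)) (z 0)" "0 < L" "L \<le> 2 * q"
    and dom: "\<And>w. w \<in> V \<Longrightarrow> w \<notin> z ` {..<L} \<Longrightarrow> \<exists>i j. i < j \<and> j < L \<and> E w (z i) \<and> E w (z j)"
  shows "rvc G \<le> q"
proof -
  \<comment> \<open>Interiors of the connecting paths will stay on the cycle, so vertices off the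
    cycle may reuse the colour 0 and cost no further colour.\<close>
  define c where "c w = (if w \<in> z ` {..<L} then inv_into {..<L} z w mod q else 0)" for w
  have cz: "c (z i) = i mod q" if "i < L" for i using that z(2) by (simp add: c_def)
  have q: "0 < q" using z(5,6) by simp
  have inj: "inj_on c (z ` I)" if I: "I \<subseteq> {..<L}" "\<And>i j. i \<in> I \<Longrightarrow> j \<in> I \<Longrightarrow> j \<noteq> i + q" for I
  proof (rule inj_onI)
    fix x y assume "x \<in> z ` I" "y \<in> z ` I" and eq: "c x = c y"
    then obtain i j where ij: "i \<in> I" "j \<in> I" "x = z i" "y = z j" by blast
    have lt: "i < L" "j < L" using ij I(1) by auto
    have mods: "i mod q = j mod q" using eq ij cz lt by simp
    have "i = j"
    proof (rule ccontr)
      assume "i \<noteq> j"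
      then consider "i < j" | "j < i" by linarith
      then show False
      proof cases
        case 1
        then show False using mod_neq_of_diff[of i j q] mods lt z(6) I(2)[OF ij(1,2)] by linarith
      next
        case 2
        then show False using mod_neq_of_diff[of j i q] mods lt z(6) I(2)[OF ij(2,1)] by linarith
      qed
    qed
    then show "x = y" using ij by simp
  qed
  \<comment> \<open>The direct arc can repeat a colour only when its length is exactly
    \<open>q\<close>, and then only between its two ends; deleting either end repairs it.\<close>
  have arc_less: "\<exists>S\<subseteq>z ` {..<L}. (EU S)\<^sup>*\<^sup>* (z a) (z b) \<and> inj_on c (S - {z a}) \<and> inj_on c (S - {z b}) \<and>
      (b - a \<noteq> q \<longrightarrow> inj_on c S)" if "a \<le> b" "b < L" for a b
  proof (cases "b - a \<le> q")
    case True
    have "(EU (z ` {a..b}))\<^sup>*\<^sup>* (z a) (z b)" by (rule EU_interval[of a b L z, OF that z(3)]) auto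
    moreover have "inj_on c (z ` {a..b} - {z a})"
    proof (rule inj_on_subset[OF inj[of "{Suc a..b}"]])
      have "{a..b} = insert a {Suc a..b}" using that(1) by auto
      then show "z ` {a..b} - {z a} \<subseteq> z ` {Suc a..b}" by auto
    qed (use that True in auto)
    moreover have "inj_on c (z ` {a..b} - {z b})"
    proof (rule inj_on_subset[OF inj[of "{a..<b}"]])
      have "{a..b} = insert b {a..<b}" using that(1) by auto
      then show "z ` {a..b} - {z b} \<subseteq> z ` {a..<b}" by auto
    qed (use that True in auto)
    moreover have "inj_on c (z ` {a..b})" if "b - a \<noteq> q"
      by (rule inj) (use that True \<open>b < L\<close> in auto)
    moreover have "z ` {a..b} \<subseteq> z ` {..<L}" using that by auto
    ultimately show ?thesis by (intro exI[of _ "z ` {a..b}"]) simp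
  next
    case False
    \<comment> \<open>The complementary arc repeats no colour: indices on different sides of the gap
      differ by at least \<open>b - a > q\<close>, and indices on the same side by less than
      \<open>q\<close>.\<close>
    let ?S = "z ` ({b..L - 1} \<union> {0..a})"
    have "(EU ?S)\<^sup>*\<^sup>* (z b) (z (L - 1))"
      by (rule EU_interval[of b "L - 1" L z, OF _ _ z(3)]) (use that in auto)
    moreover have "(EU ?S)\<^sup>*\<^sup>* (z 0) (z a)"
      by (rule EU_interval[of 0 a L z, OF _ _ z(3)]) (use that in auto)
    moreover have "EU ?S (z (L - 1)) (z 0)" using z(4) that by (auto simp: EU_def)
    ultimately have "(EU ?S)\<^sup>*\<^sup>* (z b) (z a)"
      by (meson rtranclp.rtrancl_into_rtrancl rtranclp_trans)
    then have "(EU ?S)\<^sup>*\<^sup>* (z a) (z b)" by (rule EU_reachable_sym)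
    moreover have i: "inj_on c ?S" by (rule inj) (use that False z(5,6) in auto)
    moreover have "?S \<subseteq> z ` {..<L}" using that by (intro image_mono) auto
    moreover have "inj_on c (?S - B)" for B by (rule inj_on_subset[OF i]) auto
    ultimately show ?thesis by (intro exI[of _ ?S]) simp
  qed
  have arc: "\<exists>S\<subseteq>z ` {..<L}. (EU S)\<^sup>*\<^sup>* (z a) (z b) \<and> inj_on c (S - {z a}) \<and> inj_on c (S - {z b}) \<and>
      (b \<noteq> a + q \<and> a \<noteq> b + q \<longrightarrow> inj_on c S)" if lt: "a < L" "b < L" for a b
  proof (cases "a \<le> b")
    case True
    obtain S where S: "S \<subseteq> z ` {..<L}" "(EU S)\<^sup>*\<^sup>* (z a) (z b)" "inj_on c (S - {z a})"
      "inj_on c (S - {z b})" "b - a \<noteq> q \<longrightarrow> inj_on c S"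
      using arc_less[OF True lt(2)] by (elim exE conjE)
    have "b \<noteq> a + q \<and> a \<noteq> b + q \<longrightarrow> inj_on c S" using S(5) True by auto
    then show ?thesis using S(1-4) by (intro exI[of _ S] conjI)
  next
    case False
    then have "b \<le> a" by simp
    obtain S where S: "S \<subseteq> z ` {..<L}" "(EU S)\<^sup>*\<^sup>* (z b) (z a)" "inj_on c (S - {z b})"
      "inj_on c (S - {z a})" "a - b \<noteq> q \<longrightarrow> inj_on c S"
      using arc_less[OF \<open>b \<le> a\<close> lt(1)] by (elim exE conjE)
    have "b \<noteq> a + q \<and> a \<noteq> b + q \<longrightarrow> inj_on c S" using S(5) False by auto
    then show ?thesis using S(1,3,4) EU_reachable_sym[OF S(2)] by (intro exI[of _ S] conjI)
  qed
  have attach: "(EU (insert u (insert v S)))\<^sup>*\<^sup>* u v"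
    if "(EU S)\<^sup>*\<^sup>* x y" "u = x \<or> E u x" "v = y \<or> E v y" "x \<in> S" "y \<in> S" for u v x y S
  proof -
    let ?T = "insert u (insert v S)"
    have "(EU ?T)\<^sup>*\<^sup>* x y" by (rule EU_mono[OF _ that(1)]) auto
    moreover have "(EU ?T)\<^sup>*\<^sup>* u x" using that by (auto simp: EU_def)
    moreover have "(EU ?T)\<^sup>*\<^sup>* y v" using that E_commute[of v y] by (auto simp: EU_def)
    ultimately show ?thesis by (meson rtranclp_trans)
  qed
  have ends: "x \<in> S \<and> y \<in> S" if "(EU S)\<^sup>*\<^sup>* x y" "x \<in> S" for x y S
    using that by (induction rule: rtranclp_induct) (auto simp: EU_def)
  have nbr: "\<exists>i<L. w = z i \<or> E w (z i)" if "w \<in> V" for w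
    using dom[OF that] by (cases "w \<in> z ` {..<L}") auto
  have "rainbow_vertex_connected G c"
  proof (rule rainbow_vertex_connectedI)
    fix u v assume uv: "u \<in> V" "v \<in> V" "u \<noteq> v"
    \<comment> \<open>The bad distance \<open>q\<close> is tolerated when \<open>u\<close> or
      \<open>v\<close> is itself the cycle vertex at its end of the arc, since an end of a path is
      not internal. Otherwise it has to be avoided.\<close>
    obtain a b where ab: "a < L" "b < L" "u = z a \<or> E u (z a)" "v = z b \<or> E v (z b)"
      "u = z a \<or> v = z b \<or> (b \<noteq> a + q \<and> a \<noteq> b + q)"
    proof -
      obtain a where a: "a < L" "u = z a \<or> E u (z a)" using nbr[OF uv(1)] by blast
      show ?thesis
      proof (cases "v \<in> z ` {..<L}")
        case True
        then show ?thesis using that a by blast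
      next
        case False
        from dom[OF uv(2) False] obtain b1 b2 where b: "b1 < b2" "b2 < L" "E v (z b1)" "E v (z b2)"
          by blast
        show ?thesis
        proof (cases "b1 \<noteq> a + q \<and> a \<noteq> b1 + q")
          case True
          then show ?thesis using that[of a b1] a b by simp
        next
          case False
          \<comment> \<open>At most one index below \<open>L \<le> 2 * q\<close> lies at distance
            \<open>q\<close> from \<open>a\<close>, so the second attachment of \<open>v\<close> is
            safe.\<close>
          then have "b2 \<noteq> a + q \<and> a \<noteq> b2 + q" using b z(6) a(1) by auto
          then show ?thesis using that[of a b2] a b by simp
        qed
      qed
    qed
    obtain S where S: "S \<subseteq> z ` {..<L}" "(EU S)\<^sup>*\<^sup>* (z a) (z b)" "inj_on c (S - {z a})"
      "inj_on c (S - {z b})" "b \<noteq> a + q \<and> a \<noteq> b + q \<longrightarrow> inj_on c S"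
      using arc[OF ab(1,2)] by (elim exE conjE)
    let ?S = "insert (z a) (insert (z b) S)"
    show "\<exists>S\<subseteq>V. inj_on c (S - {u, v}) \<and> (EU (insert u (insert v S)))\<^sup>*\<^sup>* u v"
    proof (cases "z a \<in> S")
      case True
      then have "z b \<in> S" using ends S(2) by blast
      have "inj_on c (S - {u, v})"
        using ab(5)
      proof (elim disjE)
        assume "u = z a"
        then show ?thesis by (intro inj_on_subset[OF S(3)]) auto
      next
        assume "v = z b"
        then show ?thesis by (intro inj_on_subset[OF S(4)]) auto
      next
        assume "b \<noteq> a + q \<and> a \<noteq> b + q"
        with S(5) have "inj_on c S" by simp
        then show ?thesis by (rule inj_on_subset) auto
      qed
      moreover have "(EU (insert u (insert v S)))\<^sup>*\<^sup>* u v"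
        by (rule attach[OF S(2) ab(3,4) True \<open>z b \<in> S\<close>])
      moreover have "S \<subseteq> V" using S(1) z(1) by blast
      ultimately show ?thesis by (intro exI[of _ S] conjI)
    next
      case False
      \<comment> \<open>Reachability is reflexive even outside \<open>S\<close>; a start that is not
        in \<open>S\<close> admits only the empty walk.\<close>
      with S(2) have "z a = z b"
        by (cases rule: converse_rtranclpE) (auto simp: EU_def)
      with ab(4) have "v = z a \<or> E v (z a)" by simp
      then have "(EU (insert u (insert v {z a})))\<^sup>*\<^sup>* u v"
        by (intro attach[OF rtranclp.rtrancl_refl ab(3)]) simp_all
      moreover have "{z a} \<subseteq> V" using z(1) ab(1) by auto
      moreover have "inj_on c ({z a} - {u, v})" by (auto simp: inj_on_def)
      ultimately show ?thesis by (intro exI[of _ "{z a}"] conjI)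
    qed
  qed
  then have "rvc G \<le> card (c ` V)" by (rule rvc_le)
  also have "\<dots> \<le> card {..<q}"
    by (rule card_mono) (use q in \<open>auto simp: c_def\<close>)
  finally show ?thesis by simp
qed

end

section \<open>Around a long geodesic\<close>

text \<open>The threshold \<open>10 \<le> d\<close> makes the cycle closed up later have at least 16
  vertices, long enough for eleven consecutive ones to induce a path.\<close>

locale long_geodesic = cgraph +
  fixes v :: "nat \<Rightarrow> 'a" and d :: nat
  assumes S122_free: "\<not> induced_subgraph_of S122 G" and net_free: "\<not> induced_subgraph_of net G"
    and d: "10 \<le> d"
    and step: "i < d \<Longrightarrow> E (v i) (v (Suc i))"
    and shortest: "(E ^^ m) (v 0) (v d) \<Longrightarrow> d \<le> m"
    and diameter: "x \<in> V \<Longrightarrow> y \<in> V \<Longrightarrow> \<exists>n\<le>d. (E ^^ n) x y"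
begin

text \<open>The complement of the closed neighbourhood of the geodesic: each \<open>v i\<close> has
  a neighbour on the geodesic, so excluding neighbours also excludes the geodesic itself.\<close>

definition far :: "'a set" where
  "far = {a \<in> V. \<forall>i\<le>d. \<not> E a (v i)}"

lemma dist_le:
  assumes "i \<le> j" "j \<le> d" "(E ^^ m) (v i) (v j)"
  shows "j \<le> i + m"
  by (rule geodesic_le[of d v, OF step shortest assms])

lemma near0: "E x (v 0) \<Longrightarrow> (E ^^ m) x (v j) \<Longrightarrow> j \<le> d \<Longrightarrow> j \<le> Suc m"
  using dist_le[of 0 j "Suc m"] relpowp_Suc_I2[of E "v 0" x m "v j"] E_sym[of x "v 0"] by simp

lemma neard:
  assumes "E x (v d)" "(E ^^ m) x (v j)" "j \<le> d"
  shows "d \<le> j + Suc m"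
proof -
  have "(E ^^ Suc m) (v d) (v j)" using relpowp_Suc_I2[of E "v d" x m "v j"] E_sym[OF assms(1)] assms(2) by simp
  then have "(E ^^ Suc m) (v j) (v d)" by (rule E_walk_sym)
  then show ?thesis using dist_le[of j d "Suc m"] assms(3) by simp
qed

lemma near0d:
  assumes "E x (v 0)" "(E ^^ m) x y" "E y (v d)"
  shows "d \<le> m + 2"
  using near0[OF assms(1) relpowp_Suc_I[OF assms(2,3)]] by simp

lemma v_in: "i \<le> d \<Longrightarrow> v i \<in> V"
  using E_in(1)[OF step[of i]] E_in(2)[OF step[of "i - 1"]] d by (cases "i = 0") auto

lemma v_adj:
  assumes "i < j" "j \<le> d"
  shows "E (v i) (v j) \<longleftrightarrow> j = Suc i"
proof
  assume "E (v i) (v j)"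
  then have "(E ^^ 1) (v i) (v j)" by (simp only: relpowp_1)
  with dist_le[of i j 1] assms show "j = Suc i" by simp
next
  assume "j = Suc i"
  then show "E (v i) (v j)" using step assms by simp
qed

lemma farD: "a \<in> far \<Longrightarrow> i \<le> d \<Longrightarrow> \<not> E a (v i)"
  by (simp add: far_def)

lemma far_in: "a \<in> far \<Longrightarrow> a \<in> V"
  by (simp add: far_def)

lemma v_notin_far: "i \<le> d \<Longrightarrow> v i \<notin> far"
proof
  assume "i \<le> d" "v i \<in> far"
  show False
  proof (cases "i = d")
    case True
    then show False using farD[OF \<open>v i \<in> far\<close>, of "d - 1"] step[of "d - 1"] d E_commute by simp
  next
    case False
    then show False using farD[OF \<open>v i \<in> far\<close>, of "Suc i"] step[of i] \<open>i \<le> d\<close> by simp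
  qed
qed

text \<open>This is \<open>attached_to_induced_path\<close> for the whole geodesic. It is what makes
  the two ends the only gates between \<open>far\<close> and the rest.\<close>

lemma attached_end:
  assumes "x \<in> V" "x \<notin> far" "a \<in> far" "E x a"
  shows "E x (v 0) \<or> E x (v d)"
proof (rule ccontr)
  assume neg: "\<not> ?thesis"
  obtain i where "i \<le> d" "E x (v i)" using assms(1,2) by (auto simp: far_def)
  then show False
    using attached_to_induced_path[OF S122_free net_free, of d v x a i] d v_adj assms(4) farD[OF assms(3)] neg
    by simp
qed

text \<open>The walk is cut at its first vertex \<open>x\<close> outside \<open>far\<close>, which
  is adjacent to an end by \<open>attached_end\<close>. Counting the steps before and after
  \<open>x\<close> separately is the basis of all later length estimates.\<close>

lemma exit_far:
  assumes "(E ^^ n) a b" "a \<in> far" "b \<notin> far"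
  shows "\<exists>m a' x m'. (EU far ^^ m) a a' \<and> a' \<in> far \<and> E a' x \<and> (E x (v 0) \<or> E x (v d)) \<and>
    (E ^^ m') x b \<and> n = m + 1 + m'"
  using assms(1,2)
proof (induction n arbitrary: a)
  case 0
  then show ?case using assms(3) by auto
next
  case (Suc n)
  obtain y where y: "E a y" "(E ^^ n) y b" using Suc.prems(1) by (rule relpowp_Suc_E2)
  show ?case
  proof (cases "y \<in> far")
    case True
    from Suc.IH[OF y(2) True] obtain m a' x m' where *: "(EU far ^^ m) y a'" "a' \<in> far" "E a' x"
      "E x (v 0) \<or> E x (v d)" "(E ^^ m') x b" "n = m + 1 + m'" by (elim exE conjE)
    have "(EU far ^^ Suc m) a a'"
      by (rule relpowp_Suc_I2[OF _ *(1)]) (use y(1) True Suc.prems(2) in \<open>simp add: EU_def\<close>)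
    moreover have "Suc n = Suc m + 1 + m'" using * by simp
    ultimately show ?thesis using *(2-5) by (intro exI conjI)
  next
    case False
    then have "E y (v 0) \<or> E y (v d)" using attached_end E_in(2) E_sym y(1) Suc.prems(2) by simp
    moreover have "(EU far ^^ 0) a a" by simp
    moreover have "Suc n = 0 + 1 + n" by simp
    ultimately show ?thesis using y Suc.prems(2) by (intro exI conjI)
  qed
qed

text \<open>\<open>lft n b\<close> and \<open>rgt n b\<close>: a path whose interior lies in \<open>far\<close> leads from a neighbour of the
  left (right) end of the geodesic to \<open>b\<close>, with \<open>n\<close> steps inside \<open>far\<close>.\<close>

definition lft :: "nat \<Rightarrow> 'a \<Rightarrow> bool" where
  "lft n b \<longleftrightarrow> b \<in> far \<and> (\<exists>x a. E x (v 0) \<and> E x a \<and> a \<in> far \<and> (EU far ^^ n) a b)"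

definition rgt :: "nat \<Rightarrow> 'a \<Rightarrow> bool" where
  "rgt n b \<longleftrightarrow> b \<in> far \<and> (\<exists>x a. E x (v d) \<and> E x a \<and> a \<in> far \<and> (EU far ^^ n) a b)"

lemma lft_0: "E x (v 0) \<Longrightarrow> E x a \<Longrightarrow> a \<in> far \<Longrightarrow> lft 0 a"
  by (auto simp: lft_def)

lemma rgt_0: "E x (v d) \<Longrightarrow> E x a \<Longrightarrow> a \<in> far \<Longrightarrow> rgt 0 a"
  by (auto simp: rgt_def)

lemma EU_trans_in: "(EU S ^^ n) a b \<Longrightarrow> a \<in> S \<Longrightarrow> b \<in> S"
  by (cases n) (auto simp: EU_def)

lemma lft_add:
  assumes "lft n b" "(EU far ^^ m) b c"
  shows "lft (n + m) c"
proof -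
  from assms(1) obtain x a where *: "E x (v 0)" "E x a" "a \<in> far" "(EU far ^^ n) a b"
    by (auto simp: lft_def)
  have "(EU far ^^ (n + m)) a c" using *(4) assms(2) by (rule relpowp_trans)
  then show ?thesis using *(1-3) EU_trans_in unfolding lft_def by blast
qed

lemma rgt_add:
  assumes "rgt n b" "(EU far ^^ m) b c"
  shows "rgt (n + m) c"
proof -
  from assms(1) obtain x a where *: "E x (v d)" "E x a" "a \<in> far" "(EU far ^^ n) a b"
    by (auto simp: rgt_def)
  have "(EU far ^^ (n + m)) a c" using *(4) assms(2) by (rule relpowp_trans)
  then show ?thesis using *(1-3) EU_trans_in unfolding rgt_def by blast
qed

lemma lft_Suc: "lft n b \<Longrightarrow> E b c \<Longrightarrow> c \<in> far \<Longrightarrow> lft (Suc n) c"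
  using lft_add[of n b 1 c, unfolded relpowp_1] lft_def[of n b] by (simp add: EU_def)

lemma EU_walk_sym: "(EU S ^^ n) a b \<Longrightarrow> (EU S ^^ n) b a"
  by (rule relpowp_sym[of "EU S"]) (use EU_sym in blast)+

lemma lft_rgt:
  assumes "lft n b" "rgt m b"
  shows "\<exists>c. lft (n + m) c \<and> rgt 0 c"
proof -
  from assms(2) obtain x c where *: "E x (v d)" "E x c" "c \<in> far" "(EU far ^^ m) c b"
    by (auto simp: rgt_def)
  then show ?thesis
    using lft_add[OF assms(1) EU_walk_sym[OF *(4)]] rgt_0 by blast
qed

text \<open>A walk of length at most \<open>d\<close> from \<open>a\<close> to \<open>v d\<close>
  cannot leave \<open>far\<close> at the left end: from there at least \<open>d - 1\<close> further
  steps are needed, and the assumption on \<open>a\<close> forces at least one step inside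
  \<open>far\<close> and then the exit step. The other end is symmetric.\<close>

lemma both_sides:
  assumes a: "a \<in> far" "\<And>x. E a x \<Longrightarrow> \<not> E x (v 0) \<and> \<not> E x (v d)"
  shows "\<exists>n m. lft n a \<and> rgt m a"
proof -
  have "\<exists>m. rgt m a"
  proof -
    obtain n where n: "n \<le> d" "(E ^^ n) a (v d)" using diameter far_in[OF a(1)] v_in by blast
    from exit_far[OF n(2) a(1)] v_notin_far obtain m a' x m' where *: "(EU far ^^ m) a a'" "a' \<in> far"
      "E a' x" "E x (v 0) \<or> E x (v d)" "(E ^^ m') x (v d)" "n = m + 1 + m'" by auto
    have "m \<noteq> 0" using * a(2) by (intro notI) auto
    have "\<not> E x (v 0)"
    proof
      assume "E x (v 0)"
      from near0[OF this *(5)] have "d \<le> Suc m'" by simp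
      then show False using *(6) n(1) \<open>m \<noteq> 0\<close> by simp
    qed
    then have "rgt 0 a'" using *(2-4) E_sym by (intro rgt_0[of x]) auto
    from rgt_add[OF this EU_walk_sym[OF *(1)]] show ?thesis by blast
  qed
  moreover have "\<exists>n. lft n a"
  proof -
    obtain n where n: "n \<le> d" "(E ^^ n) a (v 0)" using diameter far_in[OF a(1)] v_in by blast
    from exit_far[OF n(2) a(1)] v_notin_far obtain m a' x m' where *: "(EU far ^^ m) a a'" "a' \<in> far"
      "E a' x" "E x (v 0) \<or> E x (v d)" "(E ^^ m') x (v 0)" "n = m + 1 + m'" by auto
    have "m \<noteq> 0" using * a(2) by (intro notI) auto
    have "\<not> E x (v d)"
    proof
      assume "E x (v d)"
      from neard[OF this *(5)] have "d \<le> Suc m'" by simp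
      then show False using *(6) n(1) \<open>m \<noteq> 0\<close> by simp
    qed
    then have "lft 0 a'" using *(2-4) E_sym by (intro lft_0[of x]) auto
    from lft_add[OF this EU_walk_sym[OF *(1)]] show ?thesis by blast
  qed
  ultimately show ?thesis by blast
qed

end

text \<open>\<open>r 0, \<dots>, r (Suc k)\<close> is a shortest path through \<open>far\<close> from a neighbour of \<open>v 0\<close> to a
  neighbour of \<open>v d\<close>.\<close>

locale detour = long_geodesic +
  fixes r :: "nat \<Rightarrow> 'a" and k :: nat
  assumes r_left: "E (r 0) (v 0)" and r_right: "E (r (Suc k)) (v d)"
    and r_step: "i \<le> k \<Longrightarrow> E (r i) (r (Suc i))"
    and r_far: "1 \<le> i \<Longrightarrow> i \<le> k \<Longrightarrow> r i \<in> far"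
    and k_min: "lft n b \<Longrightarrow> rgt m b \<Longrightarrow> k \<le> n + m + 1"

context long_geodesic
begin

lemma detour_exists:
  assumes "lft n b" "rgt m b"
  shows "\<exists>r k. detour G v d r k"
proof -
  define P where "P n \<longleftrightarrow> (\<exists>c. lft n c \<and> rgt 0 c)" for n
  have "P (n + m)" using lft_rgt[OF assms] by (simp add: P_def)
  define k where "k = (LEAST n. P n)"
  have "P k" unfolding k_def using \<open>P (n + m)\<close> by (rule LeastI)
  have least: "k \<le> n" if "P n" for n unfolding k_def using that by (rule Least_le)
  from \<open>P k\<close> obtain x a c y where *: "E x (v 0)" "E x a" "a \<in> far" "(EU far ^^ k) a c"
    "c \<in> far" "E y (v d)" "E y c" by (auto simp: P_def lft_def rgt_def)
  from *(4) obtain f where f: "f 0 = a" "f k = c" "\<And>i. i < k \<Longrightarrow> EU far (f i) (f (Suc i))"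
    by (auto simp: relpowp_fun_conv)
  \<comment> \<open>The \<open>k + 1\<close> vertices \<open>f 0, ..., f k\<close> of
    \<open>far\<close> become \<open>r 1, ..., r (Suc k)\<close>, so the parameter of the locale is
    \<open>Suc k\<close> here; this is the source of \<open>+ 1\<close> in
    \<open>k_min\<close>.\<close>
  define r where "r i = (if i = 0 then x else if i \<le> Suc k then f (i - 1) else y)" for i
  have "detour G v d r (Suc k)"
  proof
    show "E (r 0) (v 0)" using * by (simp add: r_def)
    show "E (r (Suc (Suc k))) (v d)" using * by (simp add: r_def)
    show "E (r i) (r (Suc i))" if i: "i \<le> Suc k" for i
    proof -
      consider "i = 0" | "1 \<le> i" "i \<le> k" | "i = Suc k" using i by linarith
      then show ?thesis
      proof cases
        case 2
        then show ?thesis using f(3)[of "i - 1"] by (simp add: r_def EU_def)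
      qed (use * f in \<open>auto simp: r_def E_commute[of _ y]\<close>)
    qed
    show "r i \<in> far" if "1 \<le> i" "i \<le> Suc k" for i
    proof (cases "i = Suc k")
      case True
      then show ?thesis using * f by (simp add: r_def)
    next
      case False
      then show ?thesis using f(3)[of "i - 1"] that by (simp add: r_def EU_def)
    qed
    show "Suc k \<le> n + m + 1" if "lft n b" "rgt m b" for n m b
      using least[of "n + m"] lft_rgt[OF that] by (simp add: P_def)
  qed
  then show ?thesis by blast
qed

end

section \<open>Length of the detour, and the induced dominating cycle that it closes\<close>

context detour
begin

lemma k_pos: "1 \<le> k"
proof (rule ccontr)
  assume "\<not> ?thesis"
  then have "k = 0" by simp
  then have "E (r 0) (r 1)" "E (r 1) (v d)" using r_step[of 0] r_right by auto
  then have "(E ^^ 1) (r 0) (r 1)" by (simp only: relpowp_1)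
  from near0d[OF r_left this \<open>E (r 1) (v d)\<close>] show False using d by simp
qed

lemma r_lft:
  assumes "1 \<le> i" "i \<le> k"
  shows "lft (i - 1) (r i)"
proof -
  have "(EU far ^^ (i - 1)) (r 1) (r i)"
    by (rule relpowp_of_fun) (use assms r_step r_far in \<open>auto simp: EU_def\<close>)
  moreover have "lft 0 (r 1)" using r_left r_step[of 0] r_far[of 1] assms by (intro lft_0[of "r 0"]) auto
  ultimately show ?thesis using lft_add by fastforce
qed

lemma r_rgt:
  assumes "1 \<le> i" "i \<le> k"
  shows "rgt (k - i) (r i)"
proof -
  have "(EU far ^^ (k - i)) (r i) (r k)"
    by (rule relpowp_of_fun) (use assms r_step r_far in \<open>auto simp: EU_def\<close>)
  moreover have "rgt 0 (r k)"
    using r_right r_step[of k] r_far[of k] assms E_sym by (intro rgt_0[of "r (Suc k)"]) auto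
  ultimately show ?thesis using rgt_add EU_walk_sym by fastforce
qed

text \<open>The detour extended by both ends of the geodesic is a walk of length
  \<open>k + 3\<close> from \<open>v 0\<close> to \<open>v d\<close>.\<close>

lemma k_ge: "d \<le> k + 3"
proof -
  have "(E ^^ (Suc k - 0)) (r 0) (r (Suc k))" by (rule relpowp_of_fun) (use r_step in auto)
  from near0d[OF r_left this r_right] show ?thesis by simp
qed

text \<open>A neighbour of \<open>v 0\<close> attached further along could replace
  \<open>r 0\<close> and shorten the detour.\<close>

lemma left_nbr: "E x (v 0) \<Longrightarrow> E x (r i) \<Longrightarrow> 1 \<le> i \<Longrightarrow> i \<le> k \<Longrightarrow> i = 1"
  using k_min[OF lft_0 r_rgt[of i], of x] r_far[of i] by force

lemma right_nbr: "E x (v d) \<Longrightarrow> E x (r i) \<Longrightarrow> 1 \<le> i \<Longrightarrow> i \<le> k \<Longrightarrow> i = k"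
  using k_min[OF r_lft[of i] rgt_0, of x] r_far[of i] by force

text \<open>The two alternatives correspond to the end by which the walk leaves \<open>far\<close>.
  Minimality of the detour bounds the steps inside \<open>far\<close> from below, and the geodesic
  bounds the remaining ones.\<close>

lemma dist_r_v:
  assumes "1 \<le> i" "i \<le> k" "j \<le> d" "(E ^^ n) (r i) (v j)"
  shows "i + j \<le> n + 1 \<or> k + d \<le> n + i + j"
proof -
  from exit_far[OF assms(4) r_far[OF assms(1,2)] v_notin_far[OF assms(3)]]
  obtain m a' x m' where *: "(EU far ^^ m) (r i) a'" "a' \<in> far"
    "E a' x" "E x (v 0) \<or> E x (v d)" "(E ^^ m') x (v j)" "n = m + 1 + m'" by (elim exE conjE)
  from *(4) show ?thesis
  proof
    assume x: "E x (v 0)"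
    then have "lft 0 a'" using * E_sym by (intro lft_0[of x]) auto
    from lft_add[OF this EU_walk_sym[OF *(1)]] have "lft m (r i)" by simp
    from k_min[OF this r_rgt[OF assms(1,2)]] have "i \<le> m + 1" using assms by simp
    moreover have "j \<le> Suc m'" using near0[OF x *(5) assms(3)] .
    ultimately show ?thesis using *(6) by simp
  next
    assume x: "E x (v d)"
    then have "rgt 0 a'" using * E_sym by (intro rgt_0[of x]) auto
    from rgt_add[OF this EU_walk_sym[OF *(1)]] have "rgt m (r i)" by simp
    from k_min[OF r_lft[OF assms(1,2)] this] have "k \<le> i + m" using assms by simp
    moreover have "d \<le> j + Suc m'" using neard[OF x *(5) assms(3)] .
    ultimately show ?thesis using *(6) by simp
  qed
qed

text \<open>Both alternatives of \<open>dist_r_v\<close> are evaluated at the middle of the detour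
  and the middle of the geodesic, which the diameter keeps within distance \<open>d\<close>;
  rounding the two halves produces the constant.\<close>

lemma k_le: "k \<le> d + 3"
proof -
  define i j where "i = (k + 1) div 2" and "j = d div 2"
  have ij: "1 \<le> i" "i \<le> k" "j \<le> d" using k_pos by (auto simp: i_def j_def)
  obtain n where n: "n \<le> d" "(E ^^ n) (r i) (v j)"
    using diameter far_in[OF r_far[OF ij(1,2)]] v_in[OF ij(3)] by blast
  from dist_r_v[OF ij n(2)] n(1) show ?thesis by (simp add: i_def j_def) linarith
qed

lemma r_adj:
  assumes "i < j" "j \<le> Suc k"
  shows "E (r i) (r j) \<longleftrightarrow> j = Suc i"
proof
  assume e: "E (r i) (r j)"
  consider "i = 0" "j = Suc k" | "i = 0" "j \<le> k" | "1 \<le> i" "j = Suc k" | "1 \<le> i" "j \<le> k"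
    using assms by linarith
  then show "j = Suc i"
  proof cases
    case 1
    then have "(E ^^ 1) (r 0) (r (Suc k))" using e by (simp only: relpowp_1)
    from near0d[OF r_left this r_right] show ?thesis using d by simp
  next
    case 2
    then show ?thesis using left_nbr[OF r_left, of j] e assms by simp
  next
    case 3
    then show ?thesis using right_nbr[OF r_right, of i] e assms E_commute by simp
  next
    case 4
    then have "lft (Suc (i - 1)) (r j)" using r_lft[of i] e r_far[of j] assms by (intro lft_Suc) auto
    from k_min[OF this r_rgt[of j]] 4 assms show ?thesis by simp
  qed
next
  assume "j = Suc i"
  then show "E (r i) (r j)" using r_step assms by simp
qed

text \<open>Inside \<open>far\<close>, the vertex \<open>w\<close> would give a shortcut of the
  detour. Outside \<open>far\<close>, \<open>w\<close> reaches the inner detour only if it is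
  adjacent to an end of the geodesic, and then all its neighbours on the detour are among the two
  vertices nearest to that end.\<close>

lemma common_nbr_r:
  assumes "i < j" "j \<le> Suc k" "E w (r i)" "E w (r j)"
  shows "j \<le> i + 2"
proof -
  have walk: "(E ^^ 2) (r 0) (r (Suc k))" if "E w (r 0)" "E w (r (Suc k))"
    using that E_sym by (auto simp: numeral_2_eq_2)
  have no_ends: False if "E w (r 0)" "E w (r (Suc k))"
    using near0d[OF r_left walk[OF that] r_right] d by simp
  show ?thesis
  proof (cases "w \<in> far")
    case True
    consider "i = 0" "j = Suc k" | "i = 0" "j \<le> k" | "1 \<le> i" "j = Suc k" | "1 \<le> i" "j \<le> k"
      using assms by linarith
    then show ?thesis
    proof cases
      case 1
      then show ?thesis using no_ends assms by simp
    next
      case 2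
      then have "lft 0 w" using assms r_left E_sym True by (intro lft_0[of "r 0"]) auto
      then have "lft (Suc 0) (r j)" using assms r_far[of j] 2 by (intro lft_Suc) auto
      from k_min[OF this r_rgt[of j]] 2 assms show ?thesis by simp
    next
      case 3
      then have w: "rgt 0 w" using assms r_right E_sym True by (intro rgt_0[of "r (Suc k)"]) auto
      have "lft (Suc (i - 1)) w" using assms r_lft[of i] 3 True E_sym by (intro lft_Suc) auto
      from k_min[OF this w] 3 assms show ?thesis by simp
    next
      case 4
      then have "lft (Suc (i - 1)) w" using assms r_lft[of i] True E_sym by (intro lft_Suc) auto
      then have "lft (Suc (Suc (i - 1))) (r j)"
        by (rule lft_Suc[OF _ assms(4)]) (use assms(1) r_far[of j] 4 in auto)
      from k_min[OF this r_rgt[of j]] 4 assms show ?thesis by simp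
    qed
  next
    case False
    have w: "w \<in> V" using assms E_in by blast
    have near_l: "m \<le> 1" if "E w (v 0)" "E w (r m)" "m \<le> Suc k" for m
    proof (cases "m = Suc k")
      case True
      then have "(E ^^ 1) w (r (Suc k))" using that by (simp only: relpowp_1)
      from near0d[OF that(1) this r_right] show ?thesis using d by simp
    next
      case False
      then show ?thesis using left_nbr[OF that(1,2)] that(3) by (cases "m = 0") auto
    qed
    have near_r: "k \<le> m" if "E w (v d)" "E w (r m)" "m \<le> Suc k" for m
    proof (cases "m = 0")
      case True
      then have "(E ^^ 1) (r 0) w" using that(2) E_sym by (simp only: relpowp_1)
      from near0d[OF r_left this that(1)] show ?thesis using d by simp
    next
      case False
      then show ?thesis using right_nbr[OF that(1,2)] that(3) by (cases "m = Suc k") auto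
    qed
    show ?thesis
    proof (cases "E w (v 0) \<or> E w (v d)")
      case True
      then show ?thesis using near_l[OF _ assms(4)] near_r[OF _ assms(3)] assms(1,2) by fastforce
    next
      case ends: False
      have "\<not> (1 \<le> m \<and> m \<le> k)" if "E w (r m)" for m
        using attached_end[OF w False r_far that] ends by blast
      from this[OF assms(3)] this[OF assms(4)] assms(1,2) have "i = 0" "j = Suc k" by auto
      then show ?thesis using no_ends assms by simp
    qed
  qed
qed

text \<open>The cycle \<open>v al, \<dots>, v be, r (Suc k), \<dots>, r 0\<close>: the choice of \<open>al\<close> and \<open>be\<close> makes it induced.\<close>

definition al :: nat where "al = Max {i. i \<le> d \<and> E (r 0) (v i)}"
definition be :: nat where "be = Min {i. i \<le> d \<and> E (r (Suc k)) (v i)}"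
definition M :: nat where "M = be - al + 1"
definition L :: nat where "L = M + k + 2"
definition z :: "nat \<Rightarrow> 'a" where "z i = (if i < M then v (al + i) else r (Suc k - (i - M)))"

lemma al_nbr: "E (r 0) (v al)" "al \<le> 2" "\<And>i. i \<le> d \<Longrightarrow> E (r 0) (v i) \<Longrightarrow> i \<le> al"
proof -
  let ?S = "{i. i \<le> d \<and> E (r 0) (v i)}"
  have fin: "finite ?S" by simp
  have "0 \<in> ?S" using r_left by simp
  then have "al \<in> ?S" unfolding al_def using Max_in[OF fin] by blast
  then show "E (r 0) (v al)" by simp
  then have "(E ^^ 1) (r 0) (v al)" by (simp only: relpowp_1)
  from near0[OF r_left this] \<open>al \<in> ?S\<close> show "al \<le> 2" by simp
  show "i \<le> al" if "i \<le> d" "E (r 0) (v i)" for i unfolding al_def using Max_ge[OF fin] that by simp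
qed

lemma be_nbr: "E (r (Suc k)) (v be)" "be \<le> d" "d \<le> be + 2"
  "\<And>i. i \<le> d \<Longrightarrow> E (r (Suc k)) (v i) \<Longrightarrow> be \<le> i"
proof -
  let ?S = "{i. i \<le> d \<and> E (r (Suc k)) (v i)}"
  have fin: "finite ?S" by simp
  have "d \<in> ?S" using r_right by simp
  then have "be \<in> ?S" unfolding be_def using Min_in[OF fin] by blast
  then show "E (r (Suc k)) (v be)" "be \<le> d" by simp_all
  then have "(E ^^ 1) (r (Suc k)) (v be)" by (simp only: relpowp_1)
  from neard[OF r_right this] \<open>be \<le> d\<close> show "d \<le> be + 2" by simp
  show "be \<le> i" if "i \<le> d" "E (r (Suc k)) (v i)" for i unfolding be_def using Min_le[OF fin] that by simp
qed

lemma M_eq: "M + al = Suc be" "7 \<le> M"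
  using al_nbr(2) be_nbr(2,3) d by (auto simp: M_def)

text \<open>With \<open>10 \<le> d\<close>, both \<open>M\<close> and \<open>k\<close> are at least
  \<open>d - 3 \<ge> 7\<close>; from above, \<open>M \<le> d + 1\<close> and
  \<open>k \<le> d + 3\<close>.\<close>

lemma L_bounds: "16 \<le> L" "L \<le> 2 * (d + 3)"
  using al_nbr(2) be_nbr(2,3) d k_ge k_le by (auto simp: M_def L_def)

lemma z_left: "i < M \<Longrightarrow> z i = v (al + i)"
  by (simp add: z_def)

lemma z_right: "M \<le> i \<Longrightarrow> z i = r (Suc k - (i - M))"
  by (simp add: z_def)

text \<open>The extremal choice of \<open>al\<close> and \<open>be\<close> leaves \<open>r 0\<close>
  and \<open>r (Suc k)\<close> exactly one neighbour each on the retained part of the geodesic; the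
  inner detour lies in \<open>far\<close> and has none.\<close>

lemma z_adj:
  assumes "i < j" "j < L"
  shows "E (z i) (z j) \<longleftrightarrow> j = Suc i \<or> (i = 0 \<and> j = L - 1)"
proof -
  consider "j < M" | "M \<le> i" | "i < M" "M \<le> j" using assms by linarith
  then show ?thesis
  proof cases
    case 1
    then show ?thesis using assms M_eq be_nbr(2) v_adj[of "al + i" "al + j"] by (auto simp: z_left L_def)
  next
    case 2
    have "E (r (Suc k - (j - M))) (r (Suc k - (i - M))) \<longleftrightarrow> Suc k - (i - M) = Suc (Suc k - (j - M))"
      by (rule r_adj) (use 2 assms in \<open>auto simp: L_def\<close>)
    moreover have "Suc k - (i - M) = Suc (Suc k - (j - M)) \<longleftrightarrow> j = Suc i"
      using 2 assms by (auto simp: L_def)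
    ultimately show ?thesis
      using 2 assms M_eq(2) E_commute[of "z i" "z j"] by (simp add: z_right)
  next
    case 3
    define n where "n = Suc k - (j - M)"
    have n: "n + j = Suc k + M" "n \<le> Suc k" using 3 assms by (auto simp: n_def L_def)
    have zz: "z i = v (al + i)" "z j = r n" using 3 by (simp_all add: z_left z_right n_def)
    have id: "al + i \<le> d" using 3 M_eq be_nbr(2) by simp
    consider "n = 0" | "n = Suc k" | "1 \<le> n" "n \<le> k" using n by linarith
    then show ?thesis
    proof cases
      case 1
      have "E (r 0) (v (al + i)) \<longleftrightarrow> i = 0" using al_nbr(1) al_nbr(3)[OF id] by (cases "i = 0") auto
      moreover have "j = L - 1" "j \<noteq> Suc i" using 1 n 3 by (auto simp: L_def)
      ultimately show ?thesis using zz 1 E_commute[of "v (al + i)" "r 0"] by simp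
    next
      case 2
      have "E (r (Suc k)) (v (al + i)) \<longleftrightarrow> Suc i = M"
      proof
        assume "E (r (Suc k)) (v (al + i))"
        from be_nbr(4)[OF id this] show "Suc i = M" using M_eq 3 by simp
      next
        assume "Suc i = M"
        then have "al + i = be" using M_eq by simp
        then show "E (r (Suc k)) (v (al + i))" using be_nbr(1) by simp
      qed
      then have "E (z i) (z j) \<longleftrightarrow> Suc i = M"
        using zz 2 E_commute[of "v (al + i)" "r (Suc k)"] by simp
      moreover have "j = M" "j \<noteq> L - 1" using 2 n by (auto simp: L_def)
      ultimately show ?thesis by auto
    next
      case 3
      then have "\<not> E (r n) (v (al + i))" using farD[OF r_far id] by simp
      moreover have "j \<noteq> Suc i" "j \<noteq> L - 1" using 3 n \<open>i < M\<close> by (auto simp: L_def)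
      ultimately show ?thesis using zz E_commute[of "v (al + i)" "r n"] by simp
    qed
  qed
qed

lemma z_in:
  assumes "i < L"
  shows "z i \<in> V"
proof (cases "Suc i < L")
  case True
  then have "E (z i) (z (Suc i))" using z_adj[of i "Suc i"] by simp
  then show ?thesis by (rule E_in(1))
next
  case False
  then have "E (z (i - 1)) (z i)" using z_adj[of "i - 1" i] assms L_bounds(1) by simp
  then show ?thesis by (rule E_in(2))
qed

lemma z_adj2:
  assumes "i < L" "j < L"
  shows "E (z i) (z j) \<longleftrightarrow> j = Suc i \<or> i = Suc j \<or> (i = 0 \<and> j = L - 1) \<or> (j = 0 \<and> i = L - 1)"
  using z_adj[of i j] z_adj[of j i] assms E_commute[of "z i" "z j"] L_bounds(1)
  by (cases i j rule: linorder_cases) auto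

text \<open>Equal vertices would have the same neighbours on the cycle. This already forces the
  positions to be two apart, and then the predecessor of the first position gives the
  contradiction.\<close>

lemma z_inj: "inj_on z {..<L}"
proof -
  have "z a \<noteq> z b" if ab: "a < b" "b < L" for a b
  proof
    assume eq: "z a = z b"
    have same: "E (z c) (z a) \<longleftrightarrow> E (z c) (z b)" for c using eq by simp
    have "E (z (Suc a)) (z a)" using z_adj2[of "Suc a" a] ab by simp
    with same have "E (z (Suc a)) (z b)" by simp
    then have b: "b = Suc (Suc a)" using z_adj2[of "Suc a" b] ab z_adj2[of "Suc a" "Suc a"] by auto
    show False
    proof (cases "a = 0")
      case True
      then have "E (z (L - 1)) (z a)" using z_adj2[of "L - 1" a] L_bounds(1) by simp
      with same have "E (z (L - 1)) (z b)" by simp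
      then show False using z_adj2[of "L - 1" b] L_bounds(1) b True ab by auto
    next
      case False
      then have "E (z (a - 1)) (z a)" using z_adj2[of "a - 1" a] ab by simp
      with same have "E (z (a - 1)) (z b)" by simp
      moreover have "a - 1 < L" using ab by simp
      ultimately show False using z_adj2[of "a - 1" b] L_bounds(1) b False ab by auto
    qed
  qed
  then show ?thesis by (auto simp: inj_on_def) (metis linorder_neqE_nat)
qed

text \<open>Two positions on the same side are at most two apart. The slack up to 4 comes from pairs
  with one vertex on the geodesic and one on the detour, where \<open>near0\<close>,
  \<open>neard\<close> and \<open>dist_r_v\<close> lose a little around the two junctions.\<close>

lemma common_nbr_z:
  assumes "i < j" "j < L" "E w (z i)" "E w (z j)"
  shows "j \<le> i + 4 \<or> L \<le> j - i + 4"
proof -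
  have walk: "(E ^^ 2) x y" if "E w x" "E w y" for x y
    using that E_sym by (auto simp: numeral_2_eq_2)
  consider "j < M" | "M \<le> i" | "i < M" "M \<le> j" using assms by linarith
  then show ?thesis
  proof cases
    case 1
    then have "(E ^^ 2) (v (al + i)) (v (al + j))" using assms walk by (simp add: z_left)
    with dist_le[of "al + i" "al + j" 2] show ?thesis using 1 assms M_eq be_nbr(2) by simp
  next
    case 2
    have "Suc k - (i - M) \<le> Suc k - (j - M) + 2"
      by (rule common_nbr_r[of _ _ w]) (use 2 assms in \<open>auto simp: L_def z_right\<close>)
    then show ?thesis using 2 assms by (auto simp: L_def)
  next
    case 3
    define n where "n = Suc k - (j - M)"
    have n: "n + j = Suc k + M" "n \<le> Suc k" using 3 assms by (auto simp: n_def L_def)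
    have zz: "z i = v (al + i)" "z j = r n" using 3 by (simp_all add: z_left z_right n_def)
    have id: "al + i \<le> d" using 3 M_eq be_nbr(2) by simp
    have w2: "(E ^^ 2) (r n) (v (al + i))" using walk assms zz by simp
    consider "n = 0" | "n = Suc k" | "1 \<le> n" "n \<le> k" using n by linarith
    then show ?thesis
    proof cases
      case 1
      then have "al + i \<le> 3" using near0[OF r_left _ id] w2 by fastforce
      then show ?thesis using n 1 by (auto simp: L_def)
    next
      case 2
      then have "d \<le> al + i + 3" using neard[OF r_right _ id] w2 by fastforce
      then show ?thesis using n 2 M_eq be_nbr(2) by auto
    next
      case 3
      from dist_r_v[OF 3 id w2] show ?thesis using n M_eq be_nbr(2) \<open>i < M\<close> by (auto simp: L_def)
    qed
  qed
qed

lemma window_adj: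
  assumes "s < L" "i < j" "j \<le> 10"
  shows "E (z ((s + i) mod L)) (z ((s + j) mod L)) \<longleftrightarrow> j = Suc i"
proof -
  have L: "16 \<le> L" using L_bounds by simp
  have m: "(s + i) mod L = (if s + i < L then s + i else s + i - L)" if "i \<le> 10" for i
    using that assms(1) L by (simp add: mod_if)
  show ?thesis
    using assms L by (subst z_adj2) (auto simp: m)
qed

text \<open>Positions in a window differ by at most 10, so the alternative of
  \<open>common_nbr_z\<close> that goes the other way round the cycle would force
  \<open>L \<le> 14\<close>.\<close>

lemma window_common_nbr:
  assumes "s < L" "i < j" "j \<le> 10" "E w (z ((s + i) mod L))" "E w (z ((s + j) mod L))"
  shows "j \<le> i + 4"
proof -
  have L: "16 \<le> L" using L_bounds by simp
  have m: "(s + i) mod L = (if s + i < L then s + i else s + i - L)" if "i \<le> 10" for i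
    using that assms(1) L by (simp add: mod_if)
  have lt: "(s + i) mod L < L" "(s + j) mod L < L" using L by simp_all
  show ?thesis
  proof (cases "(s + i) mod L < (s + j) mod L")
    case True
    with common_nbr_z[OF True lt(2) assms(4,5)] show ?thesis using assms(1-3) L by (auto simp: m split: if_splits)
  next
    case False
    then have "(s + j) mod L < (s + i) mod L" using assms(1-3) L by (auto simp: m split: if_splits)
    with common_nbr_z[OF this lt(1) assms(5,4)] show ?thesis using assms(1-3) L by (auto simp: m split: if_splits)
  qed
qed

lemma window_of:
  assumes "i < L"
  obtains s where "s < L" "(s + 5) mod L = i"
proof
  \<comment> \<open>\<open>i\<close> is placed at the centre 5 of the window 0 to 10; adding
    \<open>L\<close> first avoids truncated subtraction.\<close>
  show "(i + L - 5) mod L < L" using L_bounds by simp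
  have "((i + L - 5) mod L + 5) mod L = (i + L - 5 + 5) mod L" by (rule mod_add_left_eq)
  also have "i + L - 5 + 5 = i + L" using L_bounds by simp
  finally show "((i + L - 5) mod L + 5) mod L = i" using assms by simp
qed

text \<open>Otherwise some edge from \<open>w\<close> to \<open>t'\<close> leaves the dominated set.
  In the window centred at a neighbour of \<open>w\<close>, both ends are five positions away and
  hence not adjacent to \<open>w\<close>, so \<open>attached_to_induced_path\<close>
  applies.\<close>

lemma cycle_dominates:
  assumes "t \<in> V"
  shows "dominates (z ` {..<L}) t"
proof (rule ccontr)
  let ?Z = "z ` {..<L}"
  assume neg: "\<not> dominates ?Z t"
  have z0: "z 0 \<in> V" "z 0 \<in> ?Z" using z_in L_bounds(1) by auto
  obtain n where "(E ^^ n) (z 0) t" using relpowp_dist[OF z0(1) assms] by blast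
  then obtain f where f: "f 0 = z 0" "f n = t" "\<And>i. i < n \<Longrightarrow> E (f i) (f (Suc i))"
    by (auto simp: relpowp_fun_conv)
  have "\<exists>i<n. dominates ?Z (f i) \<and> \<not> dominates ?Z (f (Suc i))"
  proof (rule ccontr)
    assume no: "\<not> ?thesis"
    have "i \<le> n \<Longrightarrow> dominates ?Z (f i)" for i
    proof (induction i)
      case 0
      then show ?case using f(1) z0(2) by (auto simp: dominates_def)
    next
      case (Suc i)
      then show ?case using no by auto
    qed
    then show False using neg f(2) by blast
  qed
  then obtain i where i: "i < n" "dominates ?Z (f i)" "\<not> dominates ?Z (f (Suc i))" by blast
  define w where "w = f i"
  define t' where "t' = f (Suc i)"
  have wt: "E w t'" using f(3)[OF i(1)] by (simp add: w_def t'_def)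
  have t': "\<not> E t' (z j)" if "j < L" for j
    using i(3) that E_commute[of t' "z j"] by (auto simp: dominates_def t'_def)
  have "w \<notin> ?Z"
  proof
    assume "w \<in> ?Z"
    then show False using wt t' E_commute by blast
  qed
  with i(2) obtain j where j: "j < L" "E w (z j)" using E_commute by (auto simp: dominates_def w_def)
  obtain s where s: "s < L" "(s + 5) mod L = j" using window_of[OF j(1)] .
  have w5: "E w (z ((s + 5) mod L))" using j s by simp
  show False
  proof (rule attached_to_induced_path[OF S122_free net_free, of 10 "\<lambda>i. z ((s + i) mod L)" w t' 5])
    show "E (z ((s + i) mod L)) (z ((s + j) mod L)) \<longleftrightarrow> j = Suc i" if "i < j" "j \<le> 10" for i j
      by (rule window_adj[OF s(1) that])
    show "\<not> E w (z ((s + 0) mod L))"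
      using window_common_nbr[OF s(1), of 0 5 w] w5 by force
    show "\<not> E w (z ((s + 10) mod L))"
      using window_common_nbr[OF s(1), of 5 10 w] w5 by force
    show "\<not> E t' (z ((s + i) mod L))" for i using t' L_bounds by simp
  qed (use wt w5 in simp_all)
qed

text \<open>A vertex attached to the cycle only once is the short leg of an \<open>S122\<close>
  centred at its attachment, with two cycle edges on either side as the long legs.\<close>

lemma two_attachments:
  assumes "w \<in> V" "w \<notin> z ` {..<L}"
  shows "\<exists>i j. i < j \<and> j < L \<and> E w (z i) \<and> E w (z j)"
proof (rule ccontr)
  assume neg: "\<not> ?thesis"
  from cycle_dominates[OF assms(1)] assms(2) obtain j where j: "j < L" "E w (z j)"
    using E_commute by (auto simp: dominates_def)
  have only: "i = j" if "i < L" "E w (z i)" for i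
    using neg that j by (cases i j rule: linorder_cases) blast+
  obtain s where s: "s < L" "(s + 5) mod L = j" using window_of[OF j(1)] .
  define q where "q i = z ((s + i) mod L)" for i
  have q: "E (q i) (q j) \<longleftrightarrow> j = Suc i \<or> i = Suc j" if "i \<le> 10" "j \<le> 10" for i j
    using window_adj[OF s(1), of i j] window_adj[OF s(1), of j i] that E_commute[of "q i" "q j"]
    by (cases i j rule: linorder_cases) (auto simp: q_def)
  have L: "16 \<le> L" using L_bounds by simp
  have w5: "E w (q 5)" using j s by (simp add: q_def)
  have wq: "\<not> E w (q i)" "\<not> E (q i) w" if "i \<le> 10" "i \<noteq> 5" for i
  proof -
    have "(s + i) mod L \<noteq> (s + 5) mod L"
      using that s(1) L by (auto simp: mod_if split: if_splits)
    then show "\<not> E w (q i)" using only[of "(s + i) mod L"] s L by (auto simp: q_def)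
    then show "\<not> E (q i) w" using E_commute by blast
  qed
  have "induced_subgraph_of S122 G"
    by (rule induced_S122I[of "q 5" w "q 6" "q 7" "q 4" "q 3"])
      (use w5 E_commute[of w] in \<open>auto simp: q wq\<close>)
  then show False using S122_free by blast
qed

lemma rvc_le_detour: "rvc G \<le> d + 3"
proof (rule rvc_le_dominating_cycle)
  show "z ` {..<L} \<subseteq> V" using z_in by blast
  show "inj_on z {..<L}" by (rule z_inj)
  show "E (z i) (z (Suc i))" if "Suc i < L" for i using z_adj[of i "Suc i"] that by simp
  show "E (z (L - 1)) (z 0)" using z_adj2[of "L - 1" 0] L_bounds(1) by simp
  show "0 < L" "L \<le> 2 * (d + 3)" using L_bounds by simp_all
qed (rule two_attachments)

end

section \<open>The case without a detour, and the bounds assembled\<close>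

lemma (in sgraph) linked_Un:
  assumes "linked A" "linked B" "x \<in> A" "x \<in> B"
  shows "linked (A \<union> B)"
proof (rule linkedI)
  show "x \<in> A \<union> B" using assms(3) by simp
  fix y assume "y \<in> A \<union> B"
  then show "(EU (A \<union> B))\<^sup>*\<^sup>* x y"
  proof
    assume "y \<in> A"
    then have "(EU A)\<^sup>*\<^sup>* x y" using assms by (simp add: linked_def)
    then show ?thesis by (rule EU_mono[rotated]) simp
  next
    assume "y \<in> B"
    then have "(EU B)\<^sup>*\<^sup>* x y" using assms by (simp add: linked_def)
    then show ?thesis by (rule EU_mono[rotated]) simp
  qed
qed

context long_geodesic
begin

text \<open>Now all of \<open>far\<close> is within distance two of an end, so expanding
  \<open>{v 0}\<close> and \<open>{v d}\<close> once covers it, while the geodesic dominates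
  everything else. The count is \<open>(d + 1) + 2 * (c + 1) + 1\<close>.\<close>

lemma rvc_le_no_detour:
  assumes c: "second_nbhd_bounded c"
    and "\<And>a. a \<in> far \<Longrightarrow> \<exists>x. E a x \<and> (E x (v 0) \<or> E x (v d))"
  shows "rvc G \<le> d + 2 * c + 4"
proof -
  let ?P = "v ` {..d}"
  have PV: "?P \<subseteq> V" using v_in by auto
  have P: "linked ?P"
  proof (rule linkedI)
    show "v 0 \<in> ?P" by simp
    fix y assume "y \<in> ?P"
    then obtain j where j: "j \<le> d" "y = v j" by auto
    have "(EU ?P)\<^sup>*\<^sup>* (v 0) (v j)"
      by (rule EU_interval[of 0 j "Suc d" v]) (use j step in auto)
    then show "(EU ?P)\<^sup>*\<^sup>* (v 0) y" using j by simp
  qed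
  have ball: "\<exists>D. u \<in> D \<and> D \<subseteq> V \<and> linked D \<and> card D \<le> c + 1 \<and>
    (\<forall>x y. E u x \<longrightarrow> E x y \<longrightarrow> dominates D y)" if u: "u \<in> V" for u
  proof -
    have 1: "{u} \<subseteq> V" "linked {u}" "{u} \<noteq> {}" using u by (auto simp: linked_def)
    obtain D where D: "{u} \<subseteq> D" "D \<subseteq> V" "linked D" "card D \<le> card {u} * (c + 1)"
      "\<forall>w y. dominates {u} w \<longrightarrow> E w y \<longrightarrow> dominates D y"
      using expand_linked[OF c 1] by (elim exE conjE)
    have "\<forall>x y. E u x \<longrightarrow> E x y \<longrightarrow> dominates D y" using D(5) by (auto simp: dominates_def)
    moreover have "u \<in> D" "card D \<le> c + 1" using D(1,4) by auto
    ultimately show ?thesis using D(2,3) by (intro exI[of _ D] conjI)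
  qed
  obtain D0 where D0: "v 0 \<in> D0" "D0 \<subseteq> V" "linked D0" "card D0 \<le> c + 1"
    "\<forall>x y. E (v 0) x \<longrightarrow> E x y \<longrightarrow> dominates D0 y"
    using ball[OF v_in[of 0]] by auto
  obtain D1 where D1: "v d \<in> D1" "D1 \<subseteq> V" "linked D1" "card D1 \<le> c + 1"
    "\<forall>x y. E (v d) x \<longrightarrow> E x y \<longrightarrow> dominates D1 y"
    using ball[OF v_in[of d]] by auto
  let ?D = "?P \<union> D0 \<union> D1"
  have "linked (?P \<union> D0)" by (rule linked_Un[OF P D0(3), of "v 0"]) (use D0(1) in auto)
  then have "linked ?D" by (rule linked_Un[OF _ D1(3), of _ "v d"]) (use D1(1) in auto)
  moreover have "?D \<subseteq> V" using PV D0(2) D1(2) by blast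
  moreover have "dominates ?D y" if y: "y \<in> V" for y
  proof (cases "y \<in> far")
    case True
    then obtain x where x: "E y x" "E x (v 0) \<or> E x (v d)" using assms(2) by blast
    then have "dominates D0 y \<or> dominates D1 y"
      using D0(5) D1(5) E_commute[of x] by blast
    then show ?thesis by (auto simp: dominates_def)
  next
    case False
    then obtain i where "i \<le> d" "E y (v i)" using y by (auto simp: far_def)
    then show ?thesis using E_commute[of y] by (auto simp: dominates_def)
  qed
  ultimately have "rvc G \<le> card ?D + 1" by (intro rvc_le_connected_dominating)
  moreover have "card ?D \<le> card ?P + card D0 + card D1"
    using card_Un_le[of ?P D0] card_Un_le[of "?P \<union> D0" D1] by linarith
  moreover have "card ?P \<le> d + 1" using card_image_le[of "{..d}" v] by simp
  ultimately show ?thesis using D0(4) D1(4) by linarith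
qed

lemma rvc_le_long:
  assumes "second_nbhd_bounded c"
  shows "rvc G \<le> d + 2 * c + 4"
proof (cases "\<exists>a\<in>far. \<forall>x. E a x \<longrightarrow> \<not> E x (v 0) \<and> \<not> E x (v d)")
  case True
  then obtain a n m where "lft n a" "rgt m a" using both_sides by meson
  then obtain r k where "detour G v d r k" using detour_exists by blast
  then have "rvc G \<le> d + 3" by (rule detour.rvc_le_detour)
  then show ?thesis by simp
next
  case False
  then show ?thesis by (intro rvc_le_no_detour[OF assms]) blast
qed

end

lemma (in cgraph) rvc_S122_net:
  assumes "\<not> induced_subgraph_of S122 G" "\<not> induced_subgraph_of net G"
    and c: "second_nbhd_bounded c"
  shows "rvc G \<le> diam G + (c + 1) ^ 9 + 2 * c + 4"
proof (cases "10 \<le> diam G")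
  case True
  obtain f where f: "\<And>i. i < diam G \<Longrightarrow> E (f i) (f (Suc i))" "\<And>i. i \<le> diam G \<Longrightarrow> f i \<in> V"
    "\<And>n. (E ^^ n) (f 0) (f (diam G)) \<Longrightarrow> diam G \<le> n" using diametral_geodesic by blast
  interpret long_geodesic G f "diam G"
    by unfold_locales (use assms(1,2) True f diam_walk in auto)
  show ?thesis using rvc_le_long[OF c] by simp
next
  case False
  obtain z where "z \<in> V" using V_nonempty by blast
  \<comment> \<open>Here the diameter is at most nine; the exponent 9 covers radius
    \<open>Suc 9\<close>.\<close>
  have "rvc G \<le> (c + 1) ^ 9 + 1"
  proof (rule rvc_le_of_radius[OF c \<open>z \<in> V\<close>])
    fix v assume "v \<in> V"
    then obtain m where "m \<le> diam G" "(E ^^ m) z v" using diam_walk[OF \<open>z \<in> V\<close>] by blast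
    moreover from this False have "m \<le> Suc 9" by linarith
    ultimately show "\<exists>m\<le>Suc 9. (E ^^ m) z v" by blast
  qed
  then show ?thesis by simp
qed

lemma rvc_bound_P5_K_h:
  "\<exists>k. \<forall>G::'a ugraph. simple_graph G \<longrightarrow> connected_graph G \<longrightarrow>
    \<not> induced_subgraph_of (path_graph 5) G \<longrightarrow> \<not> induced_subgraph_of (K_h t) G \<longrightarrow> rvc G \<le> diam G + k"
proof (intro exI allI impI)
  fix G :: "'a ugraph"
  assume G: "simple_graph G" "connected_graph G" "\<not> induced_subgraph_of (path_graph 5) G"
    "\<not> induced_subgraph_of (K_h t) G"
  interpret cgraph G by unfold_locales (use G in auto)
  show "rvc G \<le> diam G + ((2 * t + 1) ^ 2 + 1)" using rvc_P5_K_h[OF G(3,4)] by simp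
qed

lemma rvc_bound_S122_net:
  "\<exists>k. \<forall>G::'a ugraph. simple_graph G \<longrightarrow> connected_graph G \<longrightarrow>
    \<not> induced_subgraph_of S122 G \<longrightarrow> \<not> induced_subgraph_of net G \<longrightarrow> rvc G \<le> diam G + k"
proof -
  \<comment> \<open>The Ramsey number is fixed before the graph, which makes the resulting constant
    uniform.\<close>
  obtain r where r: "\<And>(W::'a set) F. finite W \<Longrightarrow> r \<le> card W \<Longrightarrow>
      \<exists>R\<subseteq>W. card R = 3 \<and> clique R F \<or> card R = 3 \<and> indep R F"
    using ramsey2[of 3 3] by metis
  show ?thesis
  proof (intro exI allI impI)
    fix G :: "'a ugraph"
    assume G: "simple_graph G" "connected_graph G" "\<not> induced_subgraph_of S122 G"
      "\<not> induced_subgraph_of net G"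
    interpret cgraph G by unfold_locales (use G in auto)
    have "second_nbhd_bounded (2 * r)" by (rule second_nbhd_bounded_S122_net[OF G(3,4) r])
    from rvc_S122_net[OF G(3,4) this]
    show "rvc G \<le> diam G + ((2 * r + 1) ^ 9 + 2 * (2 * r) + 4)" by simp
  qed
qed

section \<open>Graphs with many cut vertices\<close>

text \<open>Boundedness is stated for graphs on natural numbers, while the extremal families live on
  sums and pairs; an injective \<open>f\<close> carries them over.\<close>

definition map_graph :: "('a \<Rightarrow> 'b) \<Rightarrow> 'a ugraph \<Rightarrow> 'b ugraph" where
  "map_graph f G = UGraph (f ` verts G) ((`) f ` edges G)"

lemma connected_graphI:
  assumes "simple_graph G" "verts G \<noteq> {}"
    "\<And>u v. u \<in> verts G \<Longrightarrow> v \<in> verts G \<Longrightarrow> \<exists>n\<le>m. (adj G ^^ n) u v"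
  shows "connected_graph G"
proof -
  interpret sgraph G by unfold_locales (rule assms)
  show ?thesis
    unfolding connected_graph_def using assms(2,3) path_of_relpowp by blast
qed

context sgraph
begin

lemma adj_map_graph:
  assumes "inj_on f V" "u \<in> V" "v \<in> V"
  shows "adj (map_graph f G) (f u) (f v) \<longleftrightarrow> E u v"
proof
  assume "E u v"
  then have "f ` {u, v} \<in> (`) f ` edges G" unfolding adj_def by (rule imageI)
  then show "adj (map_graph f G) (f u) (f v)" by (simp add: adj_def map_graph_def)
next
  assume "adj (map_graph f G) (f u) (f v)"
  then obtain e where e: "e \<in> edges G" "f ` {u, v} = f ` e" by (auto simp: adj_def map_graph_def)
  have "e \<subseteq> V" using e(1) simple by (simp add: simple_graph_def)
  then have "f ` {u, v} = f ` e \<longleftrightarrow> {u, v} = e"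
    using assms(2,3) by (intro inj_on_image_eq_iff[OF assms(1)]) simp_all
  with e(2) have "{u, v} = e" by blast
  then show "E u v" using e(1) by (simp add: adj_def)
qed

lemma simple_map_graph:
  assumes "inj_on f V"
  shows "simple_graph (map_graph f G)"
  unfolding simple_graph_def map_graph_def
proof (intro conjI ballI)
  fix e assume "e \<in> edges (UGraph (f ` V) ((`) f ` edges G))"
  then obtain e' where e': "e' \<in> edges G" "e = f ` e'" by auto
  then have *: "e' \<subseteq> V" "card e' = 2" using simple by (auto simp: simple_graph_def)
  then show "e \<subseteq> verts (UGraph (f ` V) ((`) f ` edges G))" using e' by auto
  show "card e = 2" using * e' assms card_image inj_on_subset by metis
qed simp

lemma relpowp_map_graph:
  assumes f: "inj_on f V" and "u \<in> V" "(E ^^ n) u v"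
  shows "(adj (map_graph f G) ^^ n) (f u) (f v)"
  using assms(2,3)
proof (induction n arbitrary: u)
  case (Suc n)
  obtain w where w: "E u w" "(E ^^ n) w v" using Suc.prems(2) by (rule relpowp_Suc_E2)
  then have "adj (map_graph f G) (f u) (f w)" using adj_map_graph[OF f] E_in[OF w(1)] by simp
  moreover have "(adj (map_graph f G) ^^ n) (f w) (f v)" using Suc.IH w E_in[OF w(1)] by simp
  ultimately show ?case by (rule relpowp_Suc_I2)
qed simp

lemma path_of_map_graph:
  assumes f: "inj_on f V" and "u \<in> V" "v \<in> V" "path_between (map_graph f G) (f u) (f v) p"
  shows "\<exists>q. p = map f q \<and> path_between G u v q"
proof -
  have p: "p \<noteq> []" "hd p = f u" "last p = f v" "distinct p" "set p \<subseteq> f ` V"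
    "successively (adj (map_graph f G)) p"
    using assms(4) by (auto simp: path_between_def map_graph_def)
  define q where "q = map (inv_into V f) p"
  have pq: "p = map f q" using p(5) by (auto simp: q_def f_inv_into_f subset_iff intro!: map_idI[symmetric])
  have qV: "set q \<subseteq> V" using p(5) by (auto simp: q_def subset_iff intro!: inv_into_into)
  have "q \<noteq> []" using p(1) pq by simp
  moreover have "hd q = u"
    using p(2) pq \<open>q \<noteq> []\<close> f qV assms(2) by (simp add: hd_map) (metis hd_in_set inj_on_eq_iff subsetD)
  moreover have "last q = v"
    using p(3) pq \<open>q \<noteq> []\<close> f qV assms(3) by (simp add: last_map) (metis last_in_set inj_on_eq_iff subsetD)
  moreover have "distinct q" using p(4) pq by (simp add: distinct_map)
  moreover have "successively E q"
  proof -
    have "successively (\<lambda>x y. adj (map_graph f G) (f x) (f y)) q" using p(6) pq by (simp add: successively_map)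
    then show ?thesis by (rule successively_mono) (use adj_map_graph[OF f] qV in auto)
  qed
  ultimately show ?thesis using pq qV by (auto simp: path_between_def)
qed

end

context cgraph
begin

lemma connected_map_graph:
  assumes f: "inj_on f V"
  shows "connected_graph (map_graph f G)"
proof (rule connected_graphI[OF simple_map_graph[OF f], of "diam G"])
  show "verts (map_graph f G) \<noteq> {}" using V_nonempty by (simp add: map_graph_def)
  fix u v assume "u \<in> verts (map_graph f G)" "v \<in> verts (map_graph f G)"
  then obtain a b where ab: "a \<in> V" "b \<in> V" "u = f a" "v = f b" by (auto simp: map_graph_def)
  then obtain n where "n \<le> diam G" "(E ^^ n) a b" using diam_walk by blast
  then show "\<exists>n\<le>diam G. (adj (map_graph f G) ^^ n) u v"
    using relpowp_map_graph[OF f ab(1)] ab by blast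
qed

lemma diam_map_graph_le:
  assumes f: "inj_on f V"
  shows "diam (map_graph f G) \<le> diam G"
proof -
  interpret H: cgraph "map_graph f G"
    by unfold_locales (use simple_map_graph[OF f] connected_map_graph[OF f] in auto)
  show ?thesis
  proof (rule H.diam_le)
    fix u v assume "u \<in> verts (map_graph f G)" "v \<in> verts (map_graph f G)"
    then obtain a b where ab: "a \<in> V" "b \<in> V" "u = f a" "v = f b" by (auto simp: map_graph_def)
    then obtain n where "n \<le> diam G" "(E ^^ n) a b" using diam_walk by blast
    then show "\<exists>n\<le>diam G. (adj (map_graph f G) ^^ n) u v"
      using relpowp_map_graph[OF f ab(1)] ab by blast
  qed
qed

lemma rvc_map_graph_ge:
  assumes f: "inj_on f V"
  shows "rvc G \<le> rvc (map_graph f G)"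
proof (cases "is_complete G")
  case True
  then show ?thesis by (simp add: rvc_def)
next
  case False
  interpret H: cgraph "map_graph f G"
    by unfold_locales (use simple_map_graph[OF f] connected_map_graph[OF f] in auto)
  have vH: "verts (map_graph f G) = f ` V" by (simp add: map_graph_def)
  show ?thesis
  proof (rule H.rvc_ge)
    show "\<not> is_complete (map_graph f G)"
    proof -
      obtain u v where uv: "u \<in> V" "v \<in> V" "u \<noteq> v" "\<not> E u v" using False by (auto simp: is_complete_def)
      then have "f u \<in> f ` V" "f v \<in> f ` V" "f u \<noteq> f v" "\<not> adj (map_graph f G) (f u) (f v)"
        using adj_map_graph[OF f uv(1,2)] f by (auto simp: inj_on_eq_iff)
      then show ?thesis unfolding is_complete_def vH by blast
    qed
    fix c assume c: "rainbow_vertex_connected (map_graph f G) c"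
    have "rainbow_vertex_connected G (c \<circ> f)"
      unfolding rainbow_vertex_connected_def
    proof (intro ballI impI)
      fix u v assume uv: "u \<in> V" "v \<in> V" "u \<noteq> v"
      then have "f u \<noteq> f v" using f by (simp add: inj_on_eq_iff)
      then obtain p where p: "path_between (map_graph f G) (f u) (f v) p" "vertex_rainbow c p"
        using c uv unfolding rainbow_vertex_connected_def vH by blast
      obtain q where q: "p = map f q" "path_between G u v q"
        using path_of_map_graph[OF f uv(1,2) p(1)] by blast
      have "inj_on f (set (butlast (tl q)))"
      proof (rule inj_on_subset[OF f])
        have "set (butlast (tl q)) \<subseteq> set q" by (cases q) (auto dest: in_set_butlastD)
        then show "set (butlast (tl q)) \<subseteq> V" using q(2) by (auto simp: path_between_def)
      qed
      moreover have "inj_on c (f ` set (butlast (tl q)))"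
        using p(2) q(1) by (simp add: vertex_rainbow_def map_tl[symmetric] map_butlast[symmetric])
      ultimately have "vertex_rainbow (c \<circ> f) q"
        unfolding vertex_rainbow_def by (rule comp_inj_on)
      then show "\<exists>p. path_between G u v p \<and> vertex_rainbow (c \<circ> f) p" using q(2) by blast
    qed
    from rvc_le[OF this] show "rvc G \<le> card (c ` verts (map_graph f G))"
      by (simp add: vH image_comp)
  qed
qed

end

text \<open>A copy of \<open>H\<close> on natural numbers violates the bound, so it contains
  \<open>X\<close> or \<open>Y\<close>; the copy embeds back into \<open>H\<close>.\<close>

lemma induced_subgraph_of_large_rvc:
  fixes H :: "'c ugraph"
  assumes bound: "\<forall>G::nat ugraph. simple_graph G \<and> connected_graph G \<and> pair_free X Y G \<longrightarrow> rvc G \<le> diam G + k"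
    and H: "simple_graph H" "connected_graph H" "diam H + k < rvc H"
  shows "induced_subgraph_of X H \<or> induced_subgraph_of Y H"
proof -
  interpret cgraph H by unfold_locales (use H in auto)
  obtain f :: "'c \<Rightarrow> nat" where f: "inj_on f V" using finV finite_imp_inj_to_nat_seg by metis
  let ?G = "map_graph f H"
  have "\<not> rvc ?G \<le> diam ?G + k"
    using H(3) rvc_map_graph_ge[OF f] diam_map_graph_le[OF f] by linarith
  then have "induced_subgraph_of X ?G \<or> induced_subgraph_of Y ?G"
    using bound simple_map_graph[OF f] connected_map_graph[OF f] by (auto simp: pair_free_def)
  moreover have "induced_subgraph_of ?G H"
    unfolding induced_subgraph_of_iff
  proof (intro exI conjI ballI)
    let ?g = "inv_into V f"
    show "inj_on ?g (verts ?G)" "?g ` verts ?G \<subseteq> V"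
      by (auto simp: map_graph_def inj_on_inv_into inv_into_f_f[OF f])
    fix u v assume "u \<in> verts ?G" "v \<in> verts ?G"
    then show "adj ?G u v \<longleftrightarrow> E (?g u) (?g v)"
      using adj_map_graph[OF f] by (auto simp: map_graph_def inv_into_f_f[OF f])
  qed
  ultimately show ?thesis
    using induced_subgraph_of_trans[of X ?G H] induced_subgraph_of_trans[of Y ?G H] by blast
qed

section \<open>Lower bounds from cut vertices\<close>

context cgraph
begin

text \<open>The only way out of \<open>S\<close> is through \<open>x\<close>. Such sets describe the
  sides of a cut vertex without speaking of components.\<close>

lemma path_meets_separator:
  assumes "successively E p" "p \<noteq> []" "hd p \<in> S" "last p \<notin> S" "\<And>a b. a \<in> S \<Longrightarrow> E a b \<Longrightarrow> b \<in> S \<or> b = x"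
  shows "x \<in> set p"
  using assms(1-4)
proof (induction p)
  case (Cons a p)
  show ?case
  proof (cases "p = [] \<or> hd p = x")
    case True
    then show ?thesis using Cons.prems by (cases p) auto
  next
    case False
    then have "hd p \<in> S" using Cons.prems assms(5)[of a "hd p"] by (auto simp: successively_Cons)
    then show ?thesis using Cons False by (auto simp: successively_Cons)
  qed
qed simp

lemma internal_vertexI:
  assumes "path_between G u w p" "x \<in> set p" "x \<noteq> u" "x \<noteq> w"
  shows "x \<in> set (butlast (tl p))"
proof -
  have p: "p \<noteq> []" "hd p = u" "last p = w" using assms(1) by (auto simp: path_between_def)
  then have "x \<in> set (tl p)" using assms(2,3) by (cases p) auto
  moreover from this have "last (tl p) = w" using p by (cases p) auto
  ultimately show ?thesis using assms(4) by (metis append_butlast_last_id empty_iff empty_set in_set_conv_decomp rotate1.simps(2) set_ConsD set_rotate1)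
qed

text \<open>Every path from \<open>u\<close> to \<open>w\<close> must pass both \<open>x\<close> and
  \<open>y\<close> as internal vertices, so a rainbow one gives them different colours; hence every
  admissible colouring is injective on \<open>C\<close>.\<close>

lemma rvc_ge_separators:
  assumes C: "C \<subseteq> V" "\<not> is_complete G"
    and sep: "\<And>x y. x \<in> C \<Longrightarrow> y \<in> C \<Longrightarrow> x \<noteq> y \<Longrightarrow> \<exists>u\<in>V. \<exists>w\<in>V. \<exists>S T. u \<noteq> w \<and> {u, w} \<inter> {x, y} = {} \<and>
      u \<in> S \<and> w \<notin> S \<and> (\<forall>a\<in>S. \<forall>b. E a b \<longrightarrow> b \<in> S \<or> b = x) \<and>
      u \<in> T \<and> w \<notin> T \<and> (\<forall>a\<in>T. \<forall>b. E a b \<longrightarrow> b \<in> T \<or> b = y)"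
  shows "card C \<le> rvc G"
proof (rule rvc_ge[OF C(2)])
  fix c assume c: "rainbow_vertex_connected G c"
  have "inj_on c C"
  proof (rule inj_onI, rule ccontr)
    fix x y assume xy: "x \<in> C" "y \<in> C" "c x = c y" "x \<noteq> y"
    from sep[OF xy(1,2,4)] obtain u w S T where *: "u \<in> V" "w \<in> V" "u \<noteq> w" "{u, w} \<inter> {x, y} = {}"
      "u \<in> S" "w \<notin> S" "\<forall>a\<in>S. \<forall>b. E a b \<longrightarrow> b \<in> S \<or> b = x"
      "u \<in> T" "w \<notin> T" "\<forall>a\<in>T. \<forall>b. E a b \<longrightarrow> b \<in> T \<or> b = y" by (elim bexE exE conjE)
    obtain p where p: "path_between G u w p" "vertex_rainbow c p"
      using c *(1-3) by (auto simp: rainbow_vertex_connected_def)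
    have pp: "successively E p" "p \<noteq> []" "hd p = u" "last p = w" using p(1) by (auto simp: path_between_def)
    have "x \<in> set p" by (rule path_meets_separator[of p S]) (use pp * in auto)
    moreover have "y \<in> set p" by (rule path_meets_separator[of p T]) (use pp * in auto)
    ultimately have "x \<in> set (butlast (tl p))" "y \<in> set (butlast (tl p))"
      using internal_vertexI[OF p(1)] *(4) by auto
    then show False using p(2) xy by (auto simp: vertex_rainbow_def inj_on_def)
  qed
  then have "card C = card (c ` C)" by (simp add: card_image)
  also have "\<dots> \<le> card (c ` V)" by (rule card_mono) (use C in auto)
  finally show "card C \<le> card (c ` V)" .
qed

end

text \<open>Every original vertex is a cut vertex, for it separates its own leaf from the rest. A
  path between the leaves of \<open>s\<close> and \<open>t\<close> passes both, while leaves add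
  only two to distances.\<close>

lemma large_rvc_attach_pendants:
  assumes H: "simple_graph H" "2 \<le> card (verts H)"
    and walk: "\<And>u v. u \<in> verts H \<Longrightarrow> v \<in> verts H \<Longrightarrow> \<exists>n\<le>m. (adj H ^^ n) u v"
  shows "simple_graph (attach_pendants H)" "connected_graph (attach_pendants H)"
    "diam (attach_pendants H) \<le> m + 2" "card (verts H) \<le> rvc (attach_pendants H)"
proof -
  interpret H: sgraph H by unfold_locales (rule H)
  let ?G = "attach_pendants H"
  have V: "verts ?G = Inl ` verts H \<union> Inr ` verts H" by simp
  show simple: "simple_graph ?G"
    unfolding simple_graph_def
  proof (intro conjI ballI)
    show "finite (verts ?G)" using H.finV by simp
    fix e assume "e \<in> edges ?G"
    then consider e' where "e' \<in> edges H" "e = Inl ` e'" | v where "v \<in> verts H" "e = {Inl v, Inr v}"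
      by (auto simp: attach_pendants_def)
    then have "e \<subseteq> verts ?G \<and> card e = 2"
    proof cases
      case 1
      have e': "e' \<subseteq> verts H" "card e' = 2" using 1 H.simple by (auto simp: simple_graph_def)
      have "card e = card e'" unfolding 1 by (rule card_image) simp
      then show ?thesis using e' 1 by auto
    qed auto
    then show "e \<subseteq> verts ?G" "card e = 2" by auto
  qed
  interpret S: sgraph ?G by unfold_locales (rule simple)
  have lift: "(adj ?G ^^ n) (Inl u) (Inl v)" if "(adj H ^^ n) u v" for n u v
    using that
  proof (induction n arbitrary: u)
    case (Suc n)
    obtain w where w: "adj H u w" "(adj H ^^ n) w v" using Suc.prems by (rule relpowp_Suc_E2)
    have "adj ?G (Inl u) (Inl w)" using w(1) by simp
    then show ?case using Suc.IH[OF w(2)] by (rule relpowp_Suc_I2)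
  qed simp
  have walks: "\<exists>n\<le>m+2. (adj ?G ^^ n) x y" if xy: "x \<in> verts ?G" "y \<in> verts ?G" for x y
  proof -
    obtain u where u: "u \<in> verts H" "x = Inl u \<or> x = Inr u" using xy by auto
    obtain v where v: "v \<in> verts H" "y = Inl v \<or> y = Inr v" using xy by auto
    obtain n where n: "n \<le> m" "(adj H ^^ n) u v" using walk u v by blast
    have 1: "\<exists>i\<le>1. (adj ?G ^^ i) x (Inl u)"
    proof (cases "x = Inl u")
      case True
      then show ?thesis by (intro exI[of _ 0]) simp
    next
      case False
      then have "adj ?G x (Inl u)" using u by auto
      then show ?thesis by (intro exI[of _ 1]) (simp only: relpowp_1 order_refl simp_thms)
    qed
    have 2: "\<exists>i\<le>1. (adj ?G ^^ i) (Inl v) y"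
    proof (cases "y = Inl v")
      case True
      then show ?thesis by (intro exI[of _ 0]) simp
    next
      case False
      then have "adj ?G (Inl v) y" using v by auto
      then show ?thesis by (intro exI[of _ 1]) (simp only: relpowp_1 order_refl simp_thms)
    qed
    from 1 2 obtain i j where ij: "i \<le> 1" "j \<le> 1" "(adj ?G ^^ i) x (Inl u)" "(adj ?G ^^ j) (Inl v) y" by blast
    have "(adj ?G ^^ (i + n + j)) x y"
      by (rule relpowp_trans[OF relpowp_trans[OF ij(3) lift[OF n(2)]] ij(4)])
    moreover have "i + n + j \<le> m + 2" using ij n by simp
    ultimately show ?thesis by blast
  qed
  have ne: "verts H \<noteq> {}" using H(2) by auto
  show conn: "connected_graph ?G"
    by (rule connected_graphI[OF simple _ walks]) (use ne in auto)
  interpret cgraph ?G by unfold_locales (rule conn)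
  show "diam ?G \<le> m + 2" by (rule diam_le[OF walks])
  obtain a b where ab: "a \<in> verts H" "b \<in> verts H" "a \<noteq> b"
    using H(2) by (metis card_2_iff' obtain_subset_with_card_n subsetD)
  have "card (Inl ` verts H :: ('a + 'a) set) \<le> rvc ?G"
  proof (rule rvc_ge_separators)
    have "\<not> adj ?G (Inr a) (Inr b)" by simp
    moreover have "Inr a \<in> verts ?G" "Inr b \<in> verts ?G" "(Inr a :: 'a + 'a) \<noteq> Inr b" using ab by auto
    ultimately show "\<not> is_complete ?G" unfolding is_complete_def by blast
    fix x y :: "'a + 'a" assume "x \<in> Inl ` verts H" "y \<in> Inl ` verts H" "x \<noteq> y"
    then obtain s t where st: "s \<in> verts H" "t \<in> verts H" "x = Inl s" "y = Inl t" "s \<noteq> t" by auto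
    have 1: "\<forall>p\<in>{Inr s}. \<forall>q. adj ?G p q \<longrightarrow> q \<in> {Inr s} \<or> q = x"
    proof (intro ballI allI impI)
      fix p q assume "p \<in> {Inr s}" "adj ?G p q"
      then show "q \<in> {Inr s} \<or> q = x" using st by (cases q) auto
    qed
    \<comment> \<open>Seen from the leaf of \<open>s\<close>, the side of the cut vertex
      \<open>Inl t\<close> is everything except \<open>t\<close> and its leaf.\<close>
    have 2: "\<forall>p\<in>UNIV - {Inl t, Inr t}. \<forall>q. adj ?G p q \<longrightarrow> q \<in> UNIV - {Inl t, Inr t} \<or> q = y"
    proof (intro ballI allI impI)
      fix p q assume "p \<in> UNIV - {Inl t, Inr t}" "adj ?G p q"
      then show "q \<in> UNIV - {Inl t, Inr t} \<or> q = y" using st by (cases p; cases q) auto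
    qed
    show "\<exists>u\<in>verts ?G. \<exists>w\<in>verts ?G. \<exists>S T. u \<noteq> w \<and> {u, w} \<inter> {x, y} = {} \<and>
      u \<in> S \<and> w \<notin> S \<and> (\<forall>a\<in>S. \<forall>b. adj ?G a b \<longrightarrow> b \<in> S \<or> b = x) \<and>
      u \<in> T \<and> w \<notin> T \<and> (\<forall>a\<in>T. \<forall>b. adj ?G a b \<longrightarrow> b \<in> T \<or> b = y)"
      by (rule bexI[of _ "Inr s"], rule bexI[of _ "Inr t"], rule exI[of _ "{Inr s}"],
          rule exI[of _ "UNIV - {Inl t, Inr t}"], intro conjI 1 2) (use st in auto)
  qed auto
  then show "card (verts H) \<le> rvc ?G" by (simp add: card_image)
qed

section \<open>The families: complete graphs, stars, cycles and long nets\<close>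

definition rel_graph :: "'a set \<Rightarrow> ('a \<Rightarrow> 'a \<Rightarrow> bool) \<Rightarrow> 'a ugraph" where
  "rel_graph A P = UGraph A {{u, v} |u v. u \<in> A \<and> v \<in> A \<and> P u v}"

lemma verts_rel_graph [simp]: "verts (rel_graph A P) = A"
  by (simp add: rel_graph_def)

lemma adj_rel_graph:
  assumes "\<And>u v. P u v \<Longrightarrow> P v u"
  shows "adj (rel_graph A P) u v \<longleftrightarrow> u \<in> A \<and> v \<in> A \<and> P u v"
  using assms by (auto simp: adj_def rel_graph_def doubleton_eq_iff)

lemma simple_rel_graph:
  assumes "finite A" "\<And>u. \<not> P u u"
  shows "simple_graph (rel_graph A P)"
proof -
  have "u \<noteq> v" if "P u v" for u v using that assms(2) by auto
  then show ?thesis using assms(1) by (auto simp: simple_graph_def rel_graph_def)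
qed

lemma simple_complete_graph: "simple_graph (complete_graph n)"
  by (auto simp: simple_graph_def complete_graph_def)

lemma complete_graph_walk:
  assumes "u \<in> verts (complete_graph n)" "v \<in> verts (complete_graph n)"
  shows "\<exists>i\<le>1. (adj (complete_graph n) ^^ i) u v"
proof (cases "u = v")
  case True
  then show ?thesis by (intro exI[of _ 0]) simp
next
  case False
  then have "adj (complete_graph n) u v" using assms by (simp add: adj_complete_graph)
  then show ?thesis by (intro exI[of _ 1]) (simp only: relpowp_1 order_refl simp_thms)
qed

definition star :: "nat \<Rightarrow> nat ugraph" where
  "star n = rel_graph {..n} (\<lambda>i j. (i = 0) \<noteq> (j = 0))"

lemma verts_star [simp]: "verts (star n) = {..n}"
  by (simp add: star_def)

lemma adj_star: "adj (star n) i j \<longleftrightarrow> i \<le> n \<and> j \<le> n \<and> (i = 0) \<noteq> (j = 0)"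
  unfolding star_def by (subst adj_rel_graph) auto

lemma simple_star: "simple_graph (star n)"
  unfolding star_def by (rule simple_rel_graph) auto

lemma star_walk:
  assumes "u \<in> verts (star n)" "v \<in> verts (star n)"
  shows "\<exists>i\<le>2. (adj (star n) ^^ i) u v"
proof -
  consider "u = v" | "adj (star n) u v" | "adj (star n) u 0" "adj (star n) 0 v"
    using assms by (cases "u = 0"; cases "v = 0") (auto simp: adj_star)
  then show ?thesis
  proof cases
    case 1
    then show ?thesis by (intro exI[of _ 0]) simp
  next
    case 2
    then have "(adj (star n) ^^ 1) u v" by (simp only: relpowp_1)
    then show ?thesis by (intro exI[of _ 1]) simp
  next
    case 3
    then have "(adj (star n) ^^ 2) u v" by (auto simp: numeral_2_eq_2)
    then show ?thesis by blast
  qed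
qed

text \<open>The guard \<open>i \<noteq> j\<close> rules out the loop that the closing clause would
  create for \<open>n = 1\<close>.\<close>

definition cycle :: "nat \<Rightarrow> nat ugraph" where
  "cycle n = rel_graph {..<n}
     (\<lambda>i j. i \<noteq> j \<and> (j = Suc i \<or> i = Suc j \<or> (i = 0 \<and> Suc j = n) \<or> (j = 0 \<and> Suc i = n)))"

lemma verts_cycle [simp]: "verts (cycle n) = {..<n}"
  by (simp add: cycle_def)

lemma adj_cycle: "adj (cycle n) i j \<longleftrightarrow> i < n \<and> j < n \<and>
    i \<noteq> j \<and> (j = Suc i \<or> i = Suc j \<or> (i = 0 \<and> Suc j = n) \<or> (j = 0 \<and> Suc i = n))"
  unfolding cycle_def by (subst adj_rel_graph) auto

lemma simple_cycle: "simple_graph (cycle n)"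
  unfolding cycle_def by (rule simple_rel_graph) auto

lemma cycle_walk:
  assumes "u \<in> verts (cycle (2 * m))" "v \<in> verts (cycle (2 * m))" "2 \<le> m"
  shows "\<exists>i\<le>m. (adj (cycle (2 * m)) ^^ i) u v"
proof -
  let ?E = "adj (cycle (2 * m))"
  have up: "(?E ^^ (j - i)) i j" if "i \<le> j" "j < 2 * m" for i j
    using relpowp_of_fun[of i j ?E id] that by (simp add: adj_cycle)
  have less: "\<exists>n\<le>m. (?E ^^ n) i j" if ij: "i \<le> j" "j < 2 * m" for i j
  proof (cases "j - i \<le> m")
    case True
    then show ?thesis using up[OF ij] by blast
  next
    case False
    have "?E (2 * m - 1) 0" using assms(3) by (auto simp: adj_cycle)
    moreover have "(?E ^^ (2 * m - 1 - j)) j (2 * m - 1)" "(?E ^^ (i - 0)) 0 i"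
      using up[of j "2 * m - 1"] up[of 0 i] ij by auto
    ultimately have "(?E ^^ (Suc (2 * m - 1 - j) + (i - 0))) j i"
      by (meson relpowp_Suc_I relpowp_trans)
    then have "(?E ^^ (Suc (2 * m - 1 - j) + (i - 0))) i j"
      by (rule sgraph.E_walk_sym[OF sgraph.intro[OF simple_cycle]])
    moreover have "Suc (2 * m - 1 - j) + (i - 0) \<le> m" using False ij by simp
    ultimately show ?thesis by blast
  qed
  show ?thesis
  proof (cases "u \<le> v")
    case True
    then show ?thesis using less assms(2) by simp
  next
    case False
    then obtain n where "n \<le> m" "(?E ^^ n) v u" using less[of v u] assms(1) by auto
    then show ?thesis using sgraph.E_walk_sym[OF sgraph.intro[OF simple_cycle]] by blast
  qed
qed

text \<open>A triangle \<open>(0,0), (1,0), (2,0)\<close> with a path of length \<open>n\<close> attached to each of its vertices.\<close>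

definition long_net :: "nat \<Rightarrow> (nat \<times> nat) ugraph" where
  "long_net n = rel_graph ({..<3} \<times> {..n}) (\<lambda>p q. if fst p = fst q
     then snd q = Suc (snd p) \<or> snd p = Suc (snd q) else snd p = 0 \<and> snd q = 0)"

lemma verts_long_net [simp]: "verts (long_net n) = {..<3} \<times> {..n}"
  by (simp add: long_net_def)

lemma adj_long_net: "adj (long_net n) (i, j) (i', j') \<longleftrightarrow> i < 3 \<and> i' < 3 \<and> j \<le> n \<and> j' \<le> n \<and>
    (if i = i' then j' = Suc j \<or> j = Suc j' else j = 0 \<and> j' = 0)"
  unfolding long_net_def by (subst adj_rel_graph) (auto split: if_splits)

lemma simple_long_net: "simple_graph (long_net n)"
  unfolding long_net_def by (rule simple_rel_graph) auto

lemma long_net_walk: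
  assumes "u \<in> verts (long_net n)" "v \<in> verts (long_net n)"
  shows "\<exists>i\<le>2 * n + 1. (adj (long_net n) ^^ i) u v"
proof -
  let ?E = "adj (long_net n)"
  interpret sgraph "long_net n" by unfold_locales (rule simple_long_net)
  obtain a i where u: "u = (a, i)" "a < 3" "i \<le> n" using assms(1) by auto
  obtain b j where v: "v = (b, j)" "b < 3" "j \<le> n" using assms(2) by auto
  have up: "(?E ^^ (l - 0)) (c, 0) (c, l)" if "c < 3" "l \<le> n" for c l
    using relpowp_of_fun[of 0 l ?E "\<lambda>l. (c, l)"] that by (simp add: adj_long_net)
  have 1: "(?E ^^ i) u (a, 0)" using E_walk_sym[OF up[of a i]] u by simp
  have 2: "(?E ^^ j) (b, 0) v" using up[of b j] v by simp
  show ?thesis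
  proof (cases "a = b")
    case True
    then have "(?E ^^ (i + j)) u v" using 1 2 by (auto intro: relpowp_trans)
    moreover have "i + j \<le> 2 * n + 1" using u v by simp
    ultimately show ?thesis by blast
  next
    case False
    then have "?E (a, 0) (b, 0)" using u v by (simp add: adj_long_net)
    from relpowp_trans[OF relpowp_Suc_I[OF 1 this] 2] have "(?E ^^ (Suc i + j)) u v" .
    moreover have "Suc i + j \<le> 2 * n + 1" using u v by simp
    ultimately show ?thesis by blast
  qed
qed

text \<open>All \<open>3 * n\<close> vertices other than the three tips are cut vertices that need
  distinct colours, but a longest geodesic uses only two of the three legs; the gap is at least
  \<open>n - 1\<close>.\<close>

lemma large_rvc_long_net:
  assumes "1 \<le> n"
  shows "connected_graph (long_net n)" "diam (long_net n) \<le> 2 * n + 1" "3 * n \<le> rvc (long_net n)"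
proof -
  let ?G = "long_net n"
  show conn: "connected_graph ?G"
    by (rule connected_graphI[OF simple_long_net _ long_net_walk])
      (use lessThan_empty_iff[of 3] in auto)
  interpret cgraph ?G by unfold_locales (simp_all add: simple_long_net conn)
  show "diam ?G \<le> 2 * n + 1" by (rule diam_le[OF long_net_walk])
  have "card ({..<3::nat} \<times> {..<n}) \<le> rvc ?G"
  proof (rule rvc_ge_separators)
    show "{..<3} \<times> {..<n} \<subseteq> verts ?G" by auto
    have "\<not> E (0, n) (1, n)" "(0, n) \<in> V" "(1, n) \<in> V" "(0::nat, n) \<noteq> (1, n)"
      using assms by (auto simp: adj_long_net)
    then show "\<not> is_complete ?G" unfolding is_complete_def by blast
    fix x y :: "nat \<times> nat"
    assume xy: "x \<in> {..<3} \<times> {..<n}" "y \<in> {..<3} \<times> {..<n}" "x \<noteq> y"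
    have close: "\<exists>u\<in>V. \<exists>w\<in>V. \<exists>S T. u \<noteq> w \<and> {u, w} \<inter> {x, y} = {} \<and>
      u \<in> S \<and> w \<notin> S \<and> (\<forall>a\<in>S. \<forall>b. E a b \<longrightarrow> b \<in> S \<or> b = x) \<and>
      u \<in> T \<and> w \<notin> T \<and> (\<forall>a\<in>T. \<forall>b. E a b \<longrightarrow> b \<in> T \<or> b = y)"
      if "u \<in> V" "w \<in> V" "u \<noteq> w" "{u, w} \<inter> {x, y} = {}" "u \<in> S" "w \<notin> S" "u \<in> T" "w \<notin> T"
        "\<And>a b. a \<in> S \<Longrightarrow> E a b \<Longrightarrow> b \<in> S \<or> b = x" "\<And>a b. a \<in> T \<Longrightarrow> E a b \<Longrightarrow> b \<in> T \<or> b = y"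
      for u w S T
      by (rule bexI[OF _ that(1)], rule bexI[OF _ that(2)], rule exI[of _ S], rule exI[of _ T],
          intro conjI that(3-8) ballI allI impI; rule that(9,10))
    obtain i j where x: "x = (i, j)" "i < 3" "j < n" using xy by auto
    obtain i' j' where y: "y = (i', j')" "i' < 3" "j' < n" using xy by auto
    show "\<exists>u\<in>V. \<exists>w\<in>V. \<exists>S T. u \<noteq> w \<and> {u, w} \<inter> {x, y} = {} \<and>
      u \<in> S \<and> w \<notin> S \<and> (\<forall>a\<in>S. \<forall>b. E a b \<longrightarrow> b \<in> S \<or> b = x) \<and>
      u \<in> T \<and> w \<notin> T \<and> (\<forall>a\<in>T. \<forall>b. E a b \<longrightarrow> b \<in> T \<or> b = y)"
    \<comment> \<open>Two vertices of one leg both separate its tip from another tip. For different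
      legs the two tips are taken, and the side for \<open>y\<close> is the complement of the outer
      part of its leg.\<close>
    proof (cases "i = i'")
      case True
      obtain l where l: "l < 3" "l \<noteq> i" using that by (metis numeral_3_eq_3 zero_less_Suc zero_neq_one one_less_numeral_iff semiring_norm(77))
      show ?thesis
        by (rule close[of "(i, n)" "(l, n)" "{(i, s) |s. j < s}" "{(i, s) |s. j' < s}"])
          (use x y l True in \<open>auto simp: adj_long_net split: if_splits\<close>)
    next
      case False
      show ?thesis
        by (rule close[of "(i, n)" "(i', n)" "{(i, s) |s. j < s}" "UNIV - {(i', s) |s. j' \<le> s}"])
          (use x y False in \<open>auto simp: adj_long_net split: if_splits\<close>)
    qed
  qed
  then show "3 * n \<le> rvc ?G" by simp
qed

section \<open>Triangles, K4 and claws in the families\<close>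

definition triangle_free :: "'a ugraph \<Rightarrow> bool" where
  "triangle_free G \<longleftrightarrow> (\<forall>a b c. adj G a b \<longrightarrow> adj G b c \<longrightarrow> \<not> adj G a c)"

lemma triangle_free_star: "triangle_free (star n)"
  by (auto simp: triangle_free_def adj_star)

lemma triangle_free_cycle: "4 \<le> n \<Longrightarrow> triangle_free (cycle n)"
  by (auto simp: triangle_free_def adj_cycle)

lemma triangle_free_attach_pendants:
  assumes "triangle_free H" "simple_graph H"
  shows "triangle_free (attach_pendants H)"
  unfolding triangle_free_def
proof (intro allI impI notI)
  fix a b c
  assume abc: "adj (attach_pendants H) a b" "adj (attach_pendants H) b c" "adj (attach_pendants H) a c"
  interpret sgraph H by unfold_locales (rule assms)
  show False
    using abc by (cases a; cases b; cases c; simp; use assms(1) in \<open>unfold triangle_free_def, blast\<close>)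
qed

lemma triangle_free_induced_subgraph:
  assumes "induced_subgraph_of X H" "simple_graph X" "triangle_free H"
  shows "triangle_free X"
  unfolding triangle_free_def
proof (intro allI impI notI)
  interpret sgraph X by unfold_locales (rule assms)
  fix a b c assume abc: "E a b" "E b c" "E a c"
  obtain f where f: "\<forall>u\<in>V. \<forall>v\<in>V. E u v \<longleftrightarrow> adj H (f u) (f v)"
    using assms(1) unfolding induced_subgraph_of_iff by blast
  have "a \<in> V" "b \<in> V" "c \<in> V" using E_in[OF abc(1)] E_in[OF abc(2)] by simp_all
  then have "adj H (f a) (f b)" "adj H (f b) (f c)" "adj H (f a) (f c)" using f abc by blast+
  then show False using assms(3) unfolding triangle_free_def by blast
qed

lemma long_net_K4_free:
  assumes "adj (long_net n) a b" "adj (long_net n) a c" "adj (long_net n) a d"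
    "adj (long_net n) b c" "adj (long_net n) b d" "adj (long_net n) c d"
  shows False
  using assms by (cases a; cases b; cases c; cases d) (auto simp: adj_long_net split: if_splits)

text \<open>A triangle vertex sees the other two triangle vertices, which are adjacent, and at most
  one more vertex; every other vertex has at most two neighbours.\<close>

lemma long_net_claw_free:
  assumes "adj (long_net n) x a" "adj (long_net n) x b" "adj (long_net n) x c"
    "a \<noteq> b" "a \<noteq> c" "b \<noteq> c"
    "\<not> adj (long_net n) a b" "\<not> adj (long_net n) a c" "\<not> adj (long_net n) b c"
  shows False
  using assms by (cases a; cases b; cases c; cases x) (auto simp: adj_long_net split: if_splits)

section \<open>Which graphs the families contain\<close>

lemma graph_iso_sym:
  assumes "graph_iso G H"
  shows "graph_iso H G"
proof -
  obtain f where f: "bij_betw f (verts G) (verts H)"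
    "\<forall>u\<in>verts G. \<forall>v\<in>verts G. adj G u v \<longleftrightarrow> adj H (f u) (f v)"
    using assms by (auto simp: graph_iso_def)
  let ?g = "inv_into (verts G) f"
  have g: "bij_betw ?g (verts H) (verts G)" using f(1) by (rule bij_betw_inv_into)
  moreover have "adj H u v \<longleftrightarrow> adj G (?g u) (?g v)" if "u \<in> verts H" "v \<in> verts H" for u v
    using f(2) bij_betw_apply[OF g that(1)] bij_betw_apply[OF g that(2)] that
      bij_betw_inv_into_right[OF f(1)] by simp
  ultimately show ?thesis unfolding graph_iso_def by blast
qed

context cgraph
begin

lemma graph_iso_path:
  assumes "distinct xs" "set xs = V"
    "\<And>i j. i < j \<Longrightarrow> j < length xs \<Longrightarrow> E (xs ! i) (xs ! j) \<longleftrightarrow> j = Suc i"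
  shows "graph_iso G (path_graph (length xs))"
proof (rule graph_iso_sym)
  have "bij_betw ((!) xs) {..<length xs} V" using bij_betw_nth[OF assms(1)] assms(2) by simp
  moreover have "adj (path_graph (length xs)) i j \<longleftrightarrow> E (xs ! i) (xs ! j)"
    if "i < length xs" "j < length xs" for i j
    using assms(3)[of i j] assms(3)[of j i] that E_commute[of "xs ! i" "xs ! j"]
    by (cases i j rule: linorder_cases) (auto simp: adj_path_graph)
  ultimately show "graph_iso (path_graph (length xs)) G"
    unfolding graph_iso_def by (intro exI[of _ "(!) xs"]) simp
qed

lemma graph_iso_P3:
  assumes "V = {a, b, c}" "distinct [a, b, c]" "E a b" "E b c" "\<not> E a c"
  shows "graph_iso G (path_graph 3)"
proof -
  have "E ([a, b, c] ! i) ([a, b, c] ! j) \<longleftrightarrow> j = Suc i" if "i < j" "j < 3" for i j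
    using that assms by (auto simp: less_Suc_eq numeral_eq_Suc)
  then show ?thesis using graph_iso_path[of "[a, b, c]"] assms(1,2) by (simp add: eval_nat_numeral)
qed

lemma graph_iso_P4:
  assumes "V = {a, b, c, d}" "distinct [a, b, c, d]" "E a b" "E b c" "E c d"
    "\<not> E a c" "\<not> E a d" "\<not> E b d"
  shows "graph_iso G (path_graph 4)"
proof -
  have "E ([a, b, c, d] ! i) ([a, b, c, d] ! j) \<longleftrightarrow> j = Suc i" if "i < j" "j < 4" for i j
    using that assms by (auto simp: less_Suc_eq numeral_eq_Suc)
  then show ?thesis using graph_iso_path[of "[a, b, c, d]"] assms(1,2) by (simp add: eval_nat_numeral)
qed

lemma graph_iso_P5:
  assumes "V = {a, b, c, d, e}" "distinct [a, b, c, d, e]" "E a b" "E b c" "E c d" "E d e"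
    "\<not> E a c" "\<not> E a d" "\<not> E a e" "\<not> E b d" "\<not> E b e" "\<not> E c e"
  shows "graph_iso G (path_graph 5)"
proof -
  have "E ([a, b, c, d, e] ! i) ([a, b, c, d, e] ! j) \<longleftrightarrow> j = Suc i" if "i < j" "j < 5" for i j
    using that assms by (auto simp: less_Suc_eq numeral_eq_Suc)
  then show ?thesis using graph_iso_path[of "[a, b, c, d, e]"] assms(1,2) by (simp add: eval_nat_numeral)
qed

lemma closed_set:
  assumes "u \<in> V" "u \<in> S" "\<And>a b. a \<in> S \<Longrightarrow> E a b \<Longrightarrow> b \<in> S"
  shows "V \<subseteq> S"
proof
  fix w assume "w \<in> V"
  then have "(E ^^ graph_dist G u w) u w" using relpowp_dist assms(1) by blast
  moreover have "(E ^^ n) x y \<Longrightarrow> x \<in> S \<Longrightarrow> y \<in> S" for n x y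
    by (induction n arbitrary: y) (use assms(3) in auto)
  ultimately show "w \<in> S" using assms(2) by blast
qed

lemma nbr_exists:
  assumes "u \<in> V" "2 \<le> card V"
  shows "\<exists>w. E u w"
proof (rule ccontr)
  assume "\<not> ?thesis"
  then have "V \<subseteq> {u}" by (intro closed_set[OF assms(1)]) auto
  then have "card V \<le> card {u}" by (intro card_mono) auto
  then show False using assms(2) by simp
qed

text \<open>Without a triangle at most two clique vertices \<open>I\<close> occur. By connectedness
  each occurring leaf brings its clique vertex along, so the leaves \<open>J\<close> inject into
  \<open>I\<close>; with at least three vertices only P3 and P4 remain.\<close>

lemma K_h_triangle:
  assumes "induced_subgraph_of G (K_h t)" "3 \<le> card V"
    "\<not> graph_iso G (path_graph 3)" "\<not> graph_iso G (path_graph 4)"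
  shows "\<exists>a b c. E a b \<and> E b c \<and> E a c"
proof (rule ccontr)
  assume neg: "\<not> ?thesis"
  obtain f where f: "inj_on f V" "f ` V \<subseteq> verts (K_h t)"
    "\<forall>u\<in>V. \<forall>v\<in>V. E u v \<longleftrightarrow> adj (K_h t) (f u) (f v)"
    using assms(1) unfolding induced_subgraph_of_iff by blast
  define I where "I = {u \<in> V. \<exists>i. f u = Inl i}"
  define J where "J = {u \<in> V. \<exists>i. f u = Inr i}"
  have VIJ: "V = I \<union> J" "I \<inter> J = {}" by (auto simp: I_def J_def) (metis sum.exhaust)+
  have fin: "finite I" "finite J" by (auto simp: I_def J_def)
  have lt: "f u = Inl i \<Longrightarrow> u \<in> V \<Longrightarrow> i < t" for u i using f(2) by (auto simp: K_h_def)
  have adjI: "E u v" if uv: "u \<in> I" "v \<in> I" "u \<noteq> v" for u v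
  proof -
    obtain i j where ij: "f u = Inl i" "f v = Inl j" "u \<in> V" "v \<in> V" using uv by (auto simp: I_def)
    then have "i \<noteq> j" using inj_on_eq_iff[OF f(1) ij(3,4)] uv(3) by auto
    then show ?thesis using ij f(3) lt by (simp add: K_h_def adj_complete_graph)
  qed
  have adjJ: "\<not> E u v" if "u \<in> J" "v \<in> J" for u v
    using that f(3) by (auto simp: J_def K_h_def)
  have adjIJ: "E u v \<longleftrightarrow> i = j" if "f u = Inl i" "f v = Inr j" "u \<in> V" "v \<in> V" for u v i j
    using that f(3) lt by (auto simp: K_h_def)
  have "card I \<le> 2"
  proof (rule ccontr)
    assume "\<not> ?thesis"
    then obtain T where "T \<subseteq> I" "card T = 3" by (metis obtain_subset_with_card_n not_less_eq_eq numeral_2_eq_2 numeral_3_eq_3)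
    then obtain a b c where "T = {a, b, c}" "a \<noteq> b" "a \<noteq> c" "b \<noteq> c" by (metis card_3_iff)
    then show False using neg adjI \<open>T \<subseteq> I\<close> by (metis insert_subset)
  qed
  have J_nbr: "\<exists>a\<in>I. \<exists>i. f u = Inr i \<and> f a = Inl i" if uJ: "u \<in> J" for u
  proof -
    have u: "u \<in> V" using that VIJ by blast
    obtain w where w: "E u w" using nbr_exists[OF u] assms(2) by auto
    then have "w \<in> V" by (rule E_in)
    moreover have "w \<notin> J" using adjJ that w by blast
    ultimately have "w \<in> I" using VIJ by blast
    moreover obtain i where "f u = Inr i" using uJ by (auto simp: J_def)
    moreover obtain j where "f w = Inl j" using \<open>w \<in> I\<close> by (auto simp: I_def)
    ultimately show ?thesis using adjIJ[of w j u i] w u \<open>w \<in> V\<close> E_commute by auto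
  qed
  define p where "p u = (SOME a. a \<in> I \<and> (\<exists>i. f u = Inr i \<and> f a = Inl i))" for u
  have p: "p u \<in> I" "\<exists>i. f u = Inr i \<and> f (p u) = Inl i" if "u \<in> J" for u
    using someI_ex[of "\<lambda>a. a \<in> I \<and> (\<exists>i. f u = Inr i \<and> f a = Inl i)"] J_nbr[OF that]
    unfolding p_def by auto
  have pinj: "inj_on p J"
  proof (rule inj_onI)
    fix u v assume uv: "u \<in> J" "v \<in> J" "p u = p v"
    then have "f u = f v" using p(2)[OF uv(1)] p(2)[OF uv(2)] by auto
    then show "u = v" using f(1) uv VIJ by (auto simp: inj_on_def)
  qed
  have "card J \<le> card I" using pinj p(1) fin by (intro card_inj_on_le[of p]) auto
  moreover have "card V = card I + card J" using VIJ fin card_Un_disjoint by metis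
  ultimately have c: "card I = 2" "card J = 1 \<or> card J = 2" using assms(2) \<open>card I \<le> 2\<close> by auto
  obtain a b where ab: "I = {a, b}" "a \<noteq> b" using c(1) by (metis card_2_iff)
  have Eab: "E a b" using adjI ab by auto
  have pE: "E (p u) w \<longleftrightarrow> w = u" if uw: "u \<in> J" "w \<in> J" for u w
  proof -
    obtain i where i: "f u = Inr i" "f (p u) = Inl i" using p(2)[OF uw(1)] by blast
    obtain j where j: "f w = Inr j" using uw(2) by (auto simp: J_def)
    have "E (p u) w \<longleftrightarrow> i = j" by (rule adjIJ[OF i(2) j]) (use p(1)[OF that(1)] that VIJ in auto)
    also have "\<dots> \<longleftrightarrow> w = u" using i j f(1) that VIJ by (auto simp: inj_on_def)
    finally show ?thesis .
  qed
  have pE2: "\<not> E q u" if uq: "u \<in> J" "q \<in> I" "q \<noteq> p u" for u q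
  proof -
    obtain i where i: "f u = Inr i" "f (p u) = Inl i" using p(2)[OF uq(1)] by blast
    obtain j where j: "f q = Inl j" using uq(2) by (auto simp: I_def)
    have "E q u \<longleftrightarrow> j = i" by (rule adjIJ[OF j i(1)]) (use that VIJ in auto)
    moreover have "j \<noteq> i" using i j f(1) that p(1)[OF that(1)] VIJ by (auto simp: inj_on_def)
    ultimately show ?thesis by simp
  qed
  obtain x where x: "x \<in> J" using c(2) by fastforce
  obtain q where q: "I = {p x, q}" "p x \<noteq> q" using ab p(1)[OF x] by auto
  have qx: "\<not> E q x" using pE2[OF x, of q] q by auto
  have Epq: "E (p x) q" using adjI q by auto
  have Epx: "E x (p x)" using pE[OF x x] E_commute by simp
  have xne: "x \<noteq> p x" "x \<noteq> q" using x q VIJ by auto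
  from c(2) show False
  proof
    assume "card J = 1"
    then have "J = {x}" using x by (metis card_1_singletonE singletonD)
    then have "V = {x, p x, q}" using VIJ(1) q(1) by auto
    then have "graph_iso G (path_graph 3)"
      by (rule graph_iso_P3) (use xne q(2) Epx Epq qx E_commute[of x q] in auto)
    then show False using assms(3) by blast
  next
    assume "card J = 2"
    then obtain y where y: "J = {x, y}" "x \<noteq> y" using x by (metis card_2_iff insertE insert_commute singletonD)
    then have yJ: "y \<in> J" by simp
    have "p y \<noteq> p x" using pinj x yJ y(2) by (auto simp: inj_on_def)
    then have py: "p y = q" using p(1)[OF yJ] q(1) by auto
    have Eqy: "E q y" using pE[OF yJ yJ] py by simp
    have "\<not> E (p x) y" using pE[OF x yJ] y(2) by simp
    moreover have "\<not> E x y" using adjJ x yJ by simp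
    moreover have "V = {x, p x, q, y}" using VIJ(1) q(1) y(1) by auto
    moreover have "y \<noteq> p x" "y \<noteq> q" using yJ q VIJ by auto
    ultimately have "graph_iso G (path_graph 4)"
      by (intro graph_iso_P4[of x "p x" q y]) (use xne q(2) y(2) Epx Epq qx Eqy E_commute[of x q] in auto)
    then show False using assms(4) by blast
  qed
qed

text \<open>Having no K4 leaves at most three clique indices \<open>I\<close>, and connectedness
  gives every leaf an index in \<open>I\<close>. Renumbering \<open>I\<close> into
  \<open>{..<3}\<close> on clique vertices and leaves alike lands in the net.\<close>

lemma induced_net_of_K_h:
  assumes "induced_subgraph_of G (K_h t)" "2 \<le> card V"
    "\<And>a b c d. E a b \<Longrightarrow> E a c \<Longrightarrow> E a d \<Longrightarrow> E b c \<Longrightarrow> E b d \<Longrightarrow> E c d \<Longrightarrow> False"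
  shows "induced_subgraph_of G net"
proof -
  obtain f where f: "inj_on f V" "f ` V \<subseteq> verts (K_h t)"
    "\<forall>u\<in>V. \<forall>v\<in>V. E u v \<longleftrightarrow> adj (K_h t) (f u) (f v)"
    using assms(1) unfolding induced_subgraph_of_iff by blast
  define I where "I = {i. Inl i \<in> f ` V}"
  have lt: "i < t" if "i \<in> I" for i using that f(2) by (auto simp: I_def K_h_def)
  have fin: "finite I"
    using finite_subset[of I "{..<t}"] lt by auto
  have "card I \<le> 3"
  proof (rule ccontr)
    assume "\<not> ?thesis"
    then have "4 \<le> card I" by simp
    then obtain T where T: "T \<subseteq> I" "card T = 4" by (metis obtain_subset_with_card_n)
    define g where "g i = inv_into V f (Inl i)" for i
    have g: "g i \<in> V" "f (g i) = Inl i" if "i \<in> T" for i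
      using that T(1) inv_into_into[of "Inl i" f V] f_inv_into_f[of "Inl i" f V] by (auto simp: I_def g_def)
    have E: "E (g i) (g j)" if "i \<in> T" "j \<in> T" "i \<noteq> j" for i j
      using g[OF that(1)] g[OF that(2)] f(3) that T(1) lt by (auto simp: K_h_def adj_complete_graph)
    obtain a b c d where "T = {a, b, c, d}" "distinct [a, b, c, d]"
      using T(2) by (auto simp: numeral_eq_Suc card_Suc_eq)
    then show False using assms(3)[of "g a" "g b" "g c" "g d"] E by auto
  qed
  then obtain e where e: "e ` I \<subseteq> {..<3::nat}" "inj_on e I"
    using fin card_le_inj[of I "{..<3::nat}"] by auto
  have cl: "\<exists>i\<in>I. f u = Inl i \<or> f u = Inr i" if u: "u \<in> V" for u
  proof (cases "f u")
    case (Inl i)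
    then show ?thesis using u by (metis I_def image_eqI mem_Collect_eq)
  next
    case (Inr i)
    obtain w where w: "E u w" using nbr_exists[OF u assms(2)] by blast
    then have "w \<in> V" by (rule E_in)
    have "adj (K_h t) (Inr i) (f w)" using w u \<open>w \<in> V\<close> f(3) Inr by auto
    then have "f w = Inl i" by (cases "f w") (auto simp: K_h_def)
    then have "i \<in> I" using \<open>w \<in> V\<close> by (metis I_def image_eqI mem_Collect_eq)
    then show ?thesis using Inr by blast
  qed
  let ?h = "map_sum e e \<circ> f"
  have ee: "e i = e j \<longleftrightarrow> i = j" if "i \<in> I" "j \<in> I" for i j using e(2) that by (simp add: inj_on_eq_iff)
  have e3: "e i < 3" if "i \<in> I" for i using e(1) that by auto
  have adj: "E u v \<longleftrightarrow> adj net (?h u) (?h v)" if uv: "u \<in> V" "v \<in> V" for u v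
  proof -
    obtain i j where ij: "i \<in> I" "j \<in> I" "f u = Inl i \<or> f u = Inr i" "f v = Inl j \<or> f v = Inr j"
      using cl uv by blast
    have "E u v \<longleftrightarrow> adj (K_h t) (f u) (f v)" using f(3) uv by blast
    also have "\<dots> \<longleftrightarrow> adj net (?h u) (?h v)"
      using ij lt e3 ee[OF ij(1,2)] by (auto simp: K_h_def net_def adj_complete_graph)
    finally show ?thesis .
  qed
  have inj: "inj_on ?h V"
  proof (rule inj_onI)
    fix u v assume uv: "u \<in> V" "v \<in> V" "?h u = ?h v"
    obtain i j where ij: "i \<in> I" "j \<in> I" "f u = Inl i \<or> f u = Inr i" "f v = Inl j \<or> f v = Inr j"
      using cl uv by blast
    then have "f u = f v" using uv(3) ee[OF ij(1,2)] by auto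
    then show "u = v" using f(1) uv by (simp add: inj_on_eq_iff)
  qed
  have "?h u \<in> verts net" if "u \<in> V" for u using cl[OF that] e3 by (auto simp: net_def)
  then have sub: "?h ` V \<subseteq> verts net" by blast
  show ?thesis unfolding induced_subgraph_of_iff using inj sub adj by blast
qed

text \<open>\<open>c\<close> is the vertex placed at the centre of the star. It must occur: without
  it, connectedness confines the graph to one star leaf and its pendant, which is too small. Every
  vertex that is not \<open>c\<close> or a neighbour of \<open>c\<close> is a pendant, and
  \<open>p\<close> gives its support.\<close>

lemma spider_structure:
  assumes "induced_subgraph_of G (attach_pendants (star n))" "3 \<le> card V"
  shows "\<exists>c\<in>V. \<exists>p. (\<forall>u\<in>V - {c} - {b. E c b}. E c (p u) \<and> (\<forall>w. E u w \<longleftrightarrow> w = p u)) \<and>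
    inj_on p (V - {c} - {b. E c b})"
proof -
  let ?H = "attach_pendants (star n)"
  obtain g where g: "inj_on g V" "g ` V \<subseteq> verts ?H" "\<forall>u\<in>V. \<forall>v\<in>V. E u v \<longleftrightarrow> adj ?H (g u) (g v)"
    using assms(1) unfolding induced_subgraph_of_iff by blast
  have adjg: "adj ?H (g u) (g v)" if "E u v" for u v
    using g(3) E_in[OF that] that by blast
  have "\<exists>c\<in>V. g c = Inl 0"
  proof (rule ccontr)
    assume none: "\<not> ?thesis"
    obtain u where u: "u \<in> V" using V_nonempty by blast
    obtain i where i: "g u = Inl i \<or> g u = Inr i" by (cases "g u") auto
    define S where "S = {w \<in> V. g w = Inl i \<or> g w = Inr i}"
    have "V \<subseteq> S"
    proof (rule closed_set[OF u])
      show "u \<in> S" using u i by (simp add: S_def)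
      fix a b assume a: "a \<in> S" "E a b"
      have b: "b \<in> V" using E_in[OF a(2)] by simp
      have nz: "g a \<noteq> Inl 0" "g b \<noteq> Inl 0" using none b a(1) by (auto simp: S_def)
      have "g b = Inl i \<or> g b = Inr i"
        using a(1) adjg[OF a(2)] nz by (cases "g b") (auto simp: S_def adj_star)
      then show "b \<in> S" using b by (simp add: S_def)
    qed
    have "card V = card (g ` V)" using g(1) by (simp add: card_image)
    also have "\<dots> \<le> card {Inl i, Inr i :: nat + nat}"
      by (rule card_mono) (use \<open>V \<subseteq> S\<close> in \<open>auto simp: S_def\<close>)
    also have "\<dots> \<le> 2" by (simp add: card_insert_if)
    finally show False using assms(2) by simp
  qed
  then obtain c where c: "c \<in> V" "g c = Inl 0" by blast
  let ?T = "V - {c} - {b. E c b}"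
  have T: "\<exists>w i. E c w \<and> g u = Inr i \<and> g w = Inl i \<and> (\<forall>x. E u x \<longleftrightarrow> x = w)" if uT: "u \<in> ?T" for u
  proof -
    have u: "u \<in> V" "u \<noteq> c" "\<not> E c u" using uT by auto
    have nadj: "\<not> adj ?H (Inl 0) (g u)" using g(3) c u by auto
    have "g u \<noteq> Inl 0" using inj_on_eq_iff[OF g(1) u(1) c(1)] u(2) c(2) by auto
    have "g u \<in> verts ?H" using g(2) u(1) by blast
    then obtain i where i: "g u = Inr i" "i \<noteq> 0" "i \<le> n"
      using nadj \<open>g u \<noteq> Inl 0\<close> by (cases "g u") (auto simp: adj_star)
    obtain w where w: "E u w" using nbr_exists[OF u(1)] assms(2) by auto
    have nb: "g x = Inl i" if "E u x" for x
      using adjg[OF that] i(1) by (cases "g x") auto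
    have wV: "w \<in> V" using E_in[OF w] by simp
    have "adj ?H (g c) (g w)" using nb[OF w] c(2) i by (simp add: adj_star)
    then have "E c w" using g(3) c(1) wV by blast
    moreover have "E u x \<longleftrightarrow> x = w" for x
    proof
      assume x: "E u x"
      then have "x \<in> V" by (rule E_in)
      then show "x = w" using inj_on_eq_iff[OF g(1) _ wV, of x] nb[OF x] nb[OF w] by simp
    qed (use w in simp)
    ultimately show ?thesis using i(1) nb[OF w] by blast
  qed
  define p where "p u = (THE w. E u w)" for u
  have p: "E c (p u) \<and> (\<forall>w. E u w \<longleftrightarrow> w = p u)" "\<exists>i. g u = Inr i \<and> g (p u) = Inl i" if "u \<in> ?T" for u
  proof -
    from T[OF that] obtain w i where w: "E c w" "g u = Inr i" "g w = Inl i" "\<forall>x. E u x \<longleftrightarrow> x = w"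
      by (elim exE conjE)
    have "p u = w" unfolding p_def by (rule the_equality) (use w(4) in auto)
    then show "E c (p u) \<and> (\<forall>w. E u w \<longleftrightarrow> w = p u)" "\<exists>i. g u = Inr i \<and> g (p u) = Inl i" using w by simp_all
  qed
  have "inj_on p ?T"
  proof (rule inj_onI)
    fix u v assume uv: "u \<in> ?T" "v \<in> ?T" "p u = p v"
    obtain i where "g u = Inr i" "g (p u) = Inl i" using p(2)[OF uv(1)] by blast
    moreover obtain j where "g v = Inr j" "g (p v) = Inl j" using p(2)[OF uv(2)] by blast
    ultimately have "g u = g v" using uv(3) by simp
    then show "u = v" using inj_on_eq_iff[OF g(1)] uv by blast
  qed
  moreover have "\<forall>u\<in>?T. E c (p u) \<and> (\<forall>w. E u w \<longleftrightarrow> w = p u)" using p(1) by blast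
  ultimately show ?thesis using c(1) by blast
qed

text \<open>A cycle vertex has two cycle neighbours and its pendant. Degree three uses all of them,
  and the pendant is then a neighbour of degree one.\<close>

lemma pendant_cycle_nbrs:
  assumes "induced_subgraph_of G (attach_pendants (cycle n))" "c \<in> V"
  shows "card {b. E c b} \<le> 3" "card {b. E c b} = 3 \<Longrightarrow> \<exists>b. E c b \<and> (\<forall>u. E b u \<longrightarrow> u = c)"
proof -
  let ?H = "attach_pendants (cycle n)"
  let ?B = "{b. E c b}"
  obtain h where h: "inj_on h V" "h ` V \<subseteq> verts ?H" "\<forall>u\<in>V. \<forall>v\<in>V. E u v \<longleftrightarrow> adj ?H (h u) (h v)"
    using assms(1) unfolding induced_subgraph_of_iff by blast
  have adjh: "adj ?H (h u) (h v)" if "E u v" for u v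
    using h(3) E_in[OF that] that by blast
  have BV: "?B \<subseteq> V" using E_in by blast
  then have cB: "card ?B = card (h ` ?B)" using card_image[OF inj_on_subset[OF h(1) BV]] by simp
  have fB: "finite ?B" using BV finV finite_subset by blast
  have both: "card ?B \<le> 3 \<and> (card ?B = 3 \<longrightarrow> (\<exists>b. E c b \<and> (\<forall>u. E b u \<longrightarrow> u = c)))"
  proof (cases "h c")
    case (Inr i)
    have "h b = Inl i" if "E c b" for b using adjh[OF that] Inr by (cases "h b") auto
    then have "h ` ?B \<subseteq> {Inl i}" by blast
    then have "card (h ` ?B) \<le> card {Inl i :: nat + nat}" by (intro card_mono) auto
    then show ?thesis using cB by simp
  next
    case hc: (Inl i)
    define s where "s = (if Suc i = n then 0 else Suc i)"
    define t where "t = (if i = 0 then n - 1 else i - 1)"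
    have nb: "h b \<in> {Inl s, Inl t, Inr i}" if "E c b" for b
    proof (cases "h b")
      case (Inl j)
      then have "adj (cycle n) i j" using adjh[OF that] hc by simp
      then consider "j = Suc i" "Suc i \<noteq> n" | "i = Suc j" | "i = 0" "Suc j = n" | "j = 0" "Suc i = n"
        unfolding adj_cycle by blast
      then have "j = s \<or> j = t" by cases (auto simp: s_def t_def)
      then show ?thesis using Inl by blast
    next
      case (Inr j)
      then show ?thesis using adjh[OF that] hc by simp
    qed
    then have sub: "h ` ?B \<subseteq> {Inl s, Inl t, Inr i}" by blast
    have c3: "card {Inl s, Inl t, Inr i :: nat + nat} \<le> 3" by (simp add: card_insert_if)
    have "card ?B \<le> card {Inl s, Inl t, Inr i :: nat + nat}" unfolding cB by (rule card_mono[OF _ sub]) simp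
    then have "card ?B \<le> 3" using c3 by linarith
    moreover have "\<exists>b. E c b \<and> (\<forall>u. E b u \<longrightarrow> u = c)" if c: "card ?B = 3"
    proof -
      have "card (h ` ?B) = card {Inl s, Inl t, Inr i :: nat + nat}"
        using c c3 cB card_mono[OF _ sub] by simp
      then have "h ` ?B = {Inl s, Inl t, Inr i}" by (intro card_subset_eq[OF _ sub]) simp_all
      then have "Inr i \<in> h ` ?B" by simp
      then obtain b where b: "E c b" "h b = Inr i" by force
      have "u = c" if "E b u" for u
      proof -
        have "h u = Inl i" using adjh[OF that] b(2) by (cases "h u") auto
        moreover have "u \<in> V" using E_in[OF that] by simp
        ultimately show ?thesis using inj_on_eq_iff[OF h(1) _ assms(2), of u] hc by simp
      qed
      then show ?thesis using b(1) by blast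
    qed
    ultimately show ?thesis by blast
  qed
  then show "card ?B \<le> 3" "card ?B = 3 \<Longrightarrow> \<exists>b. E c b \<and> (\<forall>u. E b u \<longrightarrow> u = c)" by blast+
qed

text \<open>The graph is a spider around \<open>c\<close> with at most three legs of length one or
  two. With at most two legs it is a path on at most five vertices; with three, one leg has length
  one, so it fits into \<open>S122\<close> and contains a claw at \<open>c\<close>.\<close>

lemma P5_or_S122:
  assumes V3: "3 \<le> card V" "\<not> graph_iso G (path_graph 3)" "\<not> graph_iso G (path_graph 4)"
    and H: "induced_subgraph_of G (attach_pendants (star n))"
    "induced_subgraph_of G (attach_pendants (cycle m))"
    and tri: "triangle_free G"
  shows "graph_iso G (path_graph 5) \<or> (induced_subgraph_of G S122 \<and>
    (\<exists>c x y z. E c x \<and> E c y \<and> E c z \<and> x \<noteq> y \<and> x \<noteq> z \<and> y \<noteq> z))"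
proof -
  obtain c p where c: "c \<in> V" and p': "\<forall>u\<in>V - {c} - {b. E c b}. E c (p u) \<and> (\<forall>w. E u w \<longleftrightarrow> w = p u)"
    and pinj: "inj_on p (V - {c} - {b. E c b})"
    using spider_structure[OF H(1) V3(1)] by (elim bexE exE conjE)
  define B where "B = {b. E c b}"
  define T where "T = V - {c} - B"
  have p: "p u \<in> B" "E u w \<longleftrightarrow> w = p u" "E w u \<longleftrightarrow> w = p u" if "u \<in> T" for u w
    using p' that E_commute[of w u] by (auto simp: T_def B_def)
  have pinj: "inj_on p T" using pinj by (simp add: T_def B_def)
  have B3: "card B \<le> 3" "card B = 3 \<Longrightarrow> \<exists>b\<in>B. \<forall>u. E b u \<longrightarrow> u = c"
    using pendant_cycle_nbrs[OF H(2) c] by (auto simp: B_def)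
  have BV: "B \<subseteq> V" using E_in by (auto simp: B_def)
  have cB: "c \<notin> B" "c \<notin> T" by (auto simp: B_def T_def)
  have BT: "B \<inter> T = {}" by (auto simp: T_def)
  have fin: "finite B" "finite T" using BV finV finite_subset by (auto simp: T_def)
  have V: "V = insert c (B \<union> T)" using BV c by (auto simp: T_def)
  have cardV: "card V = Suc (card B + card T)"
    unfolding V using fin cB BT by (simp add: card_Un_disjoint)
  have cardT: "card T \<le> card B" using pinj p(1) fin by (intro card_inj_on_le[of p]) auto
  have Ec: "E c b" "E b c" if "b \<in> B" for b using that E_commute by (auto simp: B_def)
  have EB: "\<not> E b b'" if "b \<in> B" "b' \<in> B" for b b'
    using tri that Ec unfolding triangle_free_def by blast
  have EcT: "\<not> E c u" "\<not> E u c" if "u \<in> T" for u using that E_commute[of u c] by (auto simp: T_def B_def)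
  have ET: "\<not> E u u'" if "u \<in> T" "u' \<in> T" for u u'
    using p(1)[OF that(1)] p(2)[OF that(1)] that(2) BT by auto
  consider "card B = 0" | "card B = 1" | "card B = 2" | "card B = 3" using B3(1) by linarith
  then show ?thesis
  proof cases
    case 1
    then show ?thesis using cardV cardT V3 by simp
  next
    case 2
    then have "card T = 1" using cardV cardT V3 by simp
    then obtain u where u: "T = {u}" by (metis card_1_singletonE)
    from 2 obtain b where b: "B = {b}" by (metis card_1_singletonE)
    have pu: "p u = b" using p(1)[of u] u b by simp
    have "graph_iso G (path_graph 3)"
    proof (rule graph_iso_P3[of c b u])
      show "V = {c, b, u}" using V u b by auto
      show "distinct [c, b, u]" using cB BT u b by auto
      show "E c b" "E b u" "\<not> E c u" using Ec b EcT u p(3)[of u b] pu by auto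
    qed
    then show ?thesis using V3 by blast
  next
    case 3
    then obtain b1 b2 where b: "B = {b1, b2}" "b1 \<noteq> b2" by (metis card_2_iff)
    consider "card T = 0" | "card T = 1" | "card T = 2" using cardT 3 by linarith
    then show ?thesis
    proof cases
      case 1
      then have "T = {}" using fin by simp
      have "graph_iso G (path_graph 3)"
      proof (rule graph_iso_P3[of b1 c b2])
        show "V = {b1, c, b2}" using V \<open>T = {}\<close> b by auto
        show "distinct [b1, c, b2]" using cB b by auto
        show "E b1 c" "E c b2" "\<not> E b1 b2" using Ec EB b by auto
      qed
      then show ?thesis using V3 by blast
    next
      case 2
      then obtain u where u: "T = {u}" by (metis card_1_singletonE)
      have "p u \<in> {b1, b2}" using p(1)[of u] u b by simp
      then obtain a a' where a: "B = {a, a'}" "a \<noteq> a'" "p u = a" using b by auto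
      have "graph_iso G (path_graph 4)"
      proof (rule graph_iso_P4[of u a c a'])
        show "V = {u, a, c, a'}" using V u a by auto
        show "distinct [u, a, c, a']" using cB BT u a by auto
        show "E u a" "E a c" "E c a'" "\<not> E u c" "\<not> E u a'" "\<not> E a a'"
          using Ec EB EcT p(2)[of u] u a by auto
      qed
      then show ?thesis using V3 by blast
    next
      case 3
      then obtain u u' where u: "T = {u, u'}" "u \<noteq> u'" by (metis card_2_iff)
      have "p u \<noteq> p u'" using inj_on_eq_iff[OF pinj, of u u'] u by simp
      moreover have "p u \<in> B" "p u' \<in> B" using p(1) u by simp_all
      ultimately have B: "B = {p u, p u'}" using b by auto
      have "graph_iso G (path_graph 5)"
      proof (rule graph_iso_P5[of u "p u" c "p u'" u'])
        show "V = {u, p u, c, p u', u'}" using V u B by auto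
        show "distinct [u, p u, c, p u', u']" using cB BT u B \<open>p u \<noteq> p u'\<close> by auto
        show "E u (p u)" "\<not> E u (p u')" "E (p u') u'" "\<not> E (p u) u'"
          using p(2)[of u] p(3)[of u'] u(1) \<open>p u \<noteq> p u'\<close> by auto
        show "E (p u) c" "E c (p u')" "\<not> E u c" "\<not> E c u'" using Ec EcT u(1) B by blast+
        show "\<not> E u u'" "\<not> E (p u) (p u')" using ET EB u(1) B by blast+
      qed
      then show ?thesis ..
    qed
  next
    case 4
    obtain b3 where b3: "b3 \<in> B" "\<And>u. E b3 u \<Longrightarrow> u = c" using B3(2)[OF 4] by blast
    have "card (B - {b3}) = 2" using 4 b3(1) by simp
    then obtain b1 b2 where b12: "B - {b3} = {b1, b2}" "b1 \<noteq> b2" by (metis card_2_iff)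
    then have b: "B = {b1, b2, b3}" "b1 \<noteq> b3" "b2 \<noteq> b3" using b3(1) by auto
    have pT: "p u = b1 \<or> p u = b2" if "u \<in> T" for u
    proof -
      have "p u \<noteq> b3"
      proof
        assume "p u = b3"
        then have "E b3 u" using p(3)[OF that] by simp
        then show False using b3(2) that cB(2) by blast
      qed
      then show ?thesis using p(1)[OF that] b(1) by blast
    qed
    \<comment> \<open>The bare leg \<open>b3\<close> goes to 0--1, the legs of \<open>b1\<close> and
      \<open>b2\<close> to 0--2--3 and 0--4--5; a tip is sorted by its support
      \<open>p u\<close>.\<close>
    define F :: "'a \<Rightarrow> nat" where "F u = (if u = c then 0 else if u = b3 then 1 else if u = b1 then 2
      else if u = b2 then 4 else if p u = b1 then 3 else 5)" for u
    have ne: "c \<noteq> b1" "c \<noteq> b2" "c \<noteq> b3" using cB b by auto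
    have F: "F c = 0" "F b3 = 1" "F b1 = 2" "F b2 = 4" using ne b b12(2) by (auto simp: F_def)
    have FT: "F u = (if p u = b1 then 3 else 5)" if "u \<in> T" for u
      using that cB BT b by (auto simp: F_def)
    have Vc: "u = c \<or> u = b1 \<or> u = b2 \<or> u = b3 \<or> u \<in> T" if "u \<in> V" for u using that V b by auto
    have Eb: "E c b1" "E c b2" "E c b3" "E b1 c" "E b2 c" "E b3 c" using Ec b by auto
    have nb: "\<not> E x y" if "x \<in> {b1, b2, b3}" "y \<in> {b1, b2, b3}" for x y using EB that b(1) by blast
    have adj: "E u w \<longleftrightarrow> adj S122 (F u) (F w)" if uw: "u \<in> V" "w \<in> V" for u w
    proof -
      consider "u \<notin> T" "w \<notin> T" | "u \<in> T" "w \<notin> T" | "u \<notin> T" "w \<in> T" | "u \<in> T" "w \<in> T" by blast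
      then show ?thesis
      proof cases
        case 1
        then have "u = c \<or> u = b1 \<or> u = b2 \<or> u = b3" "w = c \<or> w = b1 \<or> w = b2 \<or> w = b3" using Vc uw by blast+
        then show ?thesis using F Eb nb by (elim disjE) (simp_all add: adj_S122)
      next
        case 2
        then have "w = c \<or> w = b1 \<or> w = b2 \<or> w = b3" using Vc uw by blast
        then show ?thesis using F FT[OF 2(1)] pT[OF 2(1)] p(2)[OF 2(1), of w] ne b(2,3) b12(2)
          by (elim disjE) (simp_all add: adj_S122)
      next
        case 3
        then have "u = c \<or> u = b1 \<or> u = b2 \<or> u = b3" using Vc uw by blast
        then show ?thesis using F FT[OF 3(2)] pT[OF 3(2)] p(3)[OF 3(2), of u] ne b(2,3) b12(2)
          by (elim disjE) (simp_all add: adj_S122)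
      next
        case 4
        then show ?thesis using ET FT by (simp add: adj_S122)
      qed
    qed
    have inj: "inj_on F V"
    proof (rule inj_onI)
      fix u w assume uw: "u \<in> V" "w \<in> V" "F u = F w"
      consider "u \<notin> T" "w \<notin> T" | "u \<in> T" "w \<notin> T" | "u \<notin> T" "w \<in> T" | "u \<in> T" "w \<in> T" by blast
      then show "u = w"
      proof cases
        case 1
        then have "u = c \<or> u = b1 \<or> u = b2 \<or> u = b3" "w = c \<or> w = b1 \<or> w = b2 \<or> w = b3" using Vc uw by blast+
        then show ?thesis using F uw(3) by (elim disjE) simp_all
      next
        case 2
        then have "w = c \<or> w = b1 \<or> w = b2 \<or> w = b3" using Vc uw by blast
        then show ?thesis using F FT[OF 2(1)] uw(3) by (elim disjE) (simp_all split: if_splits)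
      next
        case 3
        then have "u = c \<or> u = b1 \<or> u = b2 \<or> u = b3" using Vc uw by blast
        then show ?thesis using F FT[OF 3(2)] uw(3) by (elim disjE) (simp_all split: if_splits)
      next
        case 4
        then have "p u = p w" using FT[OF 4(1)] FT[OF 4(2)] pT[OF 4(1)] pT[OF 4(2)] uw(3) by (auto split: if_splits)
        then show ?thesis using inj_on_eq_iff[OF pinj 4] by simp
      qed
    qed
    have "F u \<in> verts S122" for u by (simp add: F_def verts_S122)
    then have "induced_subgraph_of G S122"
      unfolding induced_subgraph_of_iff using inj adj by blast
    then show ?thesis using Eb b b12(2) by blast
  qed
qed

end

text \<open>\<open>X\<close> has a triangle, so \<open>Y\<close> must lie in the triangle-free
  families. If \<open>Y\<close> is not P5 it contains a claw, and the claw-free long nets then have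
  to contain \<open>X\<close>.\<close>

lemma forbidden_pair_of_K_h:
  fixes X :: "'a ugraph" and Y :: "'b ugraph"
  assumes X: "simple_graph X" "connected_graph X" "3 \<le> card (verts X)"
    "\<not> graph_iso X (path_graph 3)" "\<not> graph_iso X (path_graph 4)"
    and Y: "simple_graph Y" "connected_graph Y" "3 \<le> card (verts Y)"
    "\<not> graph_iso Y (path_graph 3)" "\<not> graph_iso Y (path_graph 4)"
    and bound: "\<forall>G::nat ugraph. simple_graph G \<and> connected_graph G \<and> pair_free X Y G \<longrightarrow> rvc G \<le> diam G + k"
    and K_h: "induced_subgraph_of X (K_h t)"
  shows "graph_iso Y (path_graph 5) \<or> (induced_subgraph_of Y S122 \<and> induced_subgraph_of X net)"
proof -
  interpret X: cgraph X by unfold_locales (use X in auto)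
  interpret Y: cgraph Y by unfold_locales (use Y in auto)
  have tri: "\<not> triangle_free X"
    using X.K_h_triangle[OF K_h X(3-5)] unfolding triangle_free_def by blast
  \<comment> \<open>This star has \<open>k + 6\<close> vertices, while the diameter with pendants is
    at most 4.\<close>
  let ?S = "attach_pendants (star (k + 5))"
  have S_free: "triangle_free ?S" by (rule triangle_free_attach_pendants[OF triangle_free_star simple_star])
  have "induced_subgraph_of X ?S \<or> induced_subgraph_of Y ?S"
  proof (rule induced_subgraph_of_large_rvc[OF bound])
    have card: "2 \<le> card (verts (star (k + 5)))" by simp
    note L = large_rvc_attach_pendants[OF simple_star card star_walk]
    show "simple_graph ?S" "connected_graph ?S" by (rule L; simp)+
    have "diam ?S \<le> 4" "k + 6 \<le> rvc ?S" using L(3,4) by simp_all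
    then show "diam ?S + k < rvc ?S" by simp
  qed
  then have YS: "induced_subgraph_of Y ?S"
    using triangle_free_induced_subgraph[OF _ X(1) S_free] tri by blast
  \<comment> \<open>The \<open>2 * k + 10\<close> cut vertices exceed the diameter bound
    \<open>k + 7\<close> by \<open>k + 3\<close>.\<close>
  let ?C = "attach_pendants (cycle (2 * (k + 5)))"
  have C_free: "triangle_free ?C"
    by (rule triangle_free_attach_pendants[OF triangle_free_cycle simple_cycle]) simp
  have "induced_subgraph_of X ?C \<or> induced_subgraph_of Y ?C"
  proof (rule induced_subgraph_of_large_rvc[OF bound])
    have card: "2 \<le> card (verts (cycle (2 * (k + 5))))" by simp
    note L = large_rvc_attach_pendants[OF simple_cycle card cycle_walk]
    show "simple_graph ?C" "connected_graph ?C" by (rule L; simp)+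
    have "diam ?C \<le> k + 5 + 2" "2 * (k + 5) \<le> rvc ?C" using L(3,4) by simp_all
    then show "diam ?C + k < rvc ?C" by simp
  qed
  then have YC: "induced_subgraph_of Y ?C"
    using triangle_free_induced_subgraph[OF _ X(1) C_free] tri by blast
  have Y_free: "triangle_free Y" by (rule triangle_free_induced_subgraph[OF YS Y(1) S_free])
  from Y.P5_or_S122[OF Y(3-5) YS YC Y_free] show ?thesis
  proof (elim disjE conjE exE)
    fix w x y z
    assume Y_S122: "induced_subgraph_of Y S122"
      and w: "adj Y w x" "adj Y w y" "adj Y w z" "x \<noteq> y" "x \<noteq> z" "y \<noteq> z"
    \<comment> \<open>With legs of length \<open>k + 2\<close>, the lower bound
      \<open>3 * k + 6\<close> exceeds the diameter bound \<open>2 * k + 5\<close> by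
      \<open>k + 1\<close>.\<close>
    let ?N = "long_net (k + 2)"
    have "induced_subgraph_of X ?N \<or> induced_subgraph_of Y ?N"
    proof (rule induced_subgraph_of_large_rvc[OF bound simple_long_net])
      have n: "1 \<le> k + 2" by simp
      show "connected_graph ?N" by (rule large_rvc_long_net[OF n])
      show "diam ?N + k < rvc ?N" using large_rvc_long_net(2,3)[OF n] by simp
    qed
    moreover have "\<not> induced_subgraph_of Y ?N"
    proof
      assume "induced_subgraph_of Y ?N"
      then obtain f where f: "inj_on f (verts Y)"
        "\<forall>u\<in>verts Y. \<forall>v\<in>verts Y. adj Y u v \<longleftrightarrow> adj ?N (f u) (f v)"
        unfolding induced_subgraph_of_iff by blast
      have V: "w \<in> verts Y" "x \<in> verts Y" "y \<in> verts Y" "z \<in> verts Y"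
        using Y.E_in[OF w(1)] Y.E_in[OF w(2)] Y.E_in[OF w(3)] by simp_all
      have "\<not> adj Y x y" "\<not> adj Y x z" "\<not> adj Y y z" using Y_free w(1-3) unfolding triangle_free_def by blast+
      then show False
        using long_net_claw_free[of "k + 2" "f w" "f x" "f y" "f z"] f(2) V w inj_on_eq_iff[OF f(1)] by auto
    qed
    ultimately have "induced_subgraph_of X ?N" by blast
    then obtain f where f: "\<forall>u\<in>verts X. \<forall>v\<in>verts X. adj X u v \<longleftrightarrow> adj ?N (f u) (f v)"
      unfolding induced_subgraph_of_iff by blast
    have "adj ?N (f u) (f v)" if "adj X u v" for u v using f X.E_in[OF that] that by blast
    then have "induced_subgraph_of X net"
      using X.induced_net_of_K_h[OF K_h] X(3) long_net_K4_free by (metis Suc_leD eval_nat_numeral(3))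
    then show ?thesis using Y_S122 by blast
  qed blast
qed

theorem theorem6:
  fixes X :: "'a ugraph" and Y :: "'b ugraph"
  assumes "simple_graph X" and "connected_graph X" and "card (verts X) \<ge> 3"
    and "simple_graph Y" and "connected_graph Y" and "card (verts Y) \<ge> 3"
    and "\<not> graph_iso X (path_graph 3)" and "\<not> graph_iso X (path_graph 4)"
    and "\<not> graph_iso Y (path_graph 3)" and "\<not> graph_iso Y (path_graph 4)"
  shows "(\<exists>k::nat. \<forall>G::nat ugraph.
            simple_graph G \<and> connected_graph G \<and> pair_free X Y G \<longrightarrow> rvc G \<le> diam G + k)
     \<longleftrightarrow>
         ((graph_iso X (path_graph 5) \<and> (\<exists>t\<ge>4. induced_subgraph_of Y (K_h t)))
        \<or> (induced_subgraph_of X S122 \<and> induced_subgraph_of Y net)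
        \<or> (graph_iso Y (path_graph 5) \<and> (\<exists>t\<ge>4. induced_subgraph_of X (K_h t)))
        \<or> (induced_subgraph_of Y S122 \<and> induced_subgraph_of X net))"
    (is "?bounded \<longleftrightarrow> ?pairs")
proof
  assume ?bounded
  then obtain k where bound: "\<forall>G::nat ugraph. simple_graph G \<and> connected_graph G \<and> pair_free X Y G \<longrightarrow>
    rvc G \<le> diam G + k" by blast
  then have bound': "\<forall>G::nat ugraph. simple_graph G \<and> connected_graph G \<and> pair_free Y X G \<longrightarrow>
    rvc G \<le> diam G + k" by (auto simp: pair_free_def)
  \<comment> \<open>The diameter is at most 3, so \<open>k + 4\<close> cut vertices just suffice;
    this index is also at least 4, as the right-hand side demands.\<close>
  have "induced_subgraph_of X (K_h (k + 4)) \<or> induced_subgraph_of Y (K_h (k + 4))"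
  proof (rule induced_subgraph_of_large_rvc[OF bound])
    have card: "2 \<le> card (verts (complete_graph (k + 4)))" by simp
    note L = large_rvc_attach_pendants[OF simple_complete_graph card complete_graph_walk]
    show "simple_graph (K_h (k + 4))" "connected_graph (K_h (k + 4))" unfolding K_h_def by (rule L; simp)+
    have "diam (K_h (k + 4)) \<le> 3" "k + 4 \<le> rvc (K_h (k + 4))" unfolding K_h_def using L(3,4) by simp_all
    then show "diam (K_h (k + 4)) + k < rvc (K_h (k + 4))" by simp
  qed
  then show ?pairs
  proof
    assume X: "induced_subgraph_of X (K_h (k + 4))"
    have "4 \<le> k + 4" by simp
    then show ?thesis
      using forbidden_pair_of_K_h[OF assms(1-3,7,8,4-6,9,10) bound X] X by blast
  next
    assume Y: "induced_subgraph_of Y (K_h (k + 4))"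
    have "4 \<le> k + 4" by simp
    then show ?thesis
      using forbidden_pair_of_K_h[OF assms(4-6,9,10,1-3,7,8) bound' Y] Y by blast
  qed
next
  assume ?pairs
  then show ?bounded
  proof (elim disjE conjE exE)
    fix t assume *: "graph_iso X (path_graph 5)" "induced_subgraph_of Y (K_h t)"
    obtain k where "\<forall>G::nat ugraph. simple_graph G \<longrightarrow> connected_graph G \<longrightarrow>
      \<not> induced_subgraph_of (path_graph 5) G \<longrightarrow> \<not> induced_subgraph_of (K_h t) G \<longrightarrow> rvc G \<le> diam G + k"
      using rvc_bound_P5_K_h by blast
    \<comment> \<open>A graph containing P5 contains \<open>X\<close>, and one containing
      \<open>K_h t\<close> contains \<open>Y\<close>; so a graph free of the given pair is free of
      the maximal pair, whose bound it inherits.\<close>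
    then show ?thesis
      using induced_subgraph_of_trans[OF induced_subgraph_of_iso[OF *(1)]] induced_subgraph_of_trans[OF *(2)]
      unfolding pair_free_def by blast
  next
    fix t assume *: "graph_iso Y (path_graph 5)" "induced_subgraph_of X (K_h t)"
    obtain k where "\<forall>G::nat ugraph. simple_graph G \<longrightarrow> connected_graph G \<longrightarrow>
      \<not> induced_subgraph_of (path_graph 5) G \<longrightarrow> \<not> induced_subgraph_of (K_h t) G \<longrightarrow> rvc G \<le> diam G + k"
      using rvc_bound_P5_K_h by blast
    then show ?thesis
      using induced_subgraph_of_trans[OF induced_subgraph_of_iso[OF *(1)]] induced_subgraph_of_trans[OF *(2)]
      unfolding pair_free_def by blast
  next
    assume *: "induced_subgraph_of X S122" "induced_subgraph_of Y net"
    obtain k where "\<forall>G::nat ugraph. simple_graph G \<longrightarrow> connected_graph G \<longrightarrow>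
      \<not> induced_subgraph_of S122 G \<longrightarrow> \<not> induced_subgraph_of net G \<longrightarrow> rvc G \<le> diam G + k"
      using rvc_bound_S122_net by blast
    then show ?thesis
      using induced_subgraph_of_trans[OF *(1)] induced_subgraph_of_trans[OF *(2)]
      unfolding pair_free_def by blast
  next
    assume *: "induced_subgraph_of Y S122" "induced_subgraph_of X net"
    obtain k where "\<forall>G::nat ugraph. simple_graph G \<longrightarrow> connected_graph G \<longrightarrow>
      \<not> induced_subgraph_of S122 G \<longrightarrow> \<not> induced_subgraph_of net G \<longrightarrow> rvc G \<le> diam G + k"
      using rvc_bound_S122_net by blast
    then show ?thesis
      using induced_subgraph_of_trans[OF *(1)] induced_subgraph_of_trans[OF *(2)]
      unfolding pair_free_def by blast
  qed
qed

end
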